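(* Let $a\in X(\Omega)$ and let $\Lambda_a$ be the associated Dirichlet-to-Neumann operator. Let $\mu$ be any finite measure with finite second moment on $H^{1/2}(\partial\Omega)$. Then for every $\varepsilon>0$ there exists a DeepONet $F^{\theta}_\varepsilon\colon H^{1/2}(\partial\Omega)\to H^{-1/2}(\partial\Omega)$ such that $$\int_{H^{1/2}(\partial\Omega)}\|\Lambda_a f-F^{\theta}_\varepsilon f\|_{H^{-1/2}(\partial\Omega)}^2\,\mu(df)<\varepsilon .$$
   Context: $\Omega\subset\mathbb R^d$, $d\ge 2$, is a bounded smooth domain. $H^{1/2}(\partial\Omega)$ is the (Hilbert) trace space of $H^1(\Omega)$ and $H^{-1/2}(\partial\Omega)$ is its dual. Measures are Borel measures. A finite measure $\mu$ on $H^{1/2}(\partial\Omega)$ has finite second moment if $\int (1+\|f\|^2_{H^{1/2}(\partial\Omega)})\,\mu(df)<\infty$. Admissible conductivities: $X(\Omega)=\{a\in L^\infty(\Omega):\ \exists\, a_0>0 \text{ with } a\ge a_0 \text{ a.e.}\}$. Dirichlet-to-Neumann operator: for $a\in X(\Omega)$ and $f\in H^{1/2}(\partial\Omega)$ let $u\in H^1(\Omega)$ be the unique weak solution of $\operatorname{div}(a\nabla u)=0$ in $\Omega$, $u|_{\partial\Omega}=f$ (i.e. $\int_\Omega a\nabla u\cdot\nabla w\,dx=0$ for all $w\in H^1_0(\Omega)$, boundary value in the trace sense). Then $\Lambda_a f\in H^{-1/2}(\partial\Omega)$ is defined by $(\Lambda_a f)(g)=\int_\Omega a\nabla u\cdot\nabla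 v\,dx$ for $g\in H^{1/2}(\partial\Omega)$, where $v\in H^1(\Omega)$ is any function with $v|_{\partial\Omega}=g$. This is well defined, and $\Lambda_a$ is a bounded linear operator $H^{1/2}(\partial\Omega)\to H^{-1/2}(\partial\Omega)$. Neural networks and DeepONets: fix a continuous, non-polynomial activation function $\sigma:\mathbb R\to\mathbb R$, applied componentwise to vectors. A neural network with input dimension $p$ and output dimension $q$ is a finite tuple $\theta=(A_1,\dots,A_L)$, $L\in\mathbb N$, of affine maps $A_j:\mathbb R^{d_j}\to\mathbb R^{d_{j+1}}$ with $d_1=p$, $d_{L+1}=q$; its realization is $f^\theta=A_L\circ\sigma\circ A_{L-1}\circ\sigma\circ\cdots\circ\sigma\circ A_1:\mathbb R^p\to\mathbb R^q$. For separable Hilbert spaces $H,W$ with fixed orthonormal bases $(e_i)$ of $H$ and $(g_i)$ of $W$, let $P_{H,p}:H\to\mathbb R^p$, $P_{H,p}x=(\langle x,e_i\rangle_H)_{i=1}^p$ (with $p\le\dim H$) and $E_{W,q}:\mathbb R^q\to W$, $E_{W,q}b=\sum_{i=1}^q b_ig_i$ (with $q\le \dim W$). A DeepONet $H\to W$ is a map of the form $E_{W,q}\circ f^\theta\circ P_{H,p}$ for some $p,q\in\mathbb N$ and some neural network $\theta$ with input dimension $p$ and output dimension $q$. *)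

theory Defs
  imports "HOL-Analysis.Analysis" "HOL-Computational_Algebra.Polynomial"
    "Jordan_Normal_Form.Matrix"
begin

section \<open>Smooth bounded domains\<close>

primrec C_diff :: "nat \<Rightarrow> ('a::euclidean_space \<Rightarrow> real) \<Rightarrow> bool" where
  "C_diff 0 f \<longleftrightarrow> continuous_on UNIV f"
| "C_diff (Suc k) f \<longleftrightarrow> (\<forall>x. f differentiable (at x)) \<and>
     (\<forall>b\<in>Basis. C_diff k (\<lambda>x. frechet_derivative f (at x) b))"

definition smooth :: "('a::euclidean_space \<Rightarrow> real) \<Rightarrow> bool" where
  "smooth f \<longleftrightarrow> (\<forall>k. C_diff k f)"

text \<open>Near each boundary point the domain is, after a rotation, the part of a ball above the
  graph of a smooth function of \<open>d - 1\<close> variables. That \<open>\<gamma>\<close> is a function on the hyperplane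
  orthogonal to the unit vector \<open>n\<close> is expressed by its invariance under translations along
  \<open>n\<close>.\<close>

definition smooth_bounded_domain :: "'a::euclidean_space set \<Rightarrow> bool" where
  "smooth_bounded_domain \<Omega> \<longleftrightarrow>
     open \<Omega> \<and> connected \<Omega> \<and> \<Omega> \<noteq> {} \<and> bounded \<Omega> \<and>
     (\<forall>x0 \<in> frontier \<Omega>. \<exists>r>0. \<exists>n \<gamma>. norm n = 1 \<and> smooth \<gamma> \<and>
        (\<forall>x t. \<gamma> (x + t *\<^sub>R n) = \<gamma> x) \<and>
        \<Omega> \<inter> ball x0 r = {x \<in> ball x0 r. inner x n > \<gamma> x})"

text \<open>Hausdorff measure of dimension \<open>s\<close> (used for \<open>s \<ge> 1\<close> only), normalised to agree with
  the \<open>s\<close>-dimensional Lebesgue measure. The condition \<open>bounded\<close> is needed because \<open>diameter\<close>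
  is unspecified on unbounded sets.\<close>

definition hausdorff_delta :: "nat \<Rightarrow> real \<Rightarrow> 'a::euclidean_space set \<Rightarrow> ennreal" where
  "hausdorff_delta s \<delta> A =
     (INF C \<in> {C :: nat \<Rightarrow> 'a set. A \<subseteq> (\<Union>i. C i) \<and> (\<forall>i. bounded (C i) \<and> diameter (C i) \<le> \<delta>)}.
        \<Sum>i. ennreal (unit_ball_vol (real s) * (diameter (C i) / 2) ^ s))"

definition hausdorff :: "nat \<Rightarrow> 'a::euclidean_space set \<Rightarrow> ennreal" where
  "hausdorff s A = (SUP \<delta> \<in> {0<..}. hausdorff_delta s \<delta> A)"

definition surface_measure :: "'a::euclidean_space set \<Rightarrow> 'a measure" where
  "surface_measure \<Omega> = measure_of (frontier \<Omega>)
     (sets (restrict_space borel (frontier \<Omega>))) (hausdorff (DIM('a) - 1))"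

section \<open>Sobolev functions\<close>

definition L2 :: "'a measure \<Rightarrow> ('a \<Rightarrow> 'b::euclidean_space) set" where
  "L2 M = {f \<in> borel_measurable M. integrable M (\<lambda>x. (norm (f x))\<^sup>2)}"

definition test_functions :: "'a::euclidean_space set \<Rightarrow> ('a \<Rightarrow> real) set" where
  "test_functions \<Omega> = {\<phi>. smooth \<phi> \<and>
     compact (closure {x. \<phi> x \<noteq> 0}) \<and> closure {x. \<phi> x \<noteq> 0} \<subseteq> \<Omega>}"

definition is_weak_grad ::
    "'a::euclidean_space set \<Rightarrow> ('a \<Rightarrow> real) \<Rightarrow> ('a \<Rightarrow> 'a) \<Rightarrow> bool" where
  "is_weak_grad \<Omega> u G \<longleftrightarrow> G \<in> L2 (lebesgue_on \<Omega>) \<and>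
     (\<forall>\<phi> \<in> test_functions \<Omega>. \<forall>b\<in>Basis.
        (LINT x|lebesgue_on \<Omega>. u x * frechet_derivative \<phi> (at x) b)
          = - (LINT x|lebesgue_on \<Omega>. inner (G x) b * \<phi> x))"

text \<open>Elements of \<open>L\<^sup>2(\<Omega>)\<close> and \<open>H\<^sup>1(\<Omega>)\<close> are represented by functions; only their
  behaviour almost everywhere on \<open>\<Omega>\<close> is used. The weak gradient is unique almost
  everywhere.\<close>

definition H1 :: "'a::euclidean_space set \<Rightarrow> ('a \<Rightarrow> real) set" where
  "H1 \<Omega> = {u \<in> L2 (lebesgue_on \<Omega>). \<exists>G. is_weak_grad \<Omega> u G}"

definition wgrad :: "'a::euclidean_space set \<Rightarrow> ('a \<Rightarrow> real) \<Rightarrow> 'a \<Rightarrow> 'a" where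
  "wgrad \<Omega> u = (SOME G. is_weak_grad \<Omega> u G)"

definition H1_norm :: "'a::euclidean_space set \<Rightarrow> ('a \<Rightarrow> real) \<Rightarrow> real" where
  "H1_norm \<Omega> u = sqrt ((LINT x|lebesgue_on \<Omega>. (u x)\<^sup>2)
     + (LINT x|lebesgue_on \<Omega>. (norm (wgrad \<Omega> u x))\<^sup>2))"

text \<open>The trace operator \<open>H\<^sup>1(\<Omega>) \<rightarrow> L\<^sup>2(\<partial>\<Omega>)\<close> is the continuous extension of the restriction
  \<open>\<phi> \<mapsto> \<phi>|\<^bsub>\<partial>\<Omega>\<^esub>\<close> of functions \<open>\<phi>\<close> that are smooth up to the boundary. It is given here by its
  graph; \<open>f\<close> is determined by \<open>u\<close> up to a null set of the surface measure, and its values off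
  the boundary are irrelevant.\<close>

definition has_trace ::
    "'a::euclidean_space set \<Rightarrow> ('a \<Rightarrow> real) \<Rightarrow> ('a \<Rightarrow> real) \<Rightarrow> bool" where
  "has_trace \<Omega> u f \<longleftrightarrow> u \<in> H1 \<Omega> \<and> f \<in> L2 (surface_measure \<Omega>) \<and>
     (\<exists>\<phi> :: nat \<Rightarrow> 'a \<Rightarrow> real. (\<forall>n. smooth (\<phi> n)) \<and>
        (\<lambda>n. H1_norm \<Omega> (\<lambda>x. \<phi> n x - u x)) \<longlonglongrightarrow> 0 \<and>
        (\<lambda>n. \<integral>\<^sup>+x. ennreal ((\<phi> n x - f x)\<^sup>2) \<partial>surface_measure \<Omega>) \<longlonglongrightarrow> 0)"

definition H1_0 :: "'a::euclidean_space set \<Rightarrow> ('a \<Rightarrow> real) set" where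
  "H1_0 \<Omega> = {w \<in> H1 \<Omega>. has_trace \<Omega> w (\<lambda>x. 0)}"

section \<open>Hilbert spaces with explicit carrier\<close>

text \<open>The trace space depends on the domain, so it cannot be a type. In a Hilbert space the
  inner product is recovered from the norm by polarization.\<close>

record 'v hspace =
  vecs :: "'v set"
  vzero :: 'v
  vadd :: "'v \<Rightarrow> 'v \<Rightarrow> 'v"
  vscale :: "real \<Rightarrow> 'v \<Rightarrow> 'v"
  vnorm :: "'v \<Rightarrow> real"

definition vdiff :: "'v hspace \<Rightarrow> 'v \<Rightarrow> 'v \<Rightarrow> 'v" where
  "vdiff H x y = vadd H x (vscale H (-1) y)"

definition vinner :: "'v hspace \<Rightarrow> 'v \<Rightarrow> 'v \<Rightarrow> real" where
  "vinner H x y = ((vnorm H (vadd H x y))\<^sup>2 - (vnorm H (vdiff H x y))\<^sup>2) / 4"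

primrec lincomb :: "'v hspace \<Rightarrow> (nat \<Rightarrow> 'v) \<Rightarrow> (nat \<Rightarrow> real) \<Rightarrow> nat \<Rightarrow> 'v" where
  "lincomb H e c 0 = vzero H"
| "lincomb H e c (Suc n) = vadd H (lincomb H e c n) (vscale H (c n) (e n))"

text \<open>Bases are indexed by all natural numbers, since the trace space of a domain in dimension
  at least 2, and hence its dual, is infinite-dimensional and separable.\<close>

definition orthonormal_basis :: "'v hspace \<Rightarrow> (nat \<Rightarrow> 'v) \<Rightarrow> bool" where
  "orthonormal_basis H e \<longleftrightarrow> range e \<subseteq> vecs H \<and>
     (\<forall>i j. vinner H (e i) (e j) = (if i = j then 1 else 0)) \<and>
     (\<forall>x \<in> vecs H. \<forall>\<epsilon>>0. \<exists>n c. vnorm H (vdiff H x (lincomb H e c n)) < \<epsilon>)"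

definition bounded_functional :: "'v hspace \<Rightarrow> ('v \<Rightarrow> real) \<Rightarrow> bool" where
  "bounded_functional H l \<longleftrightarrow>
     (\<forall>x \<in> vecs H. \<forall>y \<in> vecs H. l (vadd H x y) = l x + l y) \<and>
     (\<forall>c. \<forall>x \<in> vecs H. l (vscale H c x) = c * l x) \<and>
     (\<exists>C. \<forall>x \<in> vecs H. \<bar>l x\<bar> \<le> C * vnorm H x)"

definition dual_space :: "'v hspace \<Rightarrow> ('v \<Rightarrow> real) hspace" where
  "dual_space H = \<lparr>
     vecs = {l \<in> extensional (vecs H). bounded_functional H l},
     vzero = (\<lambda>x \<in> vecs H. 0),
     vadd = (\<lambda>l m. \<lambda>x \<in> vecs H. l x + m x),
     vscale = (\<lambda>c l. \<lambda>x \<in> vecs H. c * l x),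
     vnorm = (\<lambda>l. SUP x \<in> {x \<in> vecs H. vnorm H x \<le> 1}. \<bar>l x\<bar>) \<rparr>"

definition borel_of :: "'v hspace \<Rightarrow> 'v measure" where
  "borel_of H = sigma (vecs H)
     {U. U \<subseteq> vecs H \<and>
         (\<forall>x \<in> U. \<exists>r>0. \<forall>y \<in> vecs H. vnorm H (vdiff H y x) < r \<longrightarrow> y \<in> U)}"

section \<open>The trace space and the Dirichlet-to-Neumann operator\<close>

definition bdry_class :: "'a::euclidean_space set \<Rightarrow> ('a \<Rightarrow> real) \<Rightarrow> ('a \<Rightarrow> real) set" where
  "bdry_class \<Omega> f = {g \<in> L2 (surface_measure \<Omega>). AE x in surface_measure \<Omega>. g x = f x}"

text \<open>\<open>H\<^sup>1\<^sup>/\<^sup>2(\<partial>\<Omega>)\<close>: its elements are the classes in \<open>L\<^sup>2(\<partial>\<Omega>)\<close> of traces of \<open>H\<^sup>1\<close>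
  functions, normed by the least \<open>H\<^sup>1\<close> norm of an extension to \<open>\<Omega>\<close>.\<close>

definition trace_space :: "'a::euclidean_space set \<Rightarrow> ('a \<Rightarrow> real) set hspace" where
  "trace_space \<Omega> = \<lparr>
     vecs = {bdry_class \<Omega> f | f. \<exists>u \<in> H1 \<Omega>. has_trace \<Omega> u f},
     vzero = bdry_class \<Omega> (\<lambda>x. 0),
     vadd = (\<lambda>F G. \<Union>f\<in>F. \<Union>g\<in>G. bdry_class \<Omega> (\<lambda>x. f x + g x)),
     vscale = (\<lambda>c F. \<Union>f\<in>F. bdry_class \<Omega> (\<lambda>x. c * f x)),
     vnorm = (\<lambda>F. Inf {H1_norm \<Omega> u | u. u \<in> H1 \<Omega> \<and> (\<exists>f\<in>F. has_trace \<Omega> u f)}) \<rparr>"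

definition admissible :: "'a::euclidean_space set \<Rightarrow> ('a \<Rightarrow> real) set" where
  "admissible \<Omega> = {a \<in> borel_measurable (lebesgue_on \<Omega>).
     (\<exists>C. AE x in lebesgue_on \<Omega>. \<bar>a x\<bar> \<le> C) \<and>
     (\<exists>a0>0. AE x in lebesgue_on \<Omega>. a0 \<le> a x)}"

definition energy ::
    "'a::euclidean_space set \<Rightarrow> ('a \<Rightarrow> real) \<Rightarrow> ('a \<Rightarrow> real) \<Rightarrow> ('a \<Rightarrow> real) \<Rightarrow> real" where
  "energy \<Omega> a u v = (LINT x|lebesgue_on \<Omega>. a x * inner (wgrad \<Omega> u x) (wgrad \<Omega> v x))"

definition weak_solution ::
    "'a::euclidean_space set \<Rightarrow> ('a \<Rightarrow> real) \<Rightarrow> ('a \<Rightarrow> real) set \<Rightarrow> ('a \<Rightarrow> real) \<Rightarrow> bool" where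
  "weak_solution \<Omega> a F u \<longleftrightarrow> u \<in> H1 \<Omega> \<and> (\<exists>f\<in>F. has_trace \<Omega> u f) \<and>
     (\<forall>w \<in> H1_0 \<Omega>. energy \<Omega> a u w = 0)"

text \<open>The solution \<open>u\<close> is unique up to a null set, and the value does not depend on the
  extension \<open>v\<close> of the argument.\<close>

definition DtN ::
    "'a::euclidean_space set \<Rightarrow> ('a \<Rightarrow> real) \<Rightarrow> ('a \<Rightarrow> real) set \<Rightarrow> (('a \<Rightarrow> real) set \<Rightarrow> real)" where
  "DtN \<Omega> a F = (\<lambda>G \<in> vecs (trace_space \<Omega>).
     energy \<Omega> a (SOME u. weak_solution \<Omega> a F u)
       (SOME v. v \<in> H1 \<Omega> \<and> (\<exists>g\<in>G. has_trace \<Omega> v g)))"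

section \<open>Neural networks and DeepONets\<close>

text \<open>The pair \<open>(A, b)\<close> is the affine map \<open>x \<mapsto> A x + b\<close>; all widths are positive.\<close>

type_synonym network = "(real mat \<times> real Matrix.vec) list"

fun is_network :: "nat \<Rightarrow> nat \<Rightarrow> network \<Rightarrow> bool" where
  "is_network p q [] \<longleftrightarrow> False"
| "is_network p q [(A, b)] \<longleftrightarrow> 0 < p \<and> 0 < q \<and> A \<in> carrier_mat q p \<and> b \<in> carrier_vec q"
| "is_network p q ((A, b) # l # ls) \<longleftrightarrow> 0 < p \<and>
     (\<exists>k. A \<in> carrier_mat k p \<and> b \<in> carrier_vec k \<and> is_network k q (l # ls))"

fun realization :: "(real \<Rightarrow> real) \<Rightarrow> network \<Rightarrow> real Matrix.vec \<Rightarrow> real Matrix.vec" where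
  "realization \<sigma> [] x = x"
| "realization \<sigma> [(A, b)] x = A *\<^sub>v x + b"
| "realization \<sigma> ((A, b) # l # ls) x = realization \<sigma> (l # ls) (map_vec \<sigma> (A *\<^sub>v x + b))"

definition encode :: "'v hspace \<Rightarrow> (nat \<Rightarrow> 'v) \<Rightarrow> nat \<Rightarrow> 'v \<Rightarrow> real Matrix.vec" where
  "encode H e p x = Matrix.vec p (\<lambda>i. vinner H x (e i))"

definition decode :: "'w hspace \<Rightarrow> (nat \<Rightarrow> 'w) \<Rightarrow> nat \<Rightarrow> real Matrix.vec \<Rightarrow> 'w" where
  "decode W g q b = lincomb W g (\<lambda>i. vec_index b i) q"

definition deeponets ::
    "(real \<Rightarrow> real) \<Rightarrow> 'v hspace \<Rightarrow> (nat \<Rightarrow> 'v) \<Rightarrow> 'w hspace \<Rightarrow> (nat \<Rightarrow> 'w) \<Rightarrow> ('v \<Rightarrow> 'w) set" where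
  "deeponets \<sigma> H e W g =
     {decode W g q \<circ> realization \<sigma> \<theta> \<circ> encode H e p | p q \<theta>. is_network p q \<theta>}"

end

theory Submission
  imports Defs
begin

text \<open>A network with a single affine layer is allowed, so a DeepONet can realise
  \<open>Q \<circ> \<Lambda>\<^sub>a \<circ> P\<close> exactly, where \<open>P\<close> is the orthogonal projection onto the span of the first \<open>p\<close> basis
  vectors and \<open>Q\<close> replaces each \<open>\<Lambda>\<^sub>a e\<^sub>i\<close> by a nearby linear combination of the \<open>g\<^sub>j\<close>. Since
  \<open>\<Lambda>\<^sub>a\<close> is bounded and linear, \<open>\<parallel>\<Lambda>\<^sub>a f - \<Lambda>\<^sub>a P f\<parallel>\<close> tends to 0 pointwise and is dominated by a
  multiple of \<open>\<parallel>f\<parallel>\<close>, and dominated convergence gives convergence in mean square.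

  That \<open>\<Lambda>\<^sub>a\<close> is bounded and linear and that the quotient norm of the trace space comes from an
  inner product both follow from orthogonal projection onto \<open>H\<^sup>1\<^sub>0\<close>, for the energy and for the
  \<open>H\<^sup>1\<close> inner product. The projection exists because \<open>H\<^sup>1\<^sub>0\<close> is closed by its definition and the
  energy is coercive on it by Friedrichs' inequality. The latter is obtained by integrating along
  lines in a coordinate direction up to the first exit point from the domain: the set of points
  that exit through a part of the boundary lies in a cylinder over that part, so its volume is
  controlled by the Hausdorff measure of the part.\<close>

section \<open>Semi-inner products\<close>

text \<open>Functions on the domain and on its boundary are handled as representatives, so every
  form in use is only semidefinite. Weak solutions and minimal extensions are therefore determined
  only up to vectors of length zero, and linearity of an arbitrarily chosen solution can be stated
  only for values of the form. Membership in \<open>H1_0\<close> means approximation by functions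
  smooth on the whole space whose boundary values tend to zero in mean square. This term has to be
  an integral against the surface measure, which is why volume is compared with Hausdorff measure.
  Only an upper bound for the volume is wanted, and covers give such a bound directly.\<close>

locale semi_ip =
  fixes V :: "'v set" and add :: "'v \<Rightarrow> 'v \<Rightarrow> 'v" and scl :: "real \<Rightarrow> 'v \<Rightarrow> 'v"
    and B :: "'v \<Rightarrow> 'v \<Rightarrow> real"
  assumes add_closed [simp]: "\<And>x y. x \<in> V \<Longrightarrow> y \<in> V \<Longrightarrow> add x y \<in> V"
    and scl_closed [simp]: "\<And>c x. x \<in> V \<Longrightarrow> scl c x \<in> V"
    and sym: "\<And>x y. x \<in> V \<Longrightarrow> y \<in> V \<Longrightarrow> B x y = B y x"
    and add_left: "\<And>x y z. x \<in> V \<Longrightarrow> y \<in> V \<Longrightarrow> z \<in> V \<Longrightarrow> B (add x y) z = B x z + B y z"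
    and scl_left: "\<And>c x z. x \<in> V \<Longrightarrow> z \<in> V \<Longrightarrow> B (scl c x) z = c * B x z"
    and nonneg: "\<And>x. x \<in> V \<Longrightarrow> 0 \<le> B x x"
begin

lemma add_right: "x \<in> V \<Longrightarrow> y \<in> V \<Longrightarrow> z \<in> V \<Longrightarrow> B z (add x y) = B z x + B z y"
  by (metis add_closed add_left sym)

lemma scl_right: "x \<in> V \<Longrightarrow> z \<in> V \<Longrightarrow> B z (scl c x) = c * B z x"
  by (metis scl_closed scl_left sym)

definition sub :: "'v \<Rightarrow> 'v \<Rightarrow> 'v" where "sub x y = add x (scl (-1) y)"

lemma sub_closed [simp]: "x \<in> V \<Longrightarrow> y \<in> V \<Longrightarrow> sub x y \<in> V"
  by (simp add: sub_def)

lemma sub_left: "x \<in> V \<Longrightarrow> y \<in> V \<Longrightarrow> z \<in> V \<Longrightarrow> B (sub x y) z = B x z - B y z"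
  by (simp add: sub_def add_left scl_left)

lemma sub_right: "x \<in> V \<Longrightarrow> y \<in> V \<Longrightarrow> z \<in> V \<Longrightarrow> B z (sub x y) = B z x - B z y"
  by (simp add: sub_def add_right scl_right)

lemmas expand = add_left add_right scl_left scl_right sub_left sub_right

lemma quadratic: "x \<in> V \<Longrightarrow> y \<in> V \<Longrightarrow> 0 \<le> B x x + 2 * t * B x y + t\<^sup>2 * B y y"
  using nonneg[of "add x (scl t y)"]
  by (simp add: expand sym[of y x] algebra_simps power2_eq_square)

lemma Cauchy_Schwarz:
  assumes "x \<in> V" "y \<in> V"
  shows "(B x y)\<^sup>2 \<le> B x x * B y y"
proof (cases "B y y = 0")
  case True
  have "B x y = 0"
  proof (rule ccontr)
    assume nz: "B x y \<noteq> 0"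
    \<comment> \<open>With \<open>B y y = 0\<close> the quadratic is affine in \<open>t\<close>;
      this \<open>t\<close> gives it the value -1.\<close>
    show False
      using quadratic[OF assms, of "- (B x x + 1) / (2 * B x y)"] nz True by (simp add: field_simps)
  qed
  then show ?thesis by (simp add: True)
next
  case False
  then have pos: "B y y > 0" using nonneg[OF assms(2)] by simp
  then show ?thesis
    using quadratic[OF assms, of "- B x y / B y y"]
    by (simp add: field_simps power2_eq_square)
qed

definition nrm :: "'v \<Rightarrow> real" where "nrm x = sqrt (B x x)"

lemma nrm_nonneg [simp]: "x \<in> V \<Longrightarrow> 0 \<le> nrm x"
  by (simp add: nrm_def nonneg)

lemma nrm_sq: "x \<in> V \<Longrightarrow> (nrm x)\<^sup>2 = B x x"
  by (simp add: nrm_def nonneg)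

lemma abs_le_nrm: "x \<in> V \<Longrightarrow> y \<in> V \<Longrightarrow> \<bar>B x y\<bar> \<le> nrm x * nrm y"
  using Cauchy_Schwarz[of x y]
  by (simp add: nrm_def real_le_rsqrt abs_le_square_iff flip: real_sqrt_mult)

text \<open>The substitute for definiteness: the form cannot tell a vector of length zero from the
  zero vector. Uniqueness of weak solutions and of minimal extensions rests on this.\<close>

lemma degenerate: "x \<in> V \<Longrightarrow> y \<in> V \<Longrightarrow> B x x = 0 \<Longrightarrow> B x y = 0"
  using Cauchy_Schwarz[of x y] by simp

lemma nrm_add: 
  assumes "x \<in> V" "y \<in> V"
  shows "nrm (add x y) \<le> nrm x + nrm y"
proof (rule power2_le_imp_le)
  have "B x y \<le> nrm x * nrm y" using abs_le_nrm[OF assms] by linarith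
  then show "(nrm (add x y))\<^sup>2 \<le> (nrm x + nrm y)\<^sup>2"
    using assms by (simp add: nrm_sq power2_sum expand sym[of y x])
qed (use assms in simp)

lemma nrm_scl: "x \<in> V \<Longrightarrow> nrm (scl c x) = \<bar>c\<bar> * nrm x"
  by (simp add: nrm_def expand real_sqrt_mult flip: mult.assoc power2_eq_square)

lemma nrm_sub_commute: "x \<in> V \<Longrightarrow> y \<in> V \<Longrightarrow> nrm (sub x y) = nrm (sub y x)"
  by (simp add: nrm_def expand sym[of y x])

text \<open>No vector-space laws are assumed for \<open>add\<close> and \<open>scl\<close>, so the
  two vectors are compared through their norms instead of being identified.\<close>

lemma nrm_triangle:
  assumes "x \<in> V" "y \<in> V" "z \<in> V"
  shows "nrm (sub x z) \<le> nrm (sub x y) + nrm (sub y z)"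
proof -
  have "nrm (sub x z) = nrm (add (sub x y) (sub y z))"
    using assms by (simp add: nrm_def expand sym[of y x] sym[of z x] sym[of z y])
  then show ?thesis using nrm_add[of "sub x y" "sub y z"] assms by simp
qed

lemma nrm_triangle2:
  assumes "x \<in> V" "y \<in> V"
  shows "nrm x \<le> nrm y + nrm (sub x y)"
proof -
  have "nrm x = nrm (add y (sub x y))"
    using assms by (simp add: nrm_def expand sym[of y x])
  then show ?thesis using nrm_add[of y "sub x y"] assms by simp
qed

lemma nrm_add_sq: "x \<in> V \<Longrightarrow> y \<in> V \<Longrightarrow> B (add x y) (add x y) \<le> 2 * B x x + 2 * B y y"
  using nonneg[of "sub x y"] by (simp add: expand sym[of y x])

text \<open>The classical minimising sequence. Completeness is asked of \<open>N\<close> alone and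
  for the semidefinite form itself, so that coercivity on \<open>H1_0\<close> can supply it.\<close>

lemma projection:
  assumes N: "N \<subseteq> V" "N \<noteq> {}"
    and N_add: "\<And>x y. x \<in> N \<Longrightarrow> y \<in> N \<Longrightarrow> add x y \<in> N"
    and N_scl: "\<And>c x. x \<in> N \<Longrightarrow> scl c x \<in> N"
    and complete: "\<And>w. (\<And>n::nat. w n \<in> N) \<Longrightarrow>
       (\<forall>\<epsilon>>0. \<exists>k. \<forall>m\<ge>k. \<forall>n\<ge>k. B (sub (w m) (w n)) (sub (w m) (w n)) < \<epsilon>) \<Longrightarrow>
       \<exists>z\<in>N. (\<lambda>n. B (sub (w n) z) (sub (w n) z)) \<longlonglongrightarrow> 0"
    and u: "u \<in> V"
  shows "\<exists>w\<in>N. \<forall>v\<in>N. B u v = B w v"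
proof -
  let ?S = "(\<lambda>w. B (sub u w) (sub u w)) ` N"
  define d where "d = Inf ?S"
  have NV: "x \<in> N \<Longrightarrow> x \<in> V" for x using N by auto
  have bdd: "bdd_below ?S"
    by (rule bdd_belowI[of _ 0]) (use NV u nonneg in auto)
  have dle: "d \<le> B (sub u w) (sub u w)" if "w \<in> N" for w
    unfolding d_def by (rule cInf_lower[OF _ bdd]) (use that in auto)
  have "\<exists>w\<in>N. B (sub u w) (sub u w) < d + 1 / Suc n" for n
  proof -
    have "Inf ?S < d + 1 / Suc n" by (simp add: d_def)
    then show ?thesis using cInf_lessD[of ?S] N by blast
  qed
  then obtain w where w: "\<And>n. w n \<in> N" and wd: "\<And>n. B (sub u (w n)) (sub u (w n)) < d + 1 / Suc n"
    by metis
  have est: "B (sub (w m) (w n)) (sub (w m) (w n)) \<le> 2 / Suc m + 2 / Suc n" for m n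
  proof -
    \<comment> \<open>Parallelogram law: the midpoint lies in \<open>N\<close>, so its squared
      distance to \<open>u\<close> is at least \<open>d\<close>, which forces \<open>w m\<close> and
      \<open>w n\<close> together.\<close>
    let ?mid = "scl (1/2) (add (w m) (w n))"
    have "?mid \<in> N" using w N_add N_scl by auto
    from dle[OF this] have "d \<le> B (sub u ?mid) (sub u ?mid)" .
    then have "B (sub (w m) (w n)) (sub (w m) (w n)) \<le>
        2 * B (sub u (w m)) (sub u (w m)) + 2 * B (sub u (w n)) (sub u (w n)) - 4 * d"
      using u w[THEN NV] by (simp add: expand sym[of "w m" u] sym[of "w n" u] sym[of "w n" "w m"] field_simps)
    also have "\<dots> \<le> 2 * (1 / Suc m) + 2 * (1 / Suc n)" using wd[of m] wd[of n] by linarith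
    also have "\<dots> = 2 / Suc m + 2 / Suc n" by simp
    finally show ?thesis .
  qed
  have "\<exists>k. \<forall>m\<ge>k. \<forall>n\<ge>k. B (sub (w m) (w n)) (sub (w m) (w n)) < \<epsilon>" if "\<epsilon> > 0" for \<epsilon>
  proof -
    obtain k where k: "1 / Suc k < \<epsilon> / 4" 
      using reals_Archimedean[of "\<epsilon>/4"] \<open>\<epsilon> > 0\<close>
      by (metis divide_pos_pos inverse_eq_divide zero_less_numeral)
    have "B (sub (w m) (w n)) (sub (w m) (w n)) < \<epsilon>" if "m \<ge> k" "n \<ge> k" for m n
    proof -
      have "1 / real (Suc m) \<le> 1 / Suc k" "1 / real (Suc n) \<le> 1 / Suc k"
        using that by (auto intro!: divide_left_mono)
      moreover have "2 / Suc m + 2 / Suc n = 2 * (1 / real (Suc m)) + 2 * (1 / real (Suc n))" by simp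
      ultimately show ?thesis using est[of m n] k by linarith
    qed
    then show ?thesis by blast
  qed
  then obtain z where z: "z \<in> N" and lim: "(\<lambda>n. B (sub (w n) z) (sub (w n) z)) \<longlonglongrightarrow> 0"
    using complete[of w] w by blast
  have lim': "(\<lambda>n. nrm (sub (w n) z)) \<longlonglongrightarrow> 0"
    unfolding nrm_def using tendsto_real_sqrt[OF lim] by simp
  have "nrm (sub u z) \<le> sqrt (d + 1 / Suc n) + nrm (sub (w n) z)" for n
  proof -
    have "nrm (sub u (w n)) \<le> sqrt (d + 1 / Suc n)" 
      unfolding nrm_def using wd[of n] by (intro real_sqrt_le_mono) simp
    then show ?thesis using nrm_triangle[of u "w n" z] u w z NV by force
  qed
  moreover have "(\<lambda>n. sqrt (d + 1 / Suc n) + nrm (sub (w n) z)) \<longlonglongrightarrow> sqrt (d + 0) + 0"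
    using LIMSEQ_inverse_real_of_nat unfolding inverse_eq_divide
    by (intro tendsto_add tendsto_real_sqrt tendsto_const lim')
  ultimately have "nrm (sub u z) \<le> sqrt (d + 0) + 0" by (intro LIMSEQ_le_const) blast+
  then have zd: "B (sub u z) (sub u z) \<le> d" by (simp add: nrm_def)
  have "B u v = B z v" if v: "v \<in> N" for v
  proof -
    let ?x = "sub u z"
    have V: "?x \<in> V" "v \<in> V" using u z v NV by auto
    have q: "0 \<le> 2 * t * B ?x v + t\<^sup>2 * B v v" for t
    proof -
      \<comment> \<open>First variation: \<open>z - t v\<close> competes with the minimiser
        \<open>z\<close>.\<close>
      have "add z (scl (-t) v) \<in> N" using z v N_add N_scl by auto
      from dle[OF this] zd have "B ?x ?x \<le> B (sub u (add z (scl (-t) v))) (sub u (add z (scl (-t) v)))"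
        by linarith
      then show ?thesis using u z v NV 
        by (simp add: expand sym[of z u] sym[of v u] sym[of v z] algebra_simps power2_eq_square)
    qed
    \<comment> \<open>If \<open>B v v = 0\<close>, the values 1 and -1 of \<open>t\<close> suffice;
      otherwise the minimising \<open>t\<close> is inserted.\<close>
    have "B ?x v = 0"
    proof (cases "B v v = 0")
      case True
      then show ?thesis using q[of 1] q[of "-1"] by simp
    next
      case False
      then have pos: "B v v > 0" using nonneg V by (simp add: order_less_le)
      have "0 \<le> - (B ?x v)\<^sup>2 / B v v"
        using q[of "- B ?x v / B v v"] pos by (simp add: field_simps power2_eq_square)
      then have "(B ?x v)\<^sup>2 \<le> 0" using pos by (simp add: field_simps)
      then show ?thesis by simp
    qed
    then show ?thesis using u z v NV by (simp add: expand)
  qed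
  then show ?thesis using z by blast
qed

end

section \<open>Dual norms and linear DeepONets\<close>

text \<open>The record stores only a norm, so the form is a parameter; once \<open>vnorm_eq\<close>
  holds, polarization gives the same form back.\<close>

locale semi_hspace = semi_ip "vecs H" "vadd H" "vscale H" ip
  for H :: "'v hspace" and ip +
  assumes zero_closed [simp]: "vzero H \<in> vecs H"
    and zero_left: "\<And>x. x \<in> vecs H \<Longrightarrow> ip (vzero H) x = 0"
    and vnorm_eq: "\<And>x. x \<in> vecs H \<Longrightarrow> vnorm H x = sqrt (ip x x)"
begin

lemma vnorm_nrm: "x \<in> vecs H \<Longrightarrow> vnorm H x = nrm x"
  by (simp add: vnorm_eq nrm_def)

lemma vdiff_sub: "vdiff H x y = sub x y"
  by (simp add: vdiff_def sub_def)

lemma vinner_eq: "x \<in> vecs H \<Longrightarrow> y \<in> vecs H \<Longrightarrow> vinner H x y = ip x y"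
  by (simp add: vinner_def vdiff_sub vnorm_nrm nrm_sq expand sym[of y x])

lemma lincomb_closed: "range e \<subseteq> vecs H \<Longrightarrow> lincomb H e c n \<in> vecs H"
  by (induction n) (auto simp: image_subset_iff)

lemma ip_lincomb:
  "range e \<subseteq> vecs H \<Longrightarrow> z \<in> vecs H \<Longrightarrow> ip (lincomb H e c n) z = (\<Sum>i<n. c i * ip (e i) z)"
  by (induction n) (auto simp: zero_left add_left scl_left lincomb_closed image_subset_iff)

lemma bounded_functional_zero:
  assumes "bounded_functional H l" "x \<in> vecs H" "vnorm H x = 0"
  shows "l x = 0"
proof -
  obtain C where "\<bar>l x\<bar> \<le> C * vnorm H x" using assms by (auto simp: bounded_functional_def)
  then show ?thesis using assms by simp
qed

lemma dual_bdd_above: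
  assumes "bounded_functional H l"
  shows "bdd_above ((\<lambda>x. \<bar>l x\<bar>) ` {x \<in> vecs H. vnorm H x \<le> 1})"
proof -
  obtain C where C: "\<And>x. x \<in> vecs H \<Longrightarrow> \<bar>l x\<bar> \<le> C * vnorm H x"
    using assms unfolding bounded_functional_def by blast
  have "\<bar>l x\<bar> \<le> \<bar>C\<bar>" if "x \<in> vecs H" "vnorm H x \<le> 1" for x
  proof -
    have "C * vnorm H x \<le> \<bar>C\<bar> * vnorm H x" 
      using that by (intro mult_right_mono) (auto simp: vnorm_nrm)
    also have "\<dots> \<le> \<bar>C\<bar> * 1" using that by (intro mult_left_mono) auto
    finally show ?thesis using C[OF that(1)] by simp
  qed
  then show ?thesis by (auto intro!: bdd_aboveI2)
qed

text \<open>Scaling to the unit ball. Vectors of norm zero cannot be scaled, but boundedness makes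
  the functional vanish there.\<close>

lemma dual_norm_bound:
  assumes l: "bounded_functional H l" and x: "x \<in> vecs H"
  shows "\<bar>l x\<bar> \<le> vnorm (dual_space H) l * vnorm H x"
proof (cases "vnorm H x = 0")
  case True
  then show ?thesis using bounded_functional_zero[OF l x] by simp
next
  case False
  then have pos: "vnorm H x > 0" using x by (simp add: vnorm_nrm order_less_le)
  let ?y = "vscale H (1 / vnorm H x) x"
  have y: "?y \<in> vecs H" "vnorm H ?y \<le> 1"
    using x pos by (auto simp: vnorm_nrm nrm_scl)
  have "\<bar>l ?y\<bar> \<le> vnorm (dual_space H) l"
    unfolding dual_space_def by simp (rule cSUP_upper[OF _ dual_bdd_above[OF l]], use y in auto)
  moreover have "l ?y = (1 / vnorm H x) * l x" using l x by (auto simp: bounded_functional_def)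
  ultimately show ?thesis using pos by (simp add: abs_mult field_simps)
qed

text \<open>The supremum is taken in the reals, so even its nonnegativity needs an upper bound and a
  point of the unit ball; \<open>vzero H\<close> is that point.\<close>

lemma dual_norm_le:
  assumes K: "\<And>x. x \<in> vecs H \<Longrightarrow> \<bar>l x\<bar> \<le> K * vnorm H x" and "0 \<le> K"
  shows "vnorm (dual_space H) l \<le> K" "0 \<le> vnorm (dual_space H) l"
proof -
  let ?S = "{x \<in> vecs H. vnorm H x \<le> 1}"
  have z: "vzero H \<in> ?S" by (simp add: vnorm_eq zero_left)
  have le: "\<bar>l x\<bar> \<le> K" if "x \<in> ?S" for x
  proof -
    have "K * vnorm H x \<le> K * 1" using that assms(2) by (intro mult_left_mono) auto
    then show ?thesis using K[of x] that by simp
  qed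
  show "vnorm (dual_space H) l \<le> K"
    unfolding dual_space_def by simp (rule cSUP_least, use z in blast, use le in simp)
  have "\<bar>l (vzero H)\<bar> \<le> (SUP x\<in>?S. \<bar>l x\<bar>)"
    by (rule cSUP_upper[OF z]) (use le in \<open>auto intro!: bdd_aboveI2\<close>)
  then show "0 \<le> vnorm (dual_space H) l" unfolding dual_space_def by simp
qed

lemma lincomb_dual:
  "x \<in> vecs H \<Longrightarrow> lincomb (dual_space H) g c n x = (\<Sum>j<n. c j * g j x)"
  by (induction n) (auto simp: dual_space_def)

text \<open>\<open>borel_of\<close> is generated by the explicit open sets, and superlevel sets of a
  continuous function are among these generators.\<close>

lemma measurable_borel_of:
  fixes h :: "'v \<Rightarrow> real"
  assumes sets: "sets \<mu> = sets (borel_of H)"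
    and cont: "\<And>x \<epsilon>. x \<in> vecs H \<Longrightarrow> \<epsilon> > 0 \<Longrightarrow> \<exists>r>0. \<forall>y\<in>vecs H. nrm (sub y x) < r \<longrightarrow> \<bar>h y - h x\<bar> < \<epsilon>"
  shows "h \<in> borel_measurable \<mu>"
proof -
  let ?G = "{U. U \<subseteq> vecs H \<and>
         (\<forall>x \<in> U. \<exists>r>0. \<forall>y \<in> vecs H. vnorm H (vdiff H y x) < r \<longrightarrow> y \<in> U)}"
  have G: "?G \<subseteq> Pow (vecs H)" by auto
  have "{x \<in> vecs H. a < h x} \<in> ?G" for a
  proof safe
    fix x assume "x \<in> vecs H" "a < h x"
    from cont[OF this(1), of "h x - a"] this obtain r where r: "r > 0"
      "\<And>y. y \<in> vecs H \<Longrightarrow> nrm (sub y x) < r \<Longrightarrow> \<bar>h y - h x\<bar> < h x - a" by auto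
    show "\<exists>r>0. \<forall>y\<in>vecs H. vnorm H (vdiff H y x) < r \<longrightarrow> y \<in> {x \<in> vecs H. a < h x}"
    proof (intro exI[of _ r] conjI ballI impI)
      fix y assume "y \<in> vecs H" "vnorm H (vdiff H y x) < r"
      then show "y \<in> {x \<in> vecs H. a < h x}"
        using r(2)[of y] \<open>x \<in> vecs H\<close> by (simp add: vdiff_sub vnorm_nrm)
    qed (rule r)
  qed
  then have "{x \<in> vecs H. a < h x} \<in> sets (borel_of H)" for a
    unfolding borel_of_def using G by (simp add: sets_measure_of sigma_sets.Basic)
  then have "h \<in> borel_measurable (borel_of H)"
    using G by (subst borel_measurable_iff_greater) (auto simp: borel_of_def space_measure_of)
  then show ?thesis using sets by (simp cong: measurable_cong_sets)
qed

lemma measurable_ip_right: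
  assumes "sets \<mu> = sets (borel_of H)" "z \<in> vecs H"
  shows "(\<lambda>x. ip x z) \<in> borel_measurable \<mu>"
proof (rule measurable_borel_of[OF assms(1)])
  fix x \<epsilon> assume x: "x \<in> vecs H" and "\<epsilon> > (0::real)"
  have nz: "nrm z + 1 > 0" using assms nrm_nonneg[of z] by linarith
  have "\<bar>ip y z - ip x z\<bar> < \<epsilon>" if y: "y \<in> vecs H" "nrm (sub y x) < \<epsilon> / (nrm z + 1)" for y
  proof -
    have "\<bar>ip y z - ip x z\<bar> \<le> nrm (sub y x) * nrm z"
      using abs_le_nrm[of "sub y x" z] x y assms by (simp add: expand)
    also have "\<dots> \<le> nrm (sub y x) * (nrm z + 1)" using x y by (intro mult_left_mono) auto
    also have "\<dots> < \<epsilon>" using y(2) nz by (simp add: field_simps)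
    finally show ?thesis .
  qed
  then show "\<exists>r>0. \<forall>y\<in>vecs H. nrm (sub y x) < r \<longrightarrow> \<bar>ip y z - ip x z\<bar> < \<epsilon>"
    using \<open>\<epsilon> > 0\<close> nz by (intro exI[of _ "\<epsilon> / (nrm z + 1)"]) auto
qed

lemma measurable_ip_self:
  assumes "sets \<mu> = sets (borel_of H)"
  shows "(\<lambda>x. ip x x) \<in> borel_measurable \<mu>"
proof -
  have "nrm \<in> borel_measurable \<mu>"
  proof (rule measurable_borel_of[OF assms])
    fix x \<epsilon> assume x: "x \<in> vecs H" and "\<epsilon> > (0::real)"
    have "\<bar>nrm y - nrm x\<bar> \<le> nrm (sub y x)" if "y \<in> vecs H" for y
      using nrm_triangle2[of x y] nrm_triangle2[of y x] nrm_sub_commute[of x y] that x by linarith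
    then show "\<exists>r>0. \<forall>y\<in>vecs H. nrm (sub y x) < r \<longrightarrow> \<bar>nrm y - nrm x\<bar> < \<epsilon>"
      using \<open>\<epsilon> > 0\<close> by (intro exI[of _ \<epsilon>]) force
  qed
  then have "(\<lambda>x. (nrm x)\<^sup>2) \<in> borel_measurable \<mu>" by simp
  moreover have "space \<mu> = vecs H"
    using sets_eq_imp_space_eq[OF assms] by (simp add: borel_of_def space_measure_of_conv)
  ultimately show ?thesis by (subst measurable_cong[of _ _ "\<lambda>x. (nrm x)\<^sup>2"]) (simp_all add: nrm_sq)
qed

section \<open>The Bessel remainder: squared distance to the span of the first basis vectors\<close>

definition remainder :: "(nat \<Rightarrow> 'v) \<Rightarrow> nat \<Rightarrow> 'v \<Rightarrow> real" where
  "remainder e p x = ip x x - (\<Sum>i<p. (ip x (e i))\<^sup>2)"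

lemma basis_ip:
  assumes "orthonormal_basis H e"
  shows "ip (e i) (e j) = (if i = j then 1 else 0)"
  using assms vinner_eq[of "e i" "e j"] by (auto simp: orthonormal_basis_def image_subset_iff)

text \<open>Pythagoras. With Fourier coefficients for \<open>c\<close> it identifies the remainder
  as a squared distance; for other coefficients the additional sum shows that the Fourier
  coefficients are optimal.\<close>

lemma dist_lincomb:
  assumes e: "orthonormal_basis H e" and x: "x \<in> vecs H"
  shows "(nrm (sub x (lincomb H e c n)))\<^sup>2 = remainder e n x + (\<Sum>i<n. (c i - ip x (e i))\<^sup>2)"
proof -
  have eV: "range e \<subseteq> vecs H" using e by (simp add: orthonormal_basis_def)
  then have eV': "e i \<in> vecs H" for i by auto
  let ?l = "lincomb H e c n"
  have l: "?l \<in> vecs H" by (rule lincomb_closed[OF eV])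
  have lx: "ip ?l x = (\<Sum>i<n. c i * ip x (e i))"
    using ip_lincomb[OF eV x] sym[OF eV' x] by simp
  have le: "ip (e i) ?l = c i" if "i < n" for i
    using ip_lincomb[OF eV eV', of c n i] sym[OF l eV'] that
    by (simp add: basis_ip[OF e] if_distrib[of "(*) _"] cong: if_cong)
  have ll: "ip ?l ?l = (\<Sum>i<n. c i * c i)"
    using ip_lincomb[OF eV l, of c n] le by simp
  have "(nrm (sub x ?l))\<^sup>2 = ip x x - 2 * ip ?l x + ip ?l ?l"
    using x l by (simp add: nrm_sq expand sym[of x ?l])
  also have "\<dots> = remainder e n x + (\<Sum>i<n. (ip x (e i))\<^sup>2 - 2 * (c i * ip x (e i)) + c i * c i)"
    unfolding lx ll remainder_def by (simp add: sum.distrib sum_subtractf sum_distrib_left)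
  also have "(\<Sum>i<n. (ip x (e i))\<^sup>2 - 2 * (c i * ip x (e i)) + c i * c i) = (\<Sum>i<n. (c i - ip x (e i))\<^sup>2)"
    by (intro sum.cong) (auto simp: power2_eq_square algebra_simps)
  finally show ?thesis .
qed

lemma remainder_dist:
  assumes "orthonormal_basis H e" "x \<in> vecs H"
  shows "remainder e p x = (nrm (sub x (lincomb H e (\<lambda>i. ip x (e i)) p)))\<^sup>2"
  using dist_lincomb[OF assms, of "\<lambda>i. ip x (e i)" p] by simp

lemma remainder_nonneg:
  assumes "orthonormal_basis H e" "x \<in> vecs H"
  shows "0 \<le> remainder e p x"
  using remainder_dist[OF assms] by simp

lemma remainder_le: "remainder e p x \<le> ip x x"
  by (simp add: remainder_def sum_nonneg)

lemma remainder_antimono: "n \<le> p \<Longrightarrow> remainder e p x \<le> remainder e n x"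
  unfolding remainder_def by (intro diff_left_mono sum_mono2) auto

text \<open>Density gives one good combination of one length \<open>n\<close>. Fourier coefficients
  do at least as well, and the remainder decreases with the length, so all longer projections are
  good too.\<close>

lemma remainder_tendsto_0:
  assumes e: "orthonormal_basis H e" and x: "x \<in> vecs H"
  shows "(\<lambda>p. remainder e p x) \<longlonglongrightarrow> 0"
proof (rule LIMSEQ_I)
  fix r :: real assume r: "r > 0"
  then have "sqrt r > 0" by simp
  then obtain n c where "vnorm H (vdiff H x (lincomb H e c n)) < sqrt r"
    using e x unfolding orthonormal_basis_def by blast
  moreover have "lincomb H e c n \<in> vecs H" using e by (simp add: lincomb_closed orthonormal_basis_def)
  ultimately have "nrm (sub x (lincomb H e c n)) < sqrt r" "0 \<le> nrm (sub x (lincomb H e c n))"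
    using x by (auto simp: vdiff_sub vnorm_nrm)
  then have "(nrm (sub x (lincomb H e c n)))\<^sup>2 < (sqrt r)\<^sup>2" by (intro power_strict_mono) auto
  then have "remainder e n x + (\<Sum>i<n. (c i - ip x (e i))\<^sup>2) < r"
    using r unfolding dist_lincomb[OF e x] by simp
  moreover have "0 \<le> (\<Sum>i<n. (c i - ip x (e i))\<^sup>2)" by (intro sum_nonneg) simp
  ultimately have "remainder e n x < r" by linarith
  then have "norm (remainder e p x - 0) < r" if "p \<ge> n" for p
    using remainder_antimono[OF that, of e x] remainder_nonneg[OF e x, of p] by simp
  then show "\<exists>no. \<forall>n\<ge>no. norm (remainder e n x - 0) < r" by blast
qed

text \<open>The operator enters through its bilinear form \<open>L\<close>, of which
  \<open>T f\<close> is the restriction to the carrier. The mean-square error splits into a part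
  lost by truncating the input and a part lost by approximating the columns; each is allotted half
  of \<open>\<epsilon>\<close>.\<close>

lemma linear_deeponet:
  assumes e: "orthonormal_basis H e" and g: "orthonormal_basis (dual_space H) g"
    and sets: "sets \<mu> = sets (borel_of H)"
    and mom: "(\<integral>\<^sup>+f. ennreal (ip f f) \<partial>\<mu>) < \<infinity>"
    and T: "\<And>f. f \<in> vecs H \<Longrightarrow> T f = (\<lambda>x \<in> vecs H. L f x)"
    and L_add_left: "\<And>f f' x. f \<in> vecs H \<Longrightarrow> f' \<in> vecs H \<Longrightarrow> x \<in> vecs H \<Longrightarrow>
          L (vadd H f f') x = L f x + L f' x"
    and L_scl_left: "\<And>c f x. f \<in> vecs H \<Longrightarrow> x \<in> vecs H \<Longrightarrow> L (vscale H c f) x = c * L f x"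
    and L_add_right: "\<And>f x x'. f \<in> vecs H \<Longrightarrow> x \<in> vecs H \<Longrightarrow> x' \<in> vecs H \<Longrightarrow>
          L f (vadd H x x') = L f x + L f x'"
    and L_scl_right: "\<And>c f x. f \<in> vecs H \<Longrightarrow> x \<in> vecs H \<Longrightarrow> L f (vscale H c x) = c * L f x"
    and L_bound: "\<And>f x. f \<in> vecs H \<Longrightarrow> x \<in> vecs H \<Longrightarrow> \<bar>L f x\<bar> \<le> C * nrm f * nrm x"
    and "C \<ge> 0" "\<epsilon> > 0"
  shows "\<exists>F \<in> deeponets \<sigma> H e (dual_space H) g.
    (\<integral>\<^sup>+f. ennreal ((vnorm (dual_space H) (vdiff (dual_space H) (T f) (F f)))\<^sup>2) \<partial>\<mu>) < ennreal \<epsilon>"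
proof -
  let ?D = "dual_space H"
  have eV: "range e \<subseteq> vecs H" using e by (simp add: orthonormal_basis_def)
  then have eV' [simp]: "e i \<in> vecs H" for i by auto
  have space: "space \<mu> = vecs H"
    using sets_eq_imp_space_eq[OF sets] by (simp add: borel_of_def space_measure_of_conv)
  have [measurable]: "(\<lambda>f. ip f f) \<in> borel_measurable \<mu>" "(\<lambda>f. ip f (e i)) \<in> borel_measurable \<mu>" for i
    using measurable_ip_self[OF sets] measurable_ip_right[OF sets] by auto
  have [measurable]: "remainder e p \<in> borel_measurable \<mu>" for p
    unfolding remainder_def[abs_def] by measurable
  have dual_vecs: "T f \<in> vecs ?D" if f: "f \<in> vecs H" for f
    using f by (auto simp: T dual_space_def bounded_functional_def L_add_right L_scl_right
        vnorm_nrm intro!: exI[of _ "C * nrm f"] L_bound)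
  have "(\<lambda>p. \<integral>\<^sup>+f. ennreal (remainder e p f) \<partial>\<mu>) \<longlonglongrightarrow> (\<integral>\<^sup>+f. 0 \<partial>\<mu>)"
  proof (rule nn_integral_dominated_convergence[where w = "\<lambda>f. ennreal (ip f f)"])
    show "AE f in \<mu>. (\<lambda>p. ennreal (remainder e p f)) \<longlonglongrightarrow> 0"
      using tendsto_ennrealI[OF remainder_tendsto_0[OF e]] by (intro AE_I2) (simp add: space)
  qed (use mom remainder_le in \<open>auto intro!: AE_I2 ennreal_leI\<close>)
  then have "(\<lambda>p. \<integral>\<^sup>+f. ennreal (remainder e p f) \<partial>\<mu>) \<longlonglongrightarrow> 0" by simp
  \<comment> \<open>The truncation error enters with the factor \<open>2 * C\<^sup>2\<close>, so
    this bound keeps it below half of \<open>\<epsilon>\<close>; the \<open>+ 1\<close> covers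
    \<open>C = 0\<close>.\<close>
  then have ev: "\<forall>\<^sub>F p in sequentially. (\<integral>\<^sup>+f. ennreal (remainder e p f) \<partial>\<mu>) < ennreal (\<epsilon> / (4 * C\<^sup>2 + 1))"
    using \<open>\<epsilon> > 0\<close> by (intro order_tendstoD(2)[where y=0]) (auto intro!: divide_pos_pos add_nonneg_pos)
  \<comment> \<open>\<open>p > 0\<close> because layers have positive width and because the next
    constant divides by \<open>p\<close>.\<close>
  obtain p where p: "p > 0"
      "(\<integral>\<^sup>+f. ennreal (remainder e p f) \<partial>\<mu>) < ennreal (\<epsilon> / (4 * C\<^sup>2 + 1))"
    using eventually_conj[OF ev eventually_gt_at_top[of 0]]
    by (auto simp: eventually_sequentially)
  obtain M where M: "M \<ge> 0" "(\<integral>\<^sup>+f. ennreal (ip f f) \<partial>\<mu>) = ennreal M"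
    using mom by (cases "\<integral>\<^sup>+f. ennreal (ip f f) \<partial>\<mu>") auto
  \<comment> \<open>Chosen so that \<open>2 * (real p * \<delta>)\<^sup>2 * M\<close> equals
    \<open>\<epsilon> / 2 * (M / (M + 1))\<close>; the \<open>+ 1\<close> covers
    \<open>M = 0\<close>.\<close>
  define \<delta> where "\<delta> = sqrt (\<epsilon> / (4 * (real p)\<^sup>2 * (M + 1)))"
  have \<delta>: "\<delta> > 0" "\<delta>\<^sup>2 = \<epsilon> / (4 * (real p)\<^sup>2 * (M + 1))"
    unfolding \<delta>_def using \<open>\<epsilon> > 0\<close> p M by (auto intro!: divide_pos_pos)
  have "\<exists>n c. vnorm ?D (vdiff ?D (T (e i)) (lincomb ?D g c n)) < \<delta>" for i
    using g dual_vecs[of "e i"] \<delta> by (auto simp: orthonormal_basis_def)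
  then obtain n c where nc: "\<And>i. vnorm ?D (vdiff ?D (T (e i)) (lincomb ?D g (c i) (n i))) < \<delta>"
    by metis
  \<comment> \<open>A common bound for the lengths \<open>n i\<close>; \<open>Suc\<close> keeps the
    output width positive.\<close>
  define q where "q = Suc (\<Sum>i<p. n i)"
  have nq: "n i \<le> q" if "i < p" for i
    using member_le_sum[of i "{..<p}" n] that by (auto simp: q_def)
  \<comment> \<open>Column \<open>i\<close> holds the coefficients that approximate
    \<open>T (e i)\<close>, padded with zeros to the common length \<open>q\<close>.\<close>
  define A where "A = Matrix.mat q p (\<lambda>(j, i). if j < n i then c i j else 0)"
  define b where "b = (0\<^sub>v q :: real Matrix.vec)"
  define F where "F = decode ?D g q \<circ> realization \<sigma> [(A, b)] \<circ> encode H e p"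
  have F: "F \<in> deeponets \<sigma> H e ?D g"
    unfolding deeponets_def F_def using p
    by (intro CollectI exI[of _ p] exI[of _ q] exI[of _ "[(A, b)]"]) (auto simp: A_def b_def q_def)
  have Fx: "F f x = (\<Sum>i<p. ip f (e i) * lincomb ?D g (c i) (n i) x)" if f: "f \<in> vecs H" and x: "x \<in> vecs H" for f x
  proof -
    let ?y = "encode H e p f"
    have y: "?y = Matrix.vec p (\<lambda>i. ip f (e i))"
      unfolding encode_def using f by (auto simp: vinner_eq intro!: eq_vecI)
    have ent: "vec_index (A *\<^sub>v ?y + b) j = (\<Sum>i<p. (if j < n i then c i j else 0) * ip f (e i))" if "j < q" for j
      using that unfolding y A_def b_def by (simp add: scalar_prod_def atLeast0LessThan)
    have "F f x = (\<Sum>j<q. vec_index (A *\<^sub>v ?y + b) j * g j x)"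
      unfolding F_def by (simp add: decode_def lincomb_dual[OF x])
    also have "\<dots> = (\<Sum>j<q. \<Sum>i<p. (if j < n i then c i j else 0) * ip f (e i) * g j x)"
      by (intro sum.cong) (auto simp: ent sum_distrib_right simp del: index_add_vec)
    also have "\<dots> = (\<Sum>i<p. \<Sum>j<q. (if j < n i then c i j else 0) * ip f (e i) * g j x)"
      by (rule sum.swap)
    also have "\<dots> = (\<Sum>i<p. \<Sum>j<n i. c i j * ip f (e i) * g j x)"
      by (intro sum.cong refl sum.mono_neutral_cong_right) (use nq in \<open>auto intro: less_le_trans\<close>)
    also have "\<dots> = (\<Sum>i<p. ip f (e i) * lincomb ?D g (c i) (n i) x)"
      by (intro sum.cong) (auto simp: lincomb_dual[OF x] sum_distrib_left mult_ac)
    finally show ?thesis .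
  qed
  have L_lincomb: "L (lincomb H e d m) x = (\<Sum>i<m. d i * L (e i) x)" if x: "x \<in> vecs H" for d m x
  proof (induction m)
    case 0
    \<comment> \<open>\<open>vzero H\<close> is not known to be a multiple of a vector, so the value
      there is read off from the bound and not from linearity.\<close>
    have "\<bar>L (vzero H) x\<bar> \<le> C * nrm (vzero H) * nrm x" using x by (intro L_bound) auto
    then show ?case by (simp add: nrm_def zero_left)
  qed (use x eV in \<open>simp add: L_add_left L_scl_left lincomb_closed\<close>)
  have col: "\<bar>L (e i) x - lincomb ?D g (c i) (n i) x\<bar> \<le> \<delta> * nrm x" if x: "x \<in> vecs H" for i x
  proof -
    let ?l = "vdiff ?D (T (e i)) (lincomb ?D g (c i) (n i))"
    have gb: "bounded_functional H (g j)" for j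
      using g by (auto simp: orthonormal_basis_def dual_space_def)
    have lx: "?l x = L (e i) x - lincomb ?D g (c i) (n i) x" if "x \<in> vecs H" for x
      using that by (simp add: vdiff_def dual_space_def T)
    have "\<exists>K. \<forall>x\<in>vecs H. \<bar>g j x\<bar> \<le> K * vnorm H x" for j
      using gb[of j] by (simp add: bounded_functional_def)
    then obtain K where K: "\<And>j x. x \<in> vecs H \<Longrightarrow> \<bar>g j x\<bar> \<le> K j * nrm x"
      by (metis vnorm_nrm)
    \<comment> \<open>\<open>dual_norm_bound\<close> speaks of bounded functionals, so the
      difference is shown to be one; its constant is assembled from those of the finitely many
      \<open>g j\<close>.\<close>
    have "bounded_functional H ?l"
      unfolding bounded_functional_def
    proof (intro conjI ballI allI)
      fix x y assume xy: "x \<in> vecs H" "y \<in> vecs H"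
      then have "g j (vadd H x y) = g j x + g j y" for j
        using gb[of j] by (simp add: bounded_functional_def)
      then show "?l (vadd H x y) = ?l x + ?l y"
        using xy by (simp add: lx lincomb_dual L_add_right algebra_simps sum.distrib)
    next
      fix a x assume x: "x \<in> vecs H"
      then have "g j (vscale H a x) = a * g j x" for j
        using gb[of j] by (simp add: bounded_functional_def)
      then show "?l (vscale H a x) = a * ?l x"
        using x by (simp add: lx lincomb_dual L_scl_right algebra_simps sum_distrib_left)
    next
      have "\<bar>?l x\<bar> \<le> (C * nrm (e i) + (\<Sum>j<n i. \<bar>c i j\<bar> * K j)) * vnorm H x" if x: "x \<in> vecs H" for x
      proof -
        have "\<bar>\<Sum>j<n i. c i j * g j x\<bar> \<le> (\<Sum>j<n i. \<bar>c i j\<bar> * (K j * nrm x))"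
          by (rule order_trans[OF sum_abs]) (auto intro!: sum_mono mult_left_mono K x simp: abs_mult)
        moreover have "\<bar>L (e i) x\<bar> \<le> C * nrm (e i) * nrm x" using x by (intro L_bound) auto
        ultimately have "\<bar>?l x\<bar> \<le> C * nrm (e i) * nrm x + (\<Sum>j<n i. \<bar>c i j\<bar> * (K j * nrm x))"
          unfolding lx[OF x] lincomb_dual[OF x] by linarith
        then show ?thesis using x by (simp add: vnorm_nrm algebra_simps sum_distrib_left)
      qed
      then show "\<exists>C. \<forall>x\<in>vecs H. \<bar>?l x\<bar> \<le> C * vnorm H x" by blast
    qed
    from dual_norm_bound[OF this x] have "\<bar>?l x\<bar> \<le> vnorm ?D ?l * nrm x" using x by (simp add: vnorm_nrm)
    also have "\<dots> \<le> \<delta> * nrm x" using nc[of i] x by (intro mult_right_mono) auto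
    finally show ?thesis unfolding lx[OF x] .
  qed
  have err: "(vnorm ?D (vdiff ?D (T f) (F f)))\<^sup>2 \<le> 2 * C\<^sup>2 * remainder e p f + 2 * (real p * \<delta>)\<^sup>2 * ip f f"
    if f: "f \<in> vecs H" for f
  proof -
    let ?P = "lincomb H e (\<lambda>i. ip f (e i)) p"
    let ?K = "C * nrm (sub f ?P) + real p * \<delta> * nrm f"
    have P: "?P \<in> vecs H" by (rule lincomb_closed[OF eV])
    have bd: "\<bar>vdiff ?D (T f) (F f) x\<bar> \<le> ?K * vnorm H x" if x: "x \<in> vecs H" for x
    proof -
      \<comment> \<open>On the projection \<open>?P\<close> the network errs only through its
        columns; on \<open>f - ?P\<close> the whole value of \<open>L\<close> counts as
        error.\<close>
      have "vdiff ?D (T f) (F f) x = L f x - F f x"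
        using x f by (simp add: vdiff_def dual_space_def T)
      also have "\<dots> = L (sub f ?P) x + (\<Sum>i<p. ip f (e i) * (L (e i) x - lincomb ?D g (c i) (n i) x))"
        using x f P by (simp add: sub_def L_add_left L_scl_left L_lincomb Fx algebra_simps sum_subtractf)
      finally have "\<bar>vdiff ?D (T f) (F f) x\<bar> \<le> \<bar>L (sub f ?P) x\<bar> + 
          (\<Sum>i<p. \<bar>ip f (e i) * (L (e i) x - lincomb ?D g (c i) (n i) x)\<bar>)"
        using sum_abs[of "\<lambda>i. ip f (e i) * (L (e i) x - lincomb ?D g (c i) (n i) x)" "{..<p}"] by linarith
      also have "\<dots> \<le> C * nrm (sub f ?P) * nrm x + (\<Sum>i<p. nrm f * (\<delta> * nrm x))"
      proof (intro add_mono sum_mono)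
        fix i
        have "\<bar>ip f (e i)\<bar> \<le> nrm f"
          using abs_le_nrm[of f "e i"] f by (simp add: nrm_def[of "e i"] basis_ip[OF e])
        then show "\<bar>ip f (e i) * (L (e i) x - lincomb ?D g (c i) (n i) x)\<bar> \<le> nrm f * (\<delta> * nrm x)"
          unfolding abs_mult using col[OF x] by (intro mult_mono) (use f in auto)
      qed (use L_bound f P x in auto)
      also have "\<dots> = ?K * vnorm H x" using x by (simp add: vnorm_nrm algebra_simps)
      finally show ?thesis .
    qed
    have "0 \<le> ?K" using \<open>C \<ge> 0\<close> \<delta> f P by auto
    from dual_norm_le[OF bd this] have "(vnorm ?D (vdiff ?D (T f) (F f)))\<^sup>2 \<le> ?K\<^sup>2"
      by (intro power_mono)
    also have "\<dots> \<le> 2 * (C * nrm (sub f ?P))\<^sup>2 + 2 * (real p * \<delta> * nrm f)\<^sup>2"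
      using zero_le_power2[of "C * nrm (sub f ?P) - real p * \<delta> * nrm f"] 
      by (simp add: power2_sum power2_diff)
    also have "\<dots> = 2 * C\<^sup>2 * remainder e p f + 2 * (real p * \<delta>)\<^sup>2 * ip f f"
      using f by (simp add: power_mult_distrib remainder_dist[OF e f] nrm_sq)
    finally show ?thesis .
  qed
  \<comment> \<open>Monotonicity of the nonnegative integral needs no measurability of the error;
    only the upper bound is split by additivity afterwards.\<close>
  have "(\<integral>\<^sup>+f. ennreal ((vnorm ?D (vdiff ?D (T f) (F f)))\<^sup>2) \<partial>\<mu>)
     \<le> (\<integral>\<^sup>+f. ennreal (2 * C\<^sup>2) * ennreal (remainder e p f) + ennreal (2 * (real p * \<delta>)\<^sup>2) * ennreal (ip f f) \<partial>\<mu>)"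
  proof (intro nn_integral_mono)
    fix f assume "f \<in> space \<mu>"
    then have f: "f \<in> vecs H" by (simp add: space)
    show "ennreal ((vnorm ?D (vdiff ?D (T f) (F f)))\<^sup>2) \<le>
        ennreal (2 * C\<^sup>2) * ennreal (remainder e p f) + ennreal (2 * (real p * \<delta>)\<^sup>2) * ennreal (ip f f)"
      using err[OF f] remainder_nonneg[OF e f, of p] nonneg[OF f]
      by (simp add: ennreal_leI flip: ennreal_mult ennreal_plus)
  qed
  also have "\<dots> = ennreal (2 * C\<^sup>2) * (\<integral>\<^sup>+f. ennreal (remainder e p f) \<partial>\<mu>) + ennreal (2 * (real p * \<delta>)\<^sup>2) * ennreal M"
    by (simp add: nn_integral_add nn_integral_cmult M)
  also have "\<dots> \<le> ennreal (2 * C\<^sup>2) * ennreal (\<epsilon> / (4 * C\<^sup>2 + 1)) + ennreal (2 * (real p * \<delta>)\<^sup>2) * ennreal M"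
    using p by (intro add_right_mono mult_left_mono) auto
  also have "\<dots> = ennreal (2 * C\<^sup>2 * (\<epsilon> / (4 * C\<^sup>2 + 1)) + 2 * (real p * \<delta>)\<^sup>2 * M)"
    using \<open>\<epsilon> > 0\<close> M by (simp flip: ennreal_mult ennreal_plus)
  also have "\<dots> < ennreal \<epsilon>"
  proof (rule ennreal_lessI)
    have "2 * C\<^sup>2 * (\<epsilon> / (4 * C\<^sup>2 + 1)) < \<epsilon> / 2" 
      using \<open>\<epsilon> > 0\<close> add_nonneg_pos[of "4 * C\<^sup>2" 1] by (simp add: field_simps)
    moreover have "2 * (real p * \<delta>)\<^sup>2 * M = \<epsilon> / 2 * (M / (M + 1))"
    proof -
      have pd: "(real p * \<delta>)\<^sup>2 = \<epsilon> / (4 * (M + 1))" using p by (simp add: power_mult_distrib \<delta>)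
      have "2 * (\<epsilon> / (4 * s)) * M = \<epsilon> / 2 * (M / s)" for s by simp
      then show ?thesis unfolding pd .
    qed
    moreover have "\<dots> \<le> \<epsilon> / 2 * 1" using M \<open>\<epsilon> > 0\<close> by (intro mult_left_mono) auto
    ultimately show "2 * C\<^sup>2 * (\<epsilon> / (4 * C\<^sup>2 + 1)) + 2 * (real p * \<delta>)\<^sup>2 * M < \<epsilon>" by linarith
  qed (use \<open>\<epsilon> > 0\<close> in auto)
  finally show ?thesis using F by blast
qed

end

section \<open>Smooth functions\<close>

text \<open>The product rule leaves one factor undifferentiated, so the induction for products needs
  the factors at one order less.\<close>

lemma C_diff_mono: "C_diff (Suc k) f \<Longrightarrow> C_diff k f"
proof (induction k arbitrary: f)
  case 0
  then show ?case by (auto intro!: differentiable_imp_continuous_on simp: differentiable_on_def differentiable_at_withinI)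
next
  case (Suc k)
  then show ?case by (metis C_diff.simps(2))
qed

lemma smooth_differentiable: "smooth f \<Longrightarrow> f differentiable (at x)"
  using C_diff.simps(2)[of 0 f] by (auto simp: smooth_def)

lemma smooth_continuous: "smooth f \<Longrightarrow> continuous_on UNIV f"
  unfolding smooth_def by (metis C_diff.simps(1))

lemma smooth_has_derivative: "smooth f \<Longrightarrow> (f has_derivative frechet_derivative f (at x)) (at x)"
  using smooth_differentiable frechet_derivative_works by blast

lemma smooth_frechet: "smooth f \<Longrightarrow> b \<in> Basis \<Longrightarrow> smooth (\<lambda>x. frechet_derivative f (at x) b)"
  unfolding smooth_def by (metis C_diff.simps(2))

lemma C_diff_const: "C_diff k (\<lambda>x::'a::euclidean_space. c)"
proof (induction k arbitrary: c)
  case (Suc k)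
  have "frechet_derivative (\<lambda>x::'a. c) (at x) = (\<lambda>_. 0)" for x
    by (rule frechet_derivative_at[symmetric]) simp
  then show ?case using Suc by simp
qed simp

lemma C_diff_add: "C_diff k f \<Longrightarrow> C_diff k g \<Longrightarrow> C_diff k (\<lambda>x. f x + g x)"
proof (induction k arbitrary: f g)
  case (Suc k)
  have "frechet_derivative (\<lambda>x. f x + g x) (at x) = 
      (\<lambda>b. frechet_derivative f (at x) b + frechet_derivative g (at x) b)" for x
    using Suc.prems by (intro frechet_derivative_at[symmetric] has_derivative_add)
       (auto simp: frechet_derivative_works)
  then show ?case using Suc by auto
qed (auto intro: continuous_on_add)

lemma C_diff_mult: "C_diff k f \<Longrightarrow> C_diff k g \<Longrightarrow> C_diff k (\<lambda>x. f x * g x)"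
proof (induction k arbitrary: f g)
  case (Suc k)
  have "frechet_derivative (\<lambda>x. f x * g x) (at x) = 
      (\<lambda>b. f x * frechet_derivative g (at x) b + frechet_derivative f (at x) b * g x)" for x
    using Suc.prems by (intro frechet_derivative_at[symmetric] has_derivative_mult)
       (auto simp: frechet_derivative_works)
  moreover have "C_diff k f" "C_diff k g" using Suc.prems C_diff_mono by auto
  ultimately show ?case using Suc by (auto intro!: C_diff_add)
qed (auto intro: continuous_on_mult)

lemma smooth_const: "smooth (\<lambda>x. c)" by (simp add: smooth_def C_diff_const)
lemma smooth_add: "smooth f \<Longrightarrow> smooth g \<Longrightarrow> smooth (\<lambda>x. f x + g x)"
  by (simp add: smooth_def C_diff_add)
lemma smooth_mult: "smooth f \<Longrightarrow> smooth g \<Longrightarrow> smooth (\<lambda>x. f x * g x)"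
  by (simp add: smooth_def C_diff_mult)
lemma smooth_prod: "(\<And>i. i \<in> I \<Longrightarrow> smooth (f i)) \<Longrightarrow> smooth (\<lambda>x. \<Prod>i\<in>I. f i x)"
  by (induction I rule: infinite_finite_induct) (auto simp: smooth_const intro!: smooth_mult)

text \<open>Up to linear combinations this family is closed under differentiation, which is why the
  power of \<open>t\<close> is included.\<close>

definition flat :: "real \<Rightarrow> nat \<Rightarrow> real \<Rightarrow> real" where
  "flat c n t = (if t > 0 then exp (- c / t) / t ^ n else 0)"

lemma exp_ge_power: 
  assumes "0 \<le> (x::real)"
  shows "x ^ n / fact n \<le> exp x"
proof -
  have "(\<Sum>k\<in>{n}. x ^ k / fact k) \<le> (\<Sum>k. x ^ k / fact k)"
    using summable_exp_generic[of x] assms by (intro sum_le_suminf) (auto simp: divide_inverse mult.commute)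
  then show ?thesis by (simp add: exp_def divide_inverse mult.commute)
qed

text \<open>The term of order \<open>n + 1\<close> of the exponential series beats
  \<open>t ^ n\<close> with one power of \<open>t\<close> to spare. This linear bound is what gives
  derivative zero at the origin.\<close>

lemma flat_le:
  assumes c: "c > 0"
  shows "\<bar>flat c n t\<bar> \<le> fact (Suc n) / c ^ Suc n * \<bar>t\<bar>"
proof (cases "t > 0")
  case True
  have "(c / t) ^ Suc n / fact (Suc n) \<le> exp (c / t)" using c True by (intro exp_ge_power) simp
  then have "exp (- c / t) \<le> fact (Suc n) * t ^ Suc n / c ^ Suc n"
    using c True by (simp add: exp_minus field_simps power_divide del: fact_Suc)
  then show ?thesis using True c by (simp add: flat_def field_simps del: fact_Suc)
next
  case False
  then have "flat c n t = 0" by (simp add: flat_def)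
  moreover have "0 \<le> fact (Suc n) / c ^ Suc n * \<bar>t\<bar>" using c by (intro mult_nonneg_nonneg divide_nonneg_nonneg) auto
  ultimately show ?thesis by simp
qed

text \<open>Away from 0 this is the quotient rule. At 0 the difference quotient of
  \<open>flat c n\<close> is \<open>flat c (n + 1)\<close>, which tends to 0.\<close>

lemma flat_has_derivative:
  assumes c: "c > 0"
  shows "(flat c n has_real_derivative c * flat c (n + 2) t - n * flat c (n + 1) t) (at t)"
proof (cases t "0::real" rule: linorder_cases)
  case greater
  have "((\<lambda>t. exp (- c / t) / t ^ n) has_real_derivative c * flat c (n + 2) t - n * flat c (n + 1) t) (at t)"
  proof -
    let ?d = "(exp (- c / t) * (c / t\<^sup>2) * t ^ n - exp (- c / t) * (n * t ^ (n - 1))) / (t ^ n * t ^ n)"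
    have "((\<lambda>t. exp (- c / t)) has_real_derivative exp (- c / t) * (c / t\<^sup>2)) (at t)"
      using greater by (auto intro!: derivative_eq_intros simp: power2_eq_square)
    moreover have "((\<lambda>t. t ^ n) has_real_derivative n * t ^ (n - 1)) (at t)"
      by (auto intro!: derivative_eq_intros)
    ultimately have "((\<lambda>t. exp (- c / t) / t ^ n) has_real_derivative ?d) (at t)"
      using greater by (intro DERIV_quotient[THEN DERIV_cong]) (auto simp: power2_eq_square)
    moreover have "?d = c * flat c (n + 2) t - n * flat c (n + 1) t"
      using greater by (cases n) (simp_all add: flat_def field_simps power2_eq_square)
    ultimately show ?thesis by simp
  qed
  then show ?thesis
  proof (rule has_field_derivative_transform_within_open[where S = "{0<..}"])
  qed (use greater in \<open>auto simp: flat_def\<close>)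
next
  case less
  have "((\<lambda>t. 0) has_real_derivative c * flat c (n + 2) t - n * flat c (n + 1) t) (at t)"
    using less by (simp add: flat_def)
  then show ?thesis
  proof (rule has_field_derivative_transform_within_open[where S = "{..<0}"])
  qed (use less in \<open>auto simp: flat_def\<close>)
next
  case equal
  have "((\<lambda>h. (flat c n (0 + h) - flat c n 0) / h) \<longlongrightarrow> 0) (at 0)"
  proof (rule Lim_null_comparison)
    have "norm ((flat c n (0 + h) - flat c n 0) / h) \<le> fact (n + 2) / c ^ (n + 2) * \<bar>h\<bar>" for h
    proof -
      have "(flat c n (0 + h) - flat c n 0) / h = flat c (n + 1) h" by (simp add: flat_def)
      moreover have "n + 2 = Suc (n + 1)" by simp
      ultimately show ?thesis using flat_le[OF c, of "n + 1" h] by (simp only: real_norm_def)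
    qed
    then show "\<forall>\<^sub>F h in at 0. norm ((flat c n (0 + h) - flat c n 0) / h) \<le> fact (n + 2) / c ^ (n + 2) * \<bar>h\<bar>"
      by (intro always_eventually) blast
    show "((\<lambda>h. fact (n + 2) / c ^ (n + 2) * \<bar>h\<bar>) \<longlongrightarrow> 0) (at (0::real))"
      using c by (auto intro!: tendsto_eq_intros)
  qed
  then show ?thesis by (simp add: DERIV_def equal flat_def)
qed

text \<open>Differentiation raises \<open>n\<close>, hence the induction for all \<open>n\<close> at
  once. The slope \<open>s\<close> is kept general because a box needs factors of both
  signs.\<close>

lemma C_diff_flat:
  fixes i :: "'a::euclidean_space"
  assumes c: "c > 0"
  shows "C_diff k (\<lambda>x. flat c n (s * inner x i + r))"
proof (induction k arbitrary: n)
  case 0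
  have "continuous_on UNIV (flat c n)" 
    by (rule DERIV_continuous_on, rule has_field_derivative_at_within, rule flat_has_derivative[OF c])
  then show ?case
    using continuous_on_compose2[of UNIV "flat c n" UNIV "\<lambda>x. s * inner x i + r"]
    by (simp add: continuous_on_add continuous_on_mult continuous_on_const continuous_on_inner continuous_on_id)
next
  case (Suc k)
  let ?l = "\<lambda>x. s * inner x i + r"
  let ?d = "\<lambda>n x. c * flat c (n + 2) (?l x) - n * flat c (n + 1) (?l x)"
  have der: "((\<lambda>x. flat c n (?l x)) has_derivative (\<lambda>h. ?d n x * (s * inner h i))) (at x)" for x
  proof -
    have "(?l has_derivative (\<lambda>h. s * inner h i)) (at x)"
      by (auto intro!: derivative_eq_intros)
    moreover have "(flat c n has_derivative (*) (?d n x)) (at (?l x))"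
      using flat_has_derivative[OF c] by (simp add: has_field_derivative_def)
    ultimately show ?thesis
      using has_derivative_compose[of ?l "\<lambda>h. s * inner h i" x UNIV "flat c n" "(*) (?d n x)"] by simp
  qed
  then have fd: "frechet_derivative (\<lambda>x. flat c n (?l x)) (at x) = (\<lambda>h. ?d n x * (s * inner h i))" for x
    using frechet_derivative_at by metis
  have "C_diff k (\<lambda>x. c * flat c (n + 2) (?l x) + (- real n) * flat c (n + 1) (?l x))"
    by (intro C_diff_add C_diff_mult C_diff_const Suc)
  then have "C_diff k (\<lambda>x. ?d n x * (s * inner b i))" for b
    by (intro C_diff_mult C_diff_const) simp
  then show ?case using der unfolding C_diff.simps fd differentiable_def by blast
qed

lemma smooth_flat: "c > 0 \<Longrightarrow> smooth (\<lambda>x. flat c n (s * inner x i + r))"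
  by (simp add: smooth_def C_diff_flat)

section \<open>Bump functions on boxes\<close>

definition bump :: "'a::euclidean_space \<Rightarrow> 'a \<Rightarrow> real \<Rightarrow> 'a \<Rightarrow> real" where
  "bump a b c x = (\<Prod>i\<in>Basis. flat c 0 (1 * inner x i + - inner a i) * flat c 0 ((-1) * inner x i + inner b i))"

lemma smooth_bump: "c > 0 \<Longrightarrow> smooth (bump a b c)"
  unfolding bump_def by (intro smooth_prod smooth_mult smooth_flat)

lemma flat_01: "c > 0 \<Longrightarrow> 0 \<le> flat c 0 t \<and> flat c 0 t \<le> 1"
  by (auto simp: flat_def)

lemma bump_01: "c > 0 \<Longrightarrow> 0 \<le> bump a b c x \<and> bump a b c x \<le> 1"
  unfolding bump_def by (intro conjI prod_nonneg prod_le_1 ballI) (auto simp: flat_01 intro!: mult_nonneg_nonneg mult_le_one)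

lemma bump_eq_0: "x \<notin> box a b \<Longrightarrow> bump a b c x = 0"
  unfolding bump_def mem_box by (auto simp: flat_def intro!: prod_zero)

lemma bump_test:
  assumes "c > 0" "cbox a b \<subseteq> \<Omega>"
  shows "bump a b c \<in> test_functions \<Omega>"
proof -
  have "closure {x. bump a b c x \<noteq> 0} \<subseteq> closure (box a b)"
    using bump_eq_0 by (intro closure_mono) blast
  also have "\<dots> \<subseteq> cbox a b" by (intro closure_minimal box_subset_cbox closed_cbox)
  finally have sub: "closure {x. bump a b c x \<noteq> 0} \<subseteq> cbox a b" .
  then have "compact (closure {x. bump a b c x \<noteq> 0})"
    using compact_cbox closed_closure compact_Int_closed[of "cbox a b"] by (metis inf.absorb2)
  then show ?thesis using assms sub smooth_bump by (auto simp: test_functions_def)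
qed

text \<open>Inside the box all arguments of \<open>flat\<close> are positive and
  \<open>exp (- c / t)\<close> tends to 1 as \<open>c\<close> tends to 0; outside, some factor
  vanishes for every \<open>c\<close>.\<close>

lemma bump_tendsto: "(\<lambda>n. bump a b (1 / Suc n) x) \<longlonglongrightarrow> indicator (box a b) x"
proof (cases "x \<in> box a b")
  case True
  have fl: "(\<lambda>n. flat (1 / Suc n) 0 t) \<longlonglongrightarrow> 1" if "t > 0" for t
  proof -
    have "(\<lambda>n. exp (- (1 / Suc n) / t)) \<longlonglongrightarrow> exp (- 0 / t)"
      using that by (intro tendsto_intros LIMSEQ_inverse_real_of_nat[unfolded inverse_eq_divide]) simp
    then show ?thesis using that by (simp add: flat_def)
  qed
  have "(\<lambda>n. bump a b (1 / Suc n) x) \<longlonglongrightarrow> (\<Prod>i\<in>(Basis::'a set). 1 * 1)"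
    unfolding bump_def using True by (intro tendsto_prod tendsto_mult fl) (auto simp: mem_box)
  then show ?thesis using True by simp
qed (simp add: bump_eq_0)

section \<open>Uniqueness of the weak gradient\<close>

lemma sigma_finite_lebesgue: "sigma_finite_measure (lebesgue :: 'a::euclidean_space measure)"
proof
  obtain A :: "'a set set" where "countable A" "A \<subseteq> sets lborel" "\<Union>A = space lborel"
      "\<forall>a\<in>A. emeasure lborel a \<noteq> \<infinity>"
    using lborel.sigma_finite_countable by blast
  then show "\<exists>A :: 'a set set. countable A \<and> A \<subseteq> sets lebesgue \<and> \<Union>A = space lebesgue \<and> (\<forall>a\<in>A. emeasure lebesgue a \<noteq> \<infinity>)"
    by (intro exI[of _ A]) (auto simp: subset_iff)
qed

text \<open>Boxes are stable under intersection and generate the Borel sets, so the class of sets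
  with zero integral grows from boxes to all of them. The integral over the whole space is a
  separate premise, needed for complements, because the space is not a box.\<close>

lemma box_integrals_zero:
  fixes f :: "'a::euclidean_space \<Rightarrow> real"
  assumes f: "integrable lebesgue f"
    and zero: "\<And>a b. set_lebesgue_integral lebesgue (box a b) f = 0"
    and UNIV: "integral\<^sup>L lebesgue f = 0"
  shows "AE x in lebesgue. f x = 0"
proof (rule sigma_finite_measure.density_zero[OF sigma_finite_lebesgue f])
  have si: "set_integrable lebesgue A f" if "A \<in> sets lebesgue" for A
    unfolding set_integrable_def by (rule integrable_mult_indicator[OF that f])
  have borel: "set_lebesgue_integral lebesgue A f = 0" if "A \<in> sets borel" for A :: "'a set"
  proof -
    let ?G = "range (\<lambda>(a, b). box a b :: 'a set)"
    have leb: "A \<in> sets lebesgue" if "A \<in> sigma_sets UNIV ?G" for A :: "'a set"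
    proof -
      have "sets (sigma UNIV ?G) = sigma_sets UNIV ?G" by (rule sets_measure_of) simp
      then show ?thesis using that borel_eq_box[where 'a='a] by (metis sets_completionI_sets sets_lborel)
    qed
    have "Int_stable ?G" by (auto simp: Int_stable_def box_Int_box)
    moreover have "?G \<subseteq> Pow UNIV" by simp
    moreover have "A \<in> sigma_sets UNIV ?G" using that unfolding borel_eq_box by simp
    ultimately show ?thesis
    proof (induction rule: sigma_sets_induct_disjoint[where \<Omega> = UNIV])
      case (compl A)
      have "UNIV - A \<in> sets lebesgue" using sets.compl_sets[OF leb[OF compl(1)]] by simp
      then have "integral\<^sup>L lebesgue f = set_lebesgue_integral lebesgue A f + set_lebesgue_integral lebesgue (UNIV - A) f"
        using set_integral_Un[of A "UNIV - A" lebesgue f] si leb[OF compl(1)]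
        by (simp add: set_lebesgue_integral_def sets.compl_sets)
      then show ?case using UNIV compl by simp
    next
      case (union A)
      then show ?case
        using lebesgue_integral_countable_add[of A lebesgue f] leb si
        by (auto simp: disjoint_family_on_def image_subset_iff sets.countable_UN)
    qed (auto simp: zero, simp add: set_lebesgue_integral_def)
  qed
  fix A :: "'a set" assume "A \<in> sets lebesgue"
  \<comment> \<open>A Lebesgue set is a Borel set together with a part of a Borel null set.\<close>
  then obtain S N N' where A: "A = S \<union> N" "N \<subseteq> N'" "N' \<in> null_sets lborel" "S \<in> sets lborel"
    by (rule sets_completionE)
  have "AE x in lebesgue. x \<notin> N'" using A by (intro AE_not_in) (auto intro: null_sets_completionI)
  then have "set_lebesgue_integral lebesgue A f = set_lebesgue_integral lebesgue S f"
    unfolding set_lebesgue_integral_def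
  proof (intro integral_cong_AE)
    show "(\<lambda>x. indicat_real A x *\<^sub>R f x) \<in> borel_measurable lebesgue"
        "(\<lambda>x. indicat_real S x *\<^sub>R f x) \<in> borel_measurable lebesgue"
      using si[of A] si[of S] \<open>A \<in> sets lebesgue\<close> A(4)
      unfolding set_integrable_def by (auto dest: borel_measurable_integrable)
  qed (use A in \<open>auto simp: indicator_def elim!: eventually_mono\<close>)
  then show "set_lebesgue_integral lebesgue A f = 0" using borel A by simp
qed

text \<open>The fundamental lemma of the calculus of variations. Bumps recover the integrals over
  boxes whose closure lies in the domain, and countably many such boxes exhaust it.\<close>

lemma integral_test_zero_imp_AE_zero:
  fixes h :: "'a::euclidean_space \<Rightarrow> real"
  assumes \<Omega>: "open \<Omega>" and h: "integrable (lebesgue_on \<Omega>) h"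
    and test: "\<And>\<phi>. \<phi> \<in> test_functions \<Omega> \<Longrightarrow> (LINT x|lebesgue_on \<Omega>. h x * \<phi> x) = 0"
  shows "AE x in lebesgue_on \<Omega>. h x = 0"
proof -
  have \<Omega>s: "\<Omega> \<in> sets lebesgue" using \<Omega> by auto
  define f where "f x = indicator \<Omega> x * h x" for x
  have f: "integrable lebesgue f" using h \<Omega>s by (simp add: integrable_restrict_space f_def[abs_def])
  have small: "set_lebesgue_integral lebesgue (box a b) f = 0" if ab: "cbox a b \<subseteq> \<Omega>" for a b
  proof -
    have eq: "integral\<^sup>L lebesgue (\<lambda>x. f x * \<phi> x) = 0" if "\<phi> \<in> test_functions \<Omega>" for \<phi>
      using test[OF that] \<Omega>s by (simp add: integral_restrict_space f_def mult.assoc)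
    have "(\<lambda>n. integral\<^sup>L lebesgue (\<lambda>x. f x * bump a b (1 / Suc n) x)) \<longlonglongrightarrow> 
        integral\<^sup>L lebesgue (\<lambda>x. f x * indicator (box a b) x)"
    proof (rule integral_dominated_convergence[where w = "\<lambda>x. norm (f x)"])
      have "bump a b (1 / Suc n) \<in> borel_measurable lebesgue" for n
        using borel_measurable_continuous_onI[OF smooth_continuous[OF smooth_bump[of "1 / Suc n" a b]]]
        by (intro measurable_completion) simp
      then show "(\<lambda>x. f x * bump a b (1 / Suc n) x) \<in> borel_measurable lebesgue" for n
        using f by auto
      show "AE x in lebesgue. norm (f x * bump a b (1 / Suc n) x) \<le> norm (f x)" for n
        using bump_01[of "1 / Suc n" a b] by (intro AE_I2) (auto simp: abs_mult intro!: mult_left_le)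
      show "AE x in lebesgue. (\<lambda>n. f x * bump a b (1 / Suc n) x) \<longlonglongrightarrow> f x * indicator (box a b) x"
        by (intro AE_I2 tendsto_intros bump_tendsto)
    qed (use f in \<open>auto intro!: borel_measurable_times borel_measurable_indicator\<close>)
    then have "integral\<^sup>L lebesgue (\<lambda>x. f x * indicator (box a b) x) = 0"
      using eq[OF bump_test[OF _ ab]] by (simp add: LIMSEQ_const_iff)
    then show ?thesis by (simp add: set_lebesgue_integral_def mult.commute)
  qed
  \<comment> \<open>The function is cut off by one such box. Intersecting this with any box gives
    again a box, with closure in the domain unless empty, so all box integrals of the cut function
    vanish.\<close>
  have loc: "AE x in lebesgue. indicator (box a b) x * f x = 0" if ab: "cbox a b \<subseteq> \<Omega>" for a b
  proof (rule box_integrals_zero)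
    show "integrable lebesgue (\<lambda>x. indicator (box a b) x * f x)"
      using integrable_mult_indicator[OF _ f, of "box a b"] by simp
    fix c d :: 'a
    obtain c' d' where cd: "box c d \<inter> box a b = box c' d'" unfolding box_Int_box by blast
    show "set_lebesgue_integral lebesgue (box c d) (\<lambda>x. indicator (box a b) x * f x) = 0"
    \<comment> \<open>The empty box is separate because its closure need not be the closed box with
      the same corners.\<close>
    proof (cases "box c' d' = {}")
      case True
      then show ?thesis using cd unfolding set_lebesgue_integral_def
        by (auto simp: indicator_def intro!: integral_eq_zero_AE AE_I2)
    next
      case False
      have "closure (box c' d') \<subseteq> cbox a b"
        using cd box_subset_cbox by (intro closure_minimal) auto
      then have "cbox c' d' \<subseteq> \<Omega>" using ab False by simp
      then show ?thesis using small[of c' d'] cd[symmetric] unfolding set_lebesgue_integral_def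
        by (simp add: indicator_inter_arith mult.assoc)
    qed
  next
    show "integral\<^sup>L lebesgue (\<lambda>x. indicator (box a b) x * f x) = 0"
      using small[OF ab] by (simp add: set_lebesgue_integral_def)
  qed
  obtain D where D: "countable D" "D \<subseteq> Pow \<Omega>" "\<And>X. X \<in> D \<Longrightarrow> \<exists>a b. X = cbox a b" "\<Union>D = \<Omega>"
    using open_countable_Union_open_cbox[OF \<Omega>] by metis
  have "AE x in lebesgue. x \<in> X \<longrightarrow> f x = 0" if X: "X \<in> D" for X
  proof -
    obtain a b where ab: "X = cbox a b" using D X by blast
    \<comment> \<open>The domain is covered by closed boxes, but the claim is known on open ones;
      the faces between them are null.\<close>
    have "AE x in lebesgue. x \<notin> cbox a b - box a b"
      using negligible_frontier_interval[of a b] by (intro AE_not_in) (simp add: negligible_iff_null_sets)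
    moreover have "AE x in lebesgue. indicator (box a b) x * f x = 0" using D X ab by (intro loc) auto
    ultimately show ?thesis by eventually_elim (auto simp: ab indicator_def)
  qed
  then have "AE x in lebesgue. \<forall>X\<in>D. x \<in> X \<longrightarrow> f x = 0" 
    using AE_ball_countable[OF D(1), of "\<lambda>x X. x \<in> X \<longrightarrow> f x = 0" lebesgue] by blast
  then have "AE x in lebesgue. x \<in> \<Omega> \<longrightarrow> h x = 0"
    by eventually_elim (use D(4) in \<open>auto simp: f_def indicator_def split: if_splits\<close>)
  then show ?thesis using \<Omega>s by (simp add: AE_restrict_space_iff)
qed

section \<open>Smooth functions as Sobolev functions\<close>

lemma smooth_line_deriv:
  assumes "smooth F"
  shows "((\<lambda>t. F (x + t *\<^sub>R b)) has_real_derivative frechet_derivative F (at (x + t *\<^sub>R b)) b) (at t)"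
proof -
  have "((\<lambda>t. x + t *\<^sub>R b) has_vector_derivative b) (at t)"
    by (auto intro!: derivative_eq_intros)
  then have "((F \<circ> (\<lambda>t. x + t *\<^sub>R b)) has_vector_derivative frechet_derivative F (at (x + t *\<^sub>R b)) b) (at t)"
    using vector_derivative_diff_chain_within[of "\<lambda>t. x + t *\<^sub>R b" b t UNIV F] 
      smooth_has_derivative[OF assms, THEN has_derivative_at_withinI] by auto
  then show ?thesis by (simp add: has_real_derivative_iff_has_vector_derivative o_def)
qed

lemma frechet_zero_outside:
  assumes "x \<notin> closure {x. F x \<noteq> (0::real)}"
  shows "frechet_derivative F (at x) = (\<lambda>_. 0)"
proof (rule frechet_derivative_at[symmetric])
  show "(F has_derivative (\<lambda>_. 0)) (at x)"
  proof (rule has_derivative_transform_within_open[where s = "- closure {x. F x \<noteq> 0}"])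
    fix y assume "y \<in> - closure {x. F x \<noteq> 0}"
    then show "0 = F y" using closure_subset[of "{x. F x \<noteq> 0}"] by auto
  qed (use assms in auto)
qed

lemma integrable_compact_support:
  fixes h :: "'a::euclidean_space \<Rightarrow> real"
  assumes "continuous_on UNIV h" "compact K" "\<And>x. x \<notin> K \<Longrightarrow> h x = 0"
  shows "integrable lborel h"
proof -
  have "integrable lborel (\<lambda>x. indicator K x *\<^sub>R h x)"
    using assms by (intro borel_integrable_compact) (auto intro: continuous_on_subset)
  moreover have "indicator K x *\<^sub>R h x = h x" for x using assms(3)[of x] by (cases "x \<in> K") auto
  ultimately show ?thesis by (simp only:)
qed

text \<open>By translation invariance every difference quotient has integral zero, and dominated
  convergence passes this on to the derivative.\<close>

lemma integral_frechet_zero: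
  assumes F: "smooth F" and K: "compact (closure {x. F x \<noteq> 0})" and b: "b \<in> Basis"
  shows "(LINT x|lborel. frechet_derivative F (at x) b) = 0"
proof -
  let ?D = "\<lambda>x. frechet_derivative F (at x) b"
  let ?S = "closure {x. F x \<noteq> 0}"
  have F0: "F x = 0" if "x \<notin> ?S" for x using that closure_subset[of "{x. F x \<noteq> 0}"] by auto
  have D0: "?D x = 0" if "x \<notin> ?S" for x using frechet_zero_outside[OF that] by simp
  have Dc: "continuous_on UNIV ?D" by (rule smooth_continuous[OF smooth_frechet[OF F b]])
  have Fc: "continuous_on UNIV F" by (rule smooth_continuous[OF F])
  have Fi: "integrable lborel F" by (rule integrable_compact_support[OF Fc K F0])
  have Dm: "?D \<in> borel_measurable borel" and Fm [measurable]: "F \<in> borel_measurable borel"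
    using Dc Fc borel_measurable_continuous_onI by auto
  obtain R where R: "R > 0" "\<And>x. x \<in> ?S \<Longrightarrow> norm x \<le> R"
    using compact_imp_bounded[OF K] by (auto simp: bounded_pos)
  have "bounded (?D ` ?S)" using K Dc by (intro compact_imp_bounded compact_continuous_image) (auto intro: continuous_on_subset)
  then obtain M where M0: "M > 0" "\<And>x. x \<in> ?S \<Longrightarrow> \<bar>?D x\<bar> \<le> M" by (auto simp: bounded_pos)
  have M: "\<bar>?D x\<bar> \<le> M" for x using M0 D0 by (cases "x \<in> ?S") auto
  define Q where "Q n x = (F ((1 / real (Suc n)) *\<^sub>R b + x) - F x) / (1 / real (Suc n))" for n x
  have Qlim: "(\<lambda>n. Q n x) \<longlonglongrightarrow> ?D x" for x
  proof -
    have "((\<lambda>h. (F (x + h *\<^sub>R b) - F x) / h) \<longlongrightarrow> ?D x) (at 0)"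
      using smooth_line_deriv[OF F, of x b 0] by (simp add: DERIV_def)
    moreover have "filterlim (\<lambda>n. 1 / real (Suc n)) (at 0) sequentially"
      using LIMSEQ_inverse_real_of_nat unfolding inverse_eq_divide by (auto simp: filterlim_at)
    ultimately show ?thesis unfolding Q_def by (auto dest: filterlim_compose simp: add.commute)
  qed
  \<comment> \<open>The mean value theorem bounds the quotients uniformly; the shifts have length at
    most 1, so all quotients are supported in the ball of radius \<open>R + 1\<close>.\<close>
  have Qbd: "\<bar>Q n x\<bar> \<le> M * indicator (cball 0 (R + 1)) x" for n x
  proof (cases "x \<in> cball 0 (R + 1)")
    case True
    have "\<exists>z>0. z < 1 / real (Suc n) \<and> F (x + (1 / real (Suc n)) *\<^sub>R b) - F (x + 0 *\<^sub>R b) = (1 / real (Suc n) - 0) * ?D (x + z *\<^sub>R b)"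
      by (intro MVT2) (auto intro: smooth_line_deriv[OF F])
    then obtain z where "F (x + (1 / real (Suc n)) *\<^sub>R b) - F x = (1 / real (Suc n)) * ?D (x + z *\<^sub>R b)"
      by auto
    then have "Q n x = ?D (x + z *\<^sub>R b)" by (simp add: Q_def add.commute)
    then show ?thesis using M True by simp
  next
    case False
    have "norm x \<le> norm ((1 / real (Suc n)) *\<^sub>R b + x) + norm ((1 / real (Suc n)) *\<^sub>R b)" 
      using norm_triangle_ineq4[of "(1 / real (Suc n)) *\<^sub>R b + x" "(1 / real (Suc n)) *\<^sub>R b"] by simp
    moreover have "norm ((1 / real (Suc n)) *\<^sub>R b) \<le> 1" using b by simp
    ultimately have "x \<notin> ?S" "(1 / real (Suc n)) *\<^sub>R b + x \<notin> ?S" 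
    proof -
      assume a: "norm x \<le> norm ((1 / real (Suc n)) *\<^sub>R b + x) + norm ((1 / real (Suc n)) *\<^sub>R b)"
        "norm ((1 / real (Suc n)) *\<^sub>R b) \<le> 1"
      have "norm x > R + 1" using False by simp
      with a have "\<not> norm x \<le> R" "\<not> norm ((1 / real (Suc n)) *\<^sub>R b + x) \<le> R" by linarith+
      then show "x \<notin> ?S" "(1 / real (Suc n)) *\<^sub>R b + x \<notin> ?S" using R(2) by blast+
    qed
    then have "F x = 0" "F ((1 / real (Suc n)) *\<^sub>R b + x) = 0" using F0 by blast+
    then show ?thesis using M0(1) by (simp only: Q_def) simp
  qed
  have tr: "integrable lborel (\<lambda>x. F (c + x)) \<and> (LINT x|lborel. F (c + x)) = (LINT x|lborel. F x)" for c
    using integrable_distr_eq[of "(+) c" lborel borel F] integral_distr[of "(+) c" lborel borel F] Fi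
    by (simp add: lborel_distr_plus)
  have "(\<lambda>n. LINT x|lborel. Q n x) \<longlonglongrightarrow> (LINT x|lborel. ?D x)"
  proof (rule integral_dominated_convergence[where w = "\<lambda>x. M * indicator (cball 0 (R + 1)) x"])
    show "integrable lborel (\<lambda>x::'a. M * indicator (cball 0 (R + 1)) x)" 
      using emeasure_lborel_cball_finite by (intro integrable_mult_right integrable_real_indicator) auto
  qed (use Qlim Qbd Dm in \<open>auto simp: Q_def\<close>)
  moreover have "(LINT x|lborel. Q n x) = 0" for n
    unfolding Q_def using tr Fi by simp
  ultimately show ?thesis by (simp add: LIMSEQ_const_iff)
qed

lemma integral_lebesgue_on_eq:
  fixes h :: "'a::euclidean_space \<Rightarrow> real"
  assumes "\<Omega> \<in> sets borel" "h \<in> borel_measurable borel" "\<And>x. x \<notin> \<Omega> \<Longrightarrow> h x = 0"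
  shows "(LINT x|lebesgue_on \<Omega>. h x) = (LINT x|lborel. h x)"
proof -
  have "(LINT x|lebesgue_on \<Omega>. h x) = (LINT x|lebesgue. indicator \<Omega> x *\<^sub>R h x)"
    using assms by (subst integral_restrict_space) auto
  also have "\<dots> = (LINT x|lebesgue. h x)"
  proof -
    have "indicator \<Omega> x *\<^sub>R h x = h x" for x using assms(3)[of x] by (cases "x \<in> \<Omega>") auto
    then show ?thesis by (simp only:)
  qed
  finally show ?thesis using assms by (simp add: integral_completion)
qed

lemma continuous_L2:
  fixes f :: "'a::euclidean_space \<Rightarrow> 'b::euclidean_space"
  assumes f: "continuous_on UNIV f" and \<Omega>: "open \<Omega>" "bounded \<Omega>"
  shows "f \<in> L2 (lebesgue_on \<Omega>)"
proof -
  interpret finite_measure "lebesgue_on \<Omega>"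
    using \<Omega> by (intro finite_measure_lebesgue_on) (auto intro: lmeasurable_open)
  have m: "f \<in> borel_measurable (lebesgue_on \<Omega>)"
    by (rule measurable_restrict_space1, rule measurable_completion) 
      (use borel_measurable_continuous_onI[OF f] in simp)
  have "bounded (f ` closure \<Omega>)"
    using \<Omega> f by (intro compact_imp_bounded compact_continuous_image) (auto intro: continuous_on_subset)
  then obtain M where M: "M > 0" "\<And>x. x \<in> closure \<Omega> \<Longrightarrow> norm (f x) \<le> M" by (auto simp: bounded_pos)
  have "integrable (lebesgue_on \<Omega>) (\<lambda>x. (norm (f x))\<^sup>2)"
  proof (rule integrable_const_bound[where B = "M\<^sup>2"])
    show "AE x in lebesgue_on \<Omega>. norm ((norm (f x))\<^sup>2) \<le> M\<^sup>2"
      using M closure_subset[of \<Omega>] by (intro AE_I2) (auto intro!: power_mono)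
  qed (use m in measurable)
  then show ?thesis using m by (simp add: L2_def)
qed

definition cgrad :: "('a::euclidean_space \<Rightarrow> real) \<Rightarrow> 'a \<Rightarrow> 'a" where
  "cgrad \<phi> x = (\<Sum>b\<in>Basis. frechet_derivative \<phi> (at x) b *\<^sub>R b)"

lemma cgrad_inner: "b \<in> Basis \<Longrightarrow> inner (cgrad \<phi> x) b = frechet_derivative \<phi> (at x) b"
  by (simp add: cgrad_def)

lemma continuous_cgrad: "smooth \<phi> \<Longrightarrow> continuous_on UNIV (cgrad \<phi>)"
  unfolding cgrad_def[abs_def] by (intro continuous_intros smooth_continuous[OF smooth_frechet])

text \<open>Integration by parts: the product with a test function has compact support, so its
  derivative integrates to zero.\<close>

lemma smooth_weak_grad:
  assumes \<Omega>: "open \<Omega>" "bounded \<Omega>" and \<phi>: "smooth \<phi>"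
  shows "is_weak_grad \<Omega> \<phi> (cgrad \<phi>)"
  unfolding is_weak_grad_def
proof (intro conjI ballI)
  show "cgrad \<phi> \<in> L2 (lebesgue_on \<Omega>)" using continuous_L2[OF continuous_cgrad[OF \<phi>] \<Omega>] .
  fix \<psi> b assume "\<psi> \<in> test_functions \<Omega>" and b: "(b::'a) \<in> Basis"
  then have \<psi>: "smooth \<psi>" and K: "compact (closure {x. \<psi> x \<noteq> 0})" and K\<Omega>: "closure {x. \<psi> x \<noteq> 0} \<subseteq> \<Omega>"
    by (auto simp: test_functions_def)
  define K where "K = closure {x. \<psi> x \<noteq> 0}"
  let ?a = "\<lambda>x. \<phi> x * frechet_derivative \<psi> (at x) b" and ?c = "\<lambda>x. frechet_derivative \<phi> (at x) b * \<psi> x"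
  have z: "\<psi> x = 0" "frechet_derivative \<psi> (at x) b = 0" if "x \<notin> K" for x
    using that closure_subset[of "{x. \<psi> x \<noteq> 0}"] frechet_zero_outside[of x \<psi>] by (auto simp: K_def)
  have ac: "continuous_on UNIV ?a" "continuous_on UNIV ?c"
    using \<phi> \<psi> b by (auto intro!: smooth_continuous smooth_mult intro: smooth_frechet)
  have ai: "integrable lborel ?a" "integrable lborel ?c"
    using ac z by (auto intro!: integrable_compact_support[OF _ K[folded K_def]])
  have eq: "(LINT x|lebesgue_on \<Omega>. h x) = (LINT x|lborel. h x)" 
    if "continuous_on UNIV h" "\<And>x. x \<notin> K \<Longrightarrow> h x = 0" for h :: "'a \<Rightarrow> real"
    using that K\<Omega>[folded K_def] \<Omega> by (intro integral_lebesgue_on_eq borel_measurable_continuous_onI) auto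
  have "closure {x. \<phi> x * \<psi> x \<noteq> 0} \<subseteq> K" unfolding K_def by (intro closure_mono) auto
  then have K': "compact (closure {x. \<phi> x * \<psi> x \<noteq> 0})"
    using K[folded K_def] by (metis closed_closure compact_Int_closed inf.absorb2)
  have "frechet_derivative (\<lambda>x. \<phi> x * \<psi> x) (at x) b = ?a x + ?c x" for x
    using frechet_derivative_at[OF has_derivative_mult[OF smooth_has_derivative[OF \<phi>] smooth_has_derivative[OF \<psi>]], of x]
    by metis
  then have "(LINT x|lborel. ?a x + ?c x) = 0"
    using integral_frechet_zero[OF smooth_mult[OF \<phi> \<psi>] K' b] by simp
  then have "(LINT x|lborel. ?a x) = - (LINT x|lborel. ?c x)" using ai by simp
  then show "(LINT x|lebesgue_on \<Omega>. \<phi> x * frechet_derivative \<psi> (at x) b) =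
      - (LINT x|lebesgue_on \<Omega>. inner (cgrad \<phi> x) b * \<psi> x)"
    using ac z by (simp add: eq cgrad_inner[OF b])
qed

section \<open>Square-integrable functions\<close>

lemma L2_measurable: "f \<in> L2 M \<Longrightarrow> f \<in> borel_measurable M"
  by (simp add: L2_def)

lemma L2_integrable: "f \<in> L2 M \<Longrightarrow> integrable M (\<lambda>x. (norm (f x))\<^sup>2)"
  by (simp add: L2_def)

lemma L2_inner_integrable:
  assumes "f \<in> L2 M" "g \<in> L2 M"
  shows "integrable M (\<lambda>x. inner (f x) (g x))"
proof (rule Bochner_Integration.integrable_bound)
  show "integrable M (\<lambda>x. (norm (f x))\<^sup>2 + (norm (g x))\<^sup>2)"
    using assms by (auto simp: L2_def)
  show "(\<lambda>x. inner (f x) (g x)) \<in> borel_measurable M"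
    using assms by (auto simp: L2_def)
  have "norm (inner (f x) (g x)) \<le> norm ((norm (f x))\<^sup>2 + (norm (g x))\<^sup>2)" for x
    using Cauchy_Schwarz_ineq2[of "f x" "g x"] sum_squares_bound[of "norm (f x)" "norm (g x)"]
      mult_nonneg_nonneg[OF norm_ge_zero norm_ge_zero, of "f x" "g x"] by simp
  then show "AE x in M. norm (inner (f x) (g x)) \<le> norm ((norm (f x))\<^sup>2 + (norm (g x))\<^sup>2)"
    by simp
qed

lemma L2_weighted_integrable:
  assumes "f \<in> L2 M" "g \<in> L2 M" and a: "a \<in> borel_measurable M" "AE x in M. \<bar>a x\<bar> \<le> C"
  shows "integrable M (\<lambda>x. a x * inner (f x) (g x))"
proof (rule Bochner_Integration.integrable_bound)
  show "integrable M (\<lambda>x. C * inner (f x) (g x))" using L2_inner_integrable[OF assms(1,2)] by simp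
  show "(\<lambda>x. a x * inner (f x) (g x)) \<in> borel_measurable M"
    using assms by (auto simp: L2_def)
  show "AE x in M. norm (a x * inner (f x) (g x)) \<le> norm (C * inner (f x) (g x))"
    using a(2) by eventually_elim (auto simp: abs_mult intro!: mult_right_mono)
qed

lemma L2_add: "f \<in> L2 M \<Longrightarrow> g \<in> L2 M \<Longrightarrow> (\<lambda>x. f x + g x) \<in> L2 M"
  using L2_inner_integrable[of f M g] L2_inner_integrable[of f M f] L2_inner_integrable[of g M g]
  by (auto simp: L2_def power2_norm_eq_inner inner_add inner_commute)

lemma L2_scl: "f \<in> L2 M \<Longrightarrow> (\<lambda>x. c *\<^sub>R f x) \<in> L2 M"
  by (auto simp: L2_def power_mult_distrib)

lemma L2_scl_real: "f \<in> L2 M \<Longrightarrow> (\<lambda>x. c * f x :: real) \<in> L2 M"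
  using L2_scl[of f M c] by simp

lemma L2_diff: "f \<in> L2 M \<Longrightarrow> g \<in> L2 M \<Longrightarrow> (\<lambda>x. f x - g x) \<in> L2 M"
  using L2_add[of f M "\<lambda>x. (-1) *\<^sub>R g x"] L2_scl[of g M "-1"] by simp

lemma L2_inner_const: "f \<in> L2 M \<Longrightarrow> (\<lambda>x. inner (f x) b) \<in> L2 M"
proof -
  assume f: "f \<in> L2 M"
  have "integrable M (\<lambda>x. (inner (f x) b)\<^sup>2)"
  proof (rule Bochner_Integration.integrable_bound)
    show "integrable M (\<lambda>x. (norm (f x))\<^sup>2 * (norm b)\<^sup>2)" using f by (auto simp: L2_def)
    have "norm ((inner (f x) b)\<^sup>2) \<le> norm ((norm (f x))\<^sup>2 * (norm b)\<^sup>2)" for x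
      using Cauchy_Schwarz_ineq[of "f x" b] by (simp add: power2_norm_eq_inner)
    then show "AE x in M. norm ((inner (f x) b)\<^sup>2) \<le> norm ((norm (f x))\<^sup>2 * (norm b)\<^sup>2)" by simp
  qed (use f in \<open>auto simp: L2_def\<close>)
  then show ?thesis using f by (auto simp: L2_def)
qed

text \<open>Makes Cauchy-Schwarz and the quadratic triangle estimate for integrals instances of the
  abstract ones.\<close>

lemma L2_semi_ip: "semi_ip (L2 M) (\<lambda>f g x. f x + g x) (\<lambda>c f x. c *\<^sub>R f x)
   (\<lambda>f g. LINT x|M. inner (f x) (g x))"
proof (standard, goal_cases)
  case (3 f g)
  then show ?case by (simp add: inner_commute)
qed (auto simp: L2_add L2_scl inner_add_left L2_inner_integrable)

lemma L2_Cauchy_Schwarz: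
  assumes "f \<in> L2 M" "g \<in> L2 M"
  shows "(LINT x|M. inner (f x) (g x))\<^sup>2 \<le> (LINT x|M. (norm (f x))\<^sup>2) * (LINT x|M. (norm (g x))\<^sup>2)"
  using semi_ip.Cauchy_Schwarz[OF L2_semi_ip assms] by (simp add: power2_norm_eq_inner)

lemma L2_add_sq:
  assumes "f \<in> L2 M" "g \<in> L2 M"
  shows "(LINT x|M. (norm (f x + g x))\<^sup>2) \<le> 2 * (LINT x|M. (norm (f x))\<^sup>2) + 2 * (LINT x|M. (norm (g x))\<^sup>2)"
  using semi_ip.nrm_add_sq[OF L2_semi_ip assms] by (simp add: power2_norm_eq_inner)

lemma L2_tendsto_inner:
  assumes s: "\<And>n. s n \<in> L2 M" and f: "f \<in> L2 M" and g: "g \<in> L2 M"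
    and lim: "(\<lambda>n. LINT x|M. (norm (s n x - f x))\<^sup>2) \<longlonglongrightarrow> 0"
  shows "(\<lambda>n. LINT x|M. inner (s n x) (g x)) \<longlonglongrightarrow> (LINT x|M. inner (f x) (g x))"
proof -
  have "(\<lambda>n. (LINT x|M. inner (s n x - f x) (g x))\<^sup>2) \<longlonglongrightarrow> 0"
  proof (rule tendsto_sandwich[where f = "\<lambda>_. 0"])
    show "(\<lambda>n. (LINT x|M. (norm (s n x - f x))\<^sup>2) * (LINT x|M. (norm (g x))\<^sup>2)) \<longlonglongrightarrow> 0"
      using tendsto_mult_right[OF lim] by simp
  qed (use L2_Cauchy_Schwarz[OF L2_diff[OF s f] g] in auto)
  then have "(\<lambda>n. LINT x|M. inner (s n x - f x) (g x)) \<longlonglongrightarrow> 0" by simp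
  moreover have "(LINT x|M. inner (s n x - f x) (g x)) = (LINT x|M. inner (s n x) (g x)) - (LINT x|M. inner (f x) (g x))" for n
    using L2_inner_integrable[OF s g] L2_inner_integrable[OF f g] by (simp add: inner_diff_left)
  ultimately show ?thesis by (simp add: LIM_zero_iff)
qed

text \<open>Riesz-Fischer on a finite measure space: Cauchy in mean square implies Cauchy in mean,
  hence a subsequence converges almost everywhere, and Fatou's lemma carries the Cauchy bounds over
  to its limit.\<close>

lemma L2_complete:
  fixes s :: "nat \<Rightarrow> 'a \<Rightarrow> 'b::euclidean_space"
  assumes fin: "finite_measure M" and s: "\<And>n. s n \<in> L2 M"
    and Cauchy: "\<And>\<epsilon>. \<epsilon> > 0 \<Longrightarrow> \<exists>k. \<forall>m\<ge>k. \<forall>n\<ge>k. (LINT x|M. (norm (s m x - s n x))\<^sup>2) < \<epsilon>"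
  obtains f where "f \<in> L2 M" "(\<lambda>n. LINT x|M. (norm (s n x - f x))\<^sup>2) \<longlonglongrightarrow> 0"
proof -
  interpret finite_measure M by (rule fin)
  have sm [measurable]: "s n \<in> borel_measurable M" for n using s by (simp add: L2_def)
  have one: "(\<lambda>x. 1 :: real) \<in> L2 M" by (simp add: L2_def)
  have norm_L2: "(\<lambda>x. norm (h x)) \<in> L2 M" if "h \<in> L2 M" for h :: "'a \<Rightarrow> 'b"
    using that by (auto simp: L2_def)
  have int1: "integrable M h" if "h \<in> L2 M" for h :: "'a \<Rightarrow> 'b"
    using L2_inner_integrable[OF norm_L2[OF that] one] L2_measurable[OF that] by (simp add: integrable_norm_iff)
  \<comment> \<open>\<open>+ 1\<close> makes the factor positive, so that it can be divided by
    below.\<close>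
  have CS1: "(LINT x|M. norm (h x))\<^sup>2 \<le> (LINT x|M. (norm (h x))\<^sup>2) * (measure M (space M) + 1)" if "h \<in> L2 M" for h :: "'a \<Rightarrow> 'b"
  proof -
    have "(LINT x|M. norm (h x))\<^sup>2 \<le> (LINT x|M. (norm (h x))\<^sup>2) * measure M (space M)"
      using L2_Cauchy_Schwarz[OF norm_L2[OF that] one] by simp
    also have "\<dots> \<le> (LINT x|M. (norm (h x))\<^sup>2) * (measure M (space M) + 1)"
      by (intro mult_left_mono) auto
    finally show ?thesis .
  qed
  have mpos: "measure M (space M) + 1 > 0" by (simp add: add_nonneg_pos)
  have "\<exists>N. \<forall>i\<ge>N. \<forall>j\<ge>N. (LINT x|M. norm (s i x - s j x)) < e" if "e > 0" for e
  proof -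
    have "e\<^sup>2 / (measure M (space M) + 1) > 0" using that mpos by simp
    from Cauchy[OF this] obtain N where N: "\<And>i j. i \<ge> N \<Longrightarrow> j \<ge> N \<Longrightarrow>
        (LINT x|M. (norm (s i x - s j x))\<^sup>2) < e\<^sup>2 / (measure M (space M) + 1)" by blast
    have "(LINT x|M. norm (s i x - s j x)) < e" if "i \<ge> N" "j \<ge> N" for i j
    proof -
      have "(LINT x|M. norm (s i x - s j x))\<^sup>2 < e\<^sup>2"
        using CS1[OF L2_diff[OF s s], of i j] N[OF that] mpos by (simp add: pos_less_divide_eq)
      then show ?thesis using \<open>e > 0\<close> by (simp add: power_less_imp_less_base)
    qed
    then show ?thesis by blast
  qed
  then obtain r where r: "strict_mono r" "AE x in M. Cauchy (\<lambda>i. s (r i) x)"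
    using cauchy_L1_AE_cauchy_subseq[of M s] int1[OF s] by metis
  define f where "f x = lim (\<lambda>i. s (r i) x)" for x
  have fm [measurable]: "f \<in> borel_measurable M" unfolding f_def[abs_def] by measurable
  have conv: "AE x in M. (\<lambda>i. s (r i) x) \<longlonglongrightarrow> f x"
    using r(2) by eventually_elim (simp add: f_def Cauchy_convergent convergent_LIMSEQ_iff[symmetric])
  have key: "(\<integral>\<^sup>+x. ennreal ((norm (s n x - f x))\<^sup>2) \<partial>M) \<le> ennreal \<epsilon>" 
    if k: "\<forall>m\<ge>k. \<forall>n\<ge>k. (LINT x|M. (norm (s m x - s n x))\<^sup>2) < \<epsilon>" and n: "n \<ge> k" for k n \<epsilon>
  proof -
    have "(\<integral>\<^sup>+x. ennreal ((norm (s n x - f x))\<^sup>2) \<partial>M) = (\<integral>\<^sup>+x. liminf (\<lambda>i. ennreal ((norm (s n x - s (r i) x))\<^sup>2)) \<partial>M)"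
    proof (rule nn_integral_cong_AE)
      show "AE x in M. ennreal ((norm (s n x - f x))\<^sup>2) = liminf (\<lambda>i. ennreal ((norm (s n x - s (r i) x))\<^sup>2))"
        using conv
      proof eventually_elim
        case (elim x)
        have "(\<lambda>i. ennreal ((norm (s n x - s (r i) x))\<^sup>2)) \<longlonglongrightarrow> ennreal ((norm (s n x - f x))\<^sup>2)"
          by (intro tendsto_intros elim)
        then show ?case by (rule lim_imp_Liminf[OF trivial_limit_sequentially, symmetric])
      qed
    qed
    also have "\<dots> \<le> liminf (\<lambda>i. \<integral>\<^sup>+x. ennreal ((norm (s n x - s (r i) x))\<^sup>2) \<partial>M)"
      by (rule nn_integral_liminf) measurable
    also have "\<dots> \<le> ennreal \<epsilon>"
    proof (rule Liminf_le)
      show "\<forall>\<^sub>F i in sequentially. (\<integral>\<^sup>+x. ennreal ((norm (s n x - s (r i) x))\<^sup>2) \<partial>M) \<le> ennreal \<epsilon>"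
      proof (rule eventually_sequentiallyI[of k])
        fix i assume "i \<ge> k"
        then have "r i \<ge> k" using seq_suble[OF r(1), of i] by linarith
        then have "(LINT x|M. (norm (s n x - s (r i) x))\<^sup>2) \<le> \<epsilon>" using k n by (intro less_imp_le) blast
        then show "(\<integral>\<^sup>+x. ennreal ((norm (s n x - s (r i) x))\<^sup>2) \<partial>M) \<le> ennreal \<epsilon>"
          using L2_integrable[OF L2_diff[OF s s], of n "r i"]
          by (subst nn_integral_eq_integral) (auto intro: ennreal_leI)
      qed
    qed simp
    finally show ?thesis .
  qed
  have diffL2: "(\<lambda>x. s n x - f x) \<in> L2 M" 
    if k: "\<forall>m\<ge>k. \<forall>n\<ge>k. (LINT x|M. (norm (s m x - s n x))\<^sup>2) < \<epsilon>" "n \<ge> k" for k n \<epsilon>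
  proof -
    have "(\<integral>\<^sup>+x. ennreal ((norm (s n x - f x))\<^sup>2) \<partial>M) < \<infinity>"
      using key[OF k] by (metis ennreal_less_top infinity_ennreal_def le_less_trans)
    then have "integrable M (\<lambda>x. (norm (s n x - f x))\<^sup>2)"
      by (intro integrableI_bounded) auto
    then show ?thesis by (simp add: L2_def)
  qed
  show ?thesis
  proof (rule that[of f])
    obtain k where k: "\<forall>m\<ge>k. \<forall>n\<ge>k. (LINT x|M. (norm (s m x - s n x))\<^sup>2) < 1" using Cauchy[of 1] by auto
    show "f \<in> L2 M" using L2_diff[OF s[of k] diffL2[OF k order_refl]] by simp
    show "(\<lambda>n. LINT x|M. (norm (s n x - f x))\<^sup>2) \<longlonglongrightarrow> 0"
    proof (rule LIMSEQ_I)
      fix e :: real assume "e > 0"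
      then obtain k where k: "\<forall>m\<ge>k. \<forall>n\<ge>k. (LINT x|M. (norm (s m x - s n x))\<^sup>2) < e / 2" 
        using Cauchy[of "e/2"] by auto
      have "norm ((LINT x|M. (norm (s n x - f x))\<^sup>2) - 0) < e" if n: "n \<ge> k" for n
      proof -
        have "ennreal (LINT x|M. (norm (s n x - f x))\<^sup>2) \<le> ennreal (e / 2)"
          using key[OF k n] L2_integrable[OF diffL2[OF k n]] by (simp add: nn_integral_eq_integral)
        then show ?thesis using \<open>e > 0\<close> by (simp add: ennreal_le_iff)
      qed
      then show "\<exists>no. \<forall>n\<ge>no. norm ((LINT x|M. (norm (s n x - f x))\<^sup>2) - 0) < e" by blast
    qed
  qed
qed

section \<open>The Sobolev space\<close>

text \<open>With \<open>c = 1\<close> and weight 1 this is the \<open>H\<^sup>1\<close> inner product, with \<open>c = 0\<close> the energy.\<close>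

definition form :: "'a::euclidean_space set \<Rightarrow> real \<Rightarrow> ('a \<Rightarrow> real) \<Rightarrow> ('a \<Rightarrow> real) \<Rightarrow> ('a \<Rightarrow> real) \<Rightarrow> real" where
  "form \<Omega> c a u v = c * (LINT x|lebesgue_on \<Omega>. u x * v x) + energy \<Omega> a u v"

text \<open>What makes \<open>energy\<close> a semi-inner product. It fits both the constant 1 and
  an admissible conductivity; the size of the lower bound matters only for coercivity.\<close>

definition weight :: "'a::euclidean_space set \<Rightarrow> ('a \<Rightarrow> real) \<Rightarrow> bool" where
  "weight \<Omega> a \<longleftrightarrow> a \<in> borel_measurable (lebesgue_on \<Omega>) \<and>
     (\<exists>C. AE x in lebesgue_on \<Omega>. \<bar>a x\<bar> \<le> C) \<and> (AE x in lebesgue_on \<Omega>. 0 \<le> a x)"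

lemma weight_one: "weight \<Omega> (\<lambda>_. 1)"
  by (auto simp: weight_def)

lemma weight_admissible:
  assumes "a \<in> admissible \<Omega>"
  shows "weight \<Omega> a"
proof -
  obtain a0 where a0: "a0 > 0" "AE x in lebesgue_on \<Omega>. a0 \<le> a x"
    using assms by (auto simp: admissible_def)
  from a0(2) have "AE x in lebesgue_on \<Omega>. 0 \<le> a x"
    by eventually_elim (use a0(1) in simp)
  then show ?thesis using assms by (auto simp: weight_def admissible_def)
qed

lemma H1_norm_form: "H1_norm \<Omega> u = sqrt (form \<Omega> 1 (\<lambda>_. 1) u u)"
  by (simp add: H1_norm_def form_def energy_def power2_norm_eq_inner flip: power2_eq_square)

locale bounded_open =
  fixes \<Omega> :: "'a::euclidean_space set"
  assumes open_dom: "open \<Omega>" and bounded_dom: "bounded \<Omega>"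
begin

abbreviation "M \<equiv> lebesgue_on \<Omega>"
abbreviation "fadd \<equiv> (\<lambda>u v (x::'a). u x + v x :: real)"
abbreviation "fscl \<equiv> (\<lambda>c u (x::'a). c * u x :: real)"

lemma finite_M: "finite_measure M"
  using open_dom bounded_dom by (intro finite_measure_lebesgue_on) (auto intro: lmeasurable_open)

lemma one_L2: "(\<lambda>x. 1 :: real) \<in> L2 M"
  using continuous_L2[OF continuous_on_const open_dom bounded_dom] .

lemma L2_prod_integrable: "u \<in> L2 M \<Longrightarrow> v \<in> L2 M \<Longrightarrow> integrable M (\<lambda>x. u x * v x :: real)"
  using L2_inner_integrable[of u M v] by simp

lemma test_L2: "\<phi> \<in> test_functions \<Omega> \<Longrightarrow> \<phi> \<in> L2 M"
  by (intro continuous_L2 open_dom bounded_dom smooth_continuous) (simp add: test_functions_def)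

lemma test_frechet_L2:
  "\<phi> \<in> test_functions \<Omega> \<Longrightarrow> b \<in> Basis \<Longrightarrow> (\<lambda>x. frechet_derivative \<phi> (at x) b) \<in> L2 M"
  by (intro continuous_L2 open_dom bounded_dom smooth_continuous smooth_frechet) (simp add: test_functions_def)

lemma weak_grad_L2: "is_weak_grad \<Omega> u G \<Longrightarrow> G \<in> L2 M"
  by (simp add: is_weak_grad_def)

lemma weak_grad_unique:
  assumes G: "is_weak_grad \<Omega> u G" and G': "is_weak_grad \<Omega> u G'"
  shows "AE x in M. G x = G' x"
proof -
  have "AE x in M. inner (G x - G' x) b = 0" if b: "b \<in> Basis" for b
  proof (rule integral_test_zero_imp_AE_zero[OF open_dom])
    have L: "(\<lambda>x. inner (G x) b) \<in> L2 M" "(\<lambda>x. inner (G' x) b) \<in> L2 M"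
      using weak_grad_L2[OF G] weak_grad_L2[OF G'] L2_inner_const by auto
    show "integrable M (\<lambda>x. inner (G x - G' x) b)"
      using L2_prod_integrable[OF L2_diff[OF L] one_L2] by (simp add: inner_diff_left)
    fix \<phi> assume \<phi>: "\<phi> \<in> test_functions \<Omega>"
    have "(LINT x|M. inner (G x) b * \<phi> x) = (LINT x|M. inner (G' x) b * \<phi> x)"
      using G G' \<phi> b by (auto simp: is_weak_grad_def)
    then show "(LINT x|M. inner (G x - G' x) b * \<phi> x) = 0"
      using L2_prod_integrable[OF L(1) test_L2[OF \<phi>]] L2_prod_integrable[OF L(2) test_L2[OF \<phi>]]
      by (simp add: inner_diff_left left_diff_distrib)
  qed
  then have "AE x in M. \<forall>b\<in>Basis. inner (G x - G' x) b = 0"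
    by (subst AE_ball_countable) (auto intro: countable_finite)
  then show ?thesis by eventually_elim (auto simp: inner_diff_left intro: euclidean_eqI)
qed

lemma weak_grad_add:
  assumes u: "u \<in> L2 M" "v \<in> L2 M" and G: "is_weak_grad \<Omega> u G" "is_weak_grad \<Omega> v G'"
  shows "is_weak_grad \<Omega> (fadd u v) (\<lambda>x. G x + G' x)"
  unfolding is_weak_grad_def
proof (intro conjI ballI)
  show "(\<lambda>x. G x + G' x) \<in> L2 M" using G by (intro L2_add weak_grad_L2)
  fix \<phi> b assume \<phi>: "\<phi> \<in> test_functions \<Omega>" and b: "(b::'a) \<in> Basis"
  have "(LINT x|M. u x * frechet_derivative \<phi> (at x) b) = - (LINT x|M. inner (G x) b * \<phi> x)"
    "(LINT x|M. v x * frechet_derivative \<phi> (at x) b) = - (LINT x|M. inner (G' x) b * \<phi> x)"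
    using G \<phi> b by (auto simp: is_weak_grad_def)
  moreover have "integrable M (\<lambda>x. inner (G x) b * \<phi> x)" "integrable M (\<lambda>x. inner (G' x) b * \<phi> x)"
    "integrable M (\<lambda>x. u x * frechet_derivative \<phi> (at x) b)" "integrable M (\<lambda>x. v x * frechet_derivative \<phi> (at x) b)"
    using L2_prod_integrable[OF L2_inner_const[OF weak_grad_L2[OF G(1)]] test_L2[OF \<phi>]]
      L2_prod_integrable[OF L2_inner_const[OF weak_grad_L2[OF G(2)]] test_L2[OF \<phi>]]
      L2_prod_integrable[OF u(1) test_frechet_L2[OF \<phi> b]] L2_prod_integrable[OF u(2) test_frechet_L2[OF \<phi> b]]
    by auto
  ultimately show "(LINT x|M. (u x + v x) * frechet_derivative \<phi> (at x) b)
          = - (LINT x|M. inner (G x + G' x) b * \<phi> x)"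
    by (simp add: inner_add_left distrib_right)
qed

lemma weak_grad_scl:
  assumes G: "is_weak_grad \<Omega> u G"
  shows "is_weak_grad \<Omega> (fscl c u) (\<lambda>x. c *\<^sub>R G x)"
  using G by (auto simp: is_weak_grad_def L2_scl mult.assoc)

lemma H1_L2: "u \<in> H1 \<Omega> \<Longrightarrow> u \<in> L2 M"
  by (simp add: H1_def)

lemma wgrad: 
  assumes "u \<in> H1 \<Omega>"
  shows "is_weak_grad \<Omega> u (wgrad \<Omega> u)"
proof -
  have "\<exists>G. is_weak_grad \<Omega> u G" using assms by (simp add: H1_def)
  then show ?thesis unfolding wgrad_def by (rule someI_ex)
qed

lemma wgrad_L2: "u \<in> H1 \<Omega> \<Longrightarrow> wgrad \<Omega> u \<in> L2 M"
  by (rule weak_grad_L2[OF wgrad])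

lemma H1_add: "u \<in> H1 \<Omega> \<Longrightarrow> v \<in> H1 \<Omega> \<Longrightarrow> fadd u v \<in> H1 \<Omega>"
  using weak_grad_add[of u v "wgrad \<Omega> u" "wgrad \<Omega> v"] wgrad[of u] wgrad[of v] L2_add[of u M v]
  by (auto simp: H1_def)

lemma H1_scl: "u \<in> H1 \<Omega> \<Longrightarrow> fscl c u \<in> H1 \<Omega>"
  using weak_grad_scl[of u "wgrad \<Omega> u"] wgrad[of u] L2_scl_real[of u M c]
  by (auto simp: H1_def)

lemma H1_diff: "u \<in> H1 \<Omega> \<Longrightarrow> v \<in> H1 \<Omega> \<Longrightarrow> (\<lambda>x. u x - v x) \<in> H1 \<Omega>"
  using H1_add[of u "fscl (-1) v"] H1_scl[of v "-1"] by simp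

lemma weak_grad_diff:
  assumes "u \<in> L2 M" "v \<in> L2 M" "is_weak_grad \<Omega> u G" "is_weak_grad \<Omega> v G'"
  shows "is_weak_grad \<Omega> (\<lambda>x. u x - v x) (\<lambda>x. G x - G' x)"
  using weak_grad_add[OF assms(1) L2_scl_real[OF assms(2)] assms(3) weak_grad_scl[OF assms(4)], of "-1"] by simp

text \<open>\<open>wgrad\<close> is a choice and need not commute with sums or multiples. Being free
  to use any weak gradient under the integral is what makes the form bilinear.\<close>

lemma energy_eq:
  assumes a: "weight \<Omega> a" and "is_weak_grad \<Omega> u G" "is_weak_grad \<Omega> v G'" 
    and uv: "u \<in> H1 \<Omega>" "v \<in> H1 \<Omega>"
  shows "energy \<Omega> a u v = (LINT x|M. a x * inner (G x) (G' x))"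
  unfolding energy_def
proof (rule integral_cong_AE)
  show "AE x in M. a x * inner (wgrad \<Omega> u x) (wgrad \<Omega> v x) = a x * inner (G x) (G' x)"
    using weak_grad_unique[OF wgrad[OF uv(1)] assms(2)] weak_grad_unique[OF wgrad[OF uv(2)] assms(3)]
    by eventually_elim simp
  have [measurable]: "a \<in> borel_measurable M" "G \<in> borel_measurable M" "G' \<in> borel_measurable M"
      "wgrad \<Omega> u \<in> borel_measurable M" "wgrad \<Omega> v \<in> borel_measurable M"
    using a L2_measurable[OF weak_grad_L2[OF assms(2)]] L2_measurable[OF weak_grad_L2[OF assms(3)]]
      L2_measurable[OF wgrad_L2[OF uv(1)]] L2_measurable[OF wgrad_L2[OF uv(2)]] by (auto simp: weight_def)
  show "(\<lambda>x. a x * inner (wgrad \<Omega> u x) (wgrad \<Omega> v x)) \<in> borel_measurable M"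
    "(\<lambda>x. a x * inner (G x) (G' x)) \<in> borel_measurable M" by measurable
qed

lemma energy_integrable:
  assumes "weight \<Omega> a" "G \<in> L2 M" "G' \<in> L2 M"
  shows "integrable M (\<lambda>x. a x * inner (G x) (G' x))"
  using assms L2_weighted_integrable[of G M G' a] by (auto simp: weight_def)

lemma form_semi_ip:
  assumes a: "weight \<Omega> a" and c: "0 \<le> c"
  shows "semi_ip (H1 \<Omega>) fadd fscl (form \<Omega> c a)"
proof (standard, goal_cases)
  case (3 u v)
  then show ?case by (simp add: form_def energy_def mult.commute inner_commute)
next
  case (4 u v w)
  have "energy \<Omega> a (fadd u v) w = energy \<Omega> a u w + energy \<Omega> a v w"
    using energy_eq[OF a weak_grad_add[OF H1_L2 H1_L2 wgrad wgrad] wgrad, of u v w] 4 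
      energy_integrable[OF a wgrad_L2 wgrad_L2, of u w] energy_integrable[OF a wgrad_L2 wgrad_L2, of v w]
    by (simp add: H1_add energy_def inner_add_left distrib_left)
  moreover have "(LINT x|M. fadd u v x * w x) = (LINT x|M. u x * w x) + (LINT x|M. v x * w x)"
    using 4 by (simp add: distrib_right L2_prod_integrable H1_L2)
  ultimately show ?case by (simp add: form_def distrib_left)
next
  case (5 r u w)
  have "energy \<Omega> a (fscl r u) w = r * energy \<Omega> a u w"
    using energy_eq[OF a weak_grad_scl[OF wgrad] wgrad, of u w r] 5
    by (simp add: H1_scl energy_def mult.left_commute)
  moreover have "(LINT x|M. fscl r u x * w x) = r * (LINT x|M. u x * w x)"
    by (simp add: mult.assoc)
  ultimately show ?case by (simp add: form_def distrib_left)
next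
  case (6 u)
  have "0 \<le> energy \<Omega> a u u"
    unfolding energy_def using a by (intro integral_nonneg_AE) (auto simp: weight_def elim!: eventually_mono)
  moreover have "0 \<le> (LINT x|M. u x * u x)" by (intro integral_nonneg_AE) auto
  ultimately show ?case using c by (simp add: form_def)
qed (auto intro: H1_add H1_scl)

abbreviation "H1_form \<equiv> form \<Omega> 1 (\<lambda>_. 1)"

lemma H1_semi_ip: "semi_ip (H1 \<Omega>) fadd fscl H1_form"
  by (rule form_semi_ip[OF weight_one]) simp

lemma H1_form_diff:
  assumes u: "u \<in> H1 \<Omega>" "v \<in> H1 \<Omega>"
  shows "H1_form (\<lambda>x. u x - v x) (\<lambda>x. u x - v x) =
    (LINT x|M. (norm (u x - v x))\<^sup>2) + (LINT x|M. (norm (wgrad \<Omega> u x - wgrad \<Omega> v x))\<^sup>2)"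
proof -
  have g: "is_weak_grad \<Omega> (\<lambda>x. u x - v x) (\<lambda>x. wgrad \<Omega> u x - wgrad \<Omega> v x)"
    using u by (intro weak_grad_diff wgrad H1_L2)
  show ?thesis
    using energy_eq[OF weight_one g g H1_diff[OF u] H1_diff[OF u]]
    by (simp add: form_def power2_norm_eq_inner flip: power2_eq_square)
qed

text \<open>Functions and weak gradients converge separately in L^2, and the identity that defines
  the weak gradient survives both limits.\<close>

lemma H1_complete:
  assumes w: "\<And>n. w n \<in> H1 \<Omega>"
    and Cauchy: "\<And>\<epsilon>. \<epsilon> > 0 \<Longrightarrow> \<exists>k. \<forall>m\<ge>k. \<forall>n\<ge>k. H1_form (\<lambda>x. w m x - w n x) (\<lambda>x. w m x - w n x) < \<epsilon>"
  obtains z where "z \<in> H1 \<Omega>" "(\<lambda>n. H1_form (\<lambda>x. w n x - z x) (\<lambda>x. w n x - z x)) \<longlonglongrightarrow> 0"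
proof -
  let ?g = "\<lambda>n. wgrad \<Omega> (w n)"
  have nn: "0 \<le> (LINT x|M. (norm (h x))\<^sup>2)" for h :: "'a \<Rightarrow> 'c::real_normed_vector"
    by (intro integral_nonneg_AE) auto
  have "\<exists>k. \<forall>m\<ge>k. \<forall>n\<ge>k. (LINT x|M. (norm (w m x - w n x))\<^sup>2) < \<epsilon> \<and> (LINT x|M. (norm (?g m x - ?g n x))\<^sup>2) < \<epsilon>" if eps: "\<epsilon> > 0" for \<epsilon>
  proof -
    obtain k where k: "\<And>m n. m \<ge> k \<Longrightarrow> n \<ge> k \<Longrightarrow> H1_form (\<lambda>x. w m x - w n x) (\<lambda>x. w m x - w n x) < \<epsilon>"
      using Cauchy[OF eps] by blast
    have "(LINT x|M. (norm (w m x - w n x))\<^sup>2) < \<epsilon> \<and> (LINT x|M. (norm (?g m x - ?g n x))\<^sup>2) < \<epsilon>"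
      if "m \<ge> k" "n \<ge> k" for m n
      using k[OF that] nn[of "\<lambda>x. w m x - w n x"] nn[of "\<lambda>x. ?g m x - ?g n x"]
      unfolding H1_form_diff[OF w w] by linarith
    then show ?thesis by blast
  qed
  then have C: "\<exists>k. \<forall>m\<ge>k. \<forall>n\<ge>k. (LINT x|M. (norm (w m x - w n x))\<^sup>2) < \<epsilon>"
    "\<exists>k. \<forall>m\<ge>k. \<forall>n\<ge>k. (LINT x|M. (norm (?g m x - ?g n x))\<^sup>2) < \<epsilon>" if "\<epsilon> > 0" for \<epsilon>
    using that by blast+
  have "\<exists>z\<in>L2 M. (\<lambda>n. LINT x|M. (norm (w n x - z x))\<^sup>2) \<longlonglongrightarrow> 0"
    by (rule L2_complete[OF finite_M, of w]) (erule C(1) | rule H1_L2 w | blast)+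
  then obtain z where z: "z \<in> L2 M" "(\<lambda>n. LINT x|M. (norm (w n x - z x))\<^sup>2) \<longlonglongrightarrow> 0" by blast
  have "\<exists>G\<in>L2 M. (\<lambda>n. LINT x|M. (norm (?g n x - G x))\<^sup>2) \<longlonglongrightarrow> 0"
    by (rule L2_complete[OF finite_M, of ?g]) (erule C(2) | rule wgrad_L2 w | blast)+
  then obtain G where G: "G \<in> L2 M" "(\<lambda>n. LINT x|M. (norm (?g n x - G x))\<^sup>2) \<longlonglongrightarrow> 0" by blast
  have zG: "is_weak_grad \<Omega> z G"
    unfolding is_weak_grad_def
  proof (intro conjI ballI)
    fix \<phi> b assume \<phi>: "\<phi> \<in> test_functions \<Omega>" and b: "(b::'a) \<in> Basis"
    have l1: "(\<lambda>n. LINT x|M. w n x * frechet_derivative \<phi> (at x) b) \<longlonglongrightarrow> (LINT x|M. z x * frechet_derivative \<phi> (at x) b)"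
      using L2_tendsto_inner[OF H1_L2[OF w] z(1) test_frechet_L2[OF \<phi> b] z(2)] by simp
    have \<phi>b: "(\<lambda>x. \<phi> x *\<^sub>R b) \<in> L2 M"
      using \<phi> test_functions_def open_dom bounded_dom smooth_continuous
      by (intro continuous_L2 continuous_intros) auto
    have l2: "(\<lambda>n. LINT x|M. inner (?g n x) b * \<phi> x) \<longlonglongrightarrow> (LINT x|M. inner (G x) b * \<phi> x)"
      using L2_tendsto_inner[OF wgrad_L2[OF w] G(1) \<phi>b G(2)] by (simp add: mult.commute)
    have "(LINT x|M. w n x * frechet_derivative \<phi> (at x) b) = - (LINT x|M. inner (?g n x) b * \<phi> x)" for n
      using wgrad[OF w] \<phi> b by (auto simp: is_weak_grad_def)
    then show "(LINT x|M. z x * frechet_derivative \<phi> (at x) b) = - (LINT x|M. inner (G x) b * \<phi> x)"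
      using LIMSEQ_unique[OF l1] tendsto_minus[OF l2] by simp
  qed (rule G)
  then have zH: "z \<in> H1 \<Omega>" unfolding H1_def using z(1) by blast
  have "H1_form (\<lambda>x. w n x - z x) (\<lambda>x. w n x - z x) = (LINT x|M. (norm (w n x - z x))\<^sup>2) + (LINT x|M. (norm (?g n x - G x))\<^sup>2)" for n
  proof -
    have g: "is_weak_grad \<Omega> (\<lambda>x. w n x - z x) (\<lambda>x. ?g n x - G x)"
      by (rule weak_grad_diff[OF H1_L2[OF w] z(1) wgrad[OF w] zG])
    show ?thesis
      using energy_eq[OF weight_one g g H1_diff[OF w zH] H1_diff[OF w zH]]
      by (simp add: form_def power2_norm_eq_inner flip: power2_eq_square)
  qed
  then have "(\<lambda>n. H1_form (\<lambda>x. w n x - z x) (\<lambda>x. w n x - z x)) \<longlonglongrightarrow> 0"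
    using tendsto_add[OF z(2) G(2)] by simp
  then show ?thesis using that zH by blast
qed

lemma smooth_H1: "smooth \<phi> \<Longrightarrow> \<phi> \<in> H1 \<Omega>"
  unfolding H1_def
  using continuous_L2[OF smooth_continuous open_dom bounded_dom, of \<phi>] smooth_weak_grad[OF open_dom bounded_dom, of \<phi>]
  by blast

end

section \<open>Friedrichs' inequality\<close>

text \<open>A cover of \<open>A\<close> by small sets gives a cover of \<open>S\<close> by boxes
  that reach back from each set by \<open>R\<close> in direction \<open>b\<close>. Their volume is
  at most a constant times the diameter to the power \<open>DIM('a) - 1\<close>, the quantity that
  the Hausdorff measure sums.\<close>

lemma hausdorff_projection:
  fixes A S :: "'a::euclidean_space set" and b :: 'a
  assumes dim: "DIM('a) \<ge> 2" and b: "b \<in> Basis" and R: "R > 0" and S: "S \<in> sets borel"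
    and SA: "\<And>x. x \<in> S \<Longrightarrow> \<exists>t. 0 \<le> t \<and> t \<le> R \<and> x + t *\<^sub>R b \<in> A"
  shows "emeasure lborel S \<le> ennreal (4 ^ (DIM('a) - 1) * (R + 2) / unit_ball_vol (real (DIM('a) - 1)))
           * hausdorff (DIM('a) - 1) A"
proof -
  define n where "n = DIM('a) - 1"
  have n: "n \<ge> 1" "DIM('a) = Suc n" using dim by (auto simp: n_def)
  let ?v = "unit_ball_vol (real n)"
  \<comment> \<open>For diameter \<open>d \<le> 1\<close> a box has cross-section
    \<open>(2 * d) ^ n = 4 ^ n * (d / 2) ^ n\<close> and length
    \<open>2 * d + R \<le> R + 2\<close>; dividing by the ball volume undoes the
    normalisation.\<close>
  define K where "K = 4 ^ n * (R + 2) / ?v"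
  have v: "?v > 0" by simp
  then have v0: "?v \<noteq> 0" by linarith
  have K: "K > 0" using R v by (simp add: K_def)
  have cover: "emeasure lborel S \<le> ennreal K * (\<Sum>i. ennreal (?v * (diameter (C i) / 2) ^ n))"
    if C: "A \<subseteq> (\<Union>i. C i)" "\<And>i. bounded (C i)" "\<And>i. diameter (C i) \<le> 1" for C :: "nat \<Rightarrow> 'a set"
  proof -
    \<comment> \<open>Built around an arbitrary point of \<open>C i\<close>; an empty set has no
      such point and gets the empty box.\<close>
    define B where "B i = (if C i = {} then {} else 
       cbox ((SOME c. c \<in> C i) - diameter (C i) *\<^sub>R One - R *\<^sub>R b) ((SOME c. c \<in> C i) + diameter (C i) *\<^sub>R One))" for i
    have "S \<subseteq> (\<Union>i. B i)"
    proof
      fix x assume "x \<in> S"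
      then obtain t where t: "0 \<le> t" "t \<le> R" "x + t *\<^sub>R b \<in> A" using SA by blast
      then obtain i where i: "x + t *\<^sub>R b \<in> C i" using C(1) by blast
      let ?c = "SOME c. c \<in> C i"
      have c: "?c \<in> C i" using i by (rule someI)
      have "x \<in> cbox (?c - diameter (C i) *\<^sub>R One - R *\<^sub>R b) (?c + diameter (C i) *\<^sub>R One)"
        unfolding mem_box
      proof
        fix b' :: 'a assume b': "b' \<in> Basis"
        have "norm (x + t *\<^sub>R b - ?c) \<le> diameter (C i)"
          using diameter_bounded_bound[OF C(2) i c] by (simp add: dist_norm)
        then have "\<bar>inner (x + t *\<^sub>R b - ?c) b'\<bar> \<le> diameter (C i)"
          using Basis_le_norm[OF b', of "x + t *\<^sub>R b - ?c"] by linarith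
        then show "inner (?c - diameter (C i) *\<^sub>R One - R *\<^sub>R b) b' \<le> inner x b' \<and> inner x b' \<le> inner (?c + diameter (C i) *\<^sub>R One) b'"
          using t R b b' by (cases "b = b'") (auto simp: inner_diff_left inner_add_left inner_Basis)
      qed
      then show "x \<in> (\<Union>i. B i)" using i by (auto simp: B_def)
    qed
    moreover have "emeasure lborel (B i) \<le> ennreal K * ennreal (?v * (diameter (C i) / 2) ^ n)" for i
    proof (cases "C i = {}")
      case False
      let ?d = "diameter (C i)" and ?c = "SOME c. c \<in> C i"
      have d: "0 \<le> ?d" "?d \<le> 1" using C diameter_ge_0 by auto
      have inn: "inner (?c + ?d *\<^sub>R One - (?c - ?d *\<^sub>R One - R *\<^sub>R b)) b' = 2 * ?d + (if b' = b then R else 0)" if "b' \<in> Basis" for b'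
        using that b by (auto simp: inner_diff_left inner_add_left inner_Basis)
      have "emeasure lborel (B i) = ennreal (\<Prod>b'\<in>Basis. 2 * ?d + (if b' = b then R else 0))"
        using False d R b unfolding B_def
      proof -
        have le: "inner (?c - ?d *\<^sub>R One - R *\<^sub>R b) b' \<le> inner (?c + ?d *\<^sub>R One) b'" if "b' \<in> Basis" for b'
          using inn[OF that] d R unfolding inner_diff_left[of "?c + ?d *\<^sub>R One"] by (simp split: if_splits)
        have "emeasure lborel (cbox (?c - ?d *\<^sub>R One - R *\<^sub>R b) (?c + ?d *\<^sub>R One)) =
            ennreal (\<Prod>b'\<in>Basis. inner (?c + ?d *\<^sub>R One - (?c - ?d *\<^sub>R One - R *\<^sub>R b)) b')"
          by (rule emeasure_lborel_cbox) (rule le)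
        also have "(\<Prod>b'\<in>Basis. inner (?c + ?d *\<^sub>R One - (?c - ?d *\<^sub>R One - R *\<^sub>R b)) b') =
            (\<Prod>b'\<in>Basis. 2 * ?d + (if b' = b then R else 0))"
          by (rule prod.cong[OF refl inn])
        finally show "emeasure lborel (if C i = {} then {} else cbox (?c - ?d *\<^sub>R One - R *\<^sub>R b) (?c + ?d *\<^sub>R One)) =
            ennreal (\<Prod>b'\<in>Basis. 2 * ?d + (if b' = b then R else 0))" using False by simp
      qed
      also have "(\<Prod>b'\<in>Basis. 2 * ?d + (if b' = b then R else 0)) = (2 * ?d + R) * (\<Prod>b'\<in>Basis - {b}. 2 * ?d)"
        using b by (subst prod.remove[of _ b]) (auto intro!: prod.cong)
      also have "\<dots> = (2 * ?d + R) * (2 * ?d) ^ n" using b n by simp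
      also have "\<dots> \<le> (R + 2) * (2 * ?d) ^ n" using d R by (intro mult_right_mono) auto
      also have "(R + 2) * (2 * ?d) ^ n = K * (?v * (?d / 2) ^ n)"
      proof -
        have "2 * ?d = 4 * (?d / 2)" by simp
        then have "(2 * ?d) ^ n = 4 ^ n * (?d / 2) ^ n" by (metis power_mult_distrib)
        then show ?thesis using v0 by (simp add: K_def)
      qed
      finally show ?thesis using K v d by (simp add: ennreal_leI flip: ennreal_mult)
    qed (simp add: B_def)
    moreover have "range B \<subseteq> sets lborel" by (auto simp: B_def)
    ultimately have "emeasure lborel S \<le> (\<Sum>i. ennreal K * ennreal (?v * (diameter (C i) / 2) ^ n))"
      using S by (intro order_trans[OF emeasure_mono order_trans[OF emeasure_subadditive_countably suminf_le]]) auto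
    then show ?thesis by simp
  qed
  \<comment> \<open>With the constant on the left, covers can be treated one at a time under the
    infimum. Covers of mesh 1 suffice, since the Hausdorff measure is a supremum over all
    meshes.\<close>
  have "ennreal (1 / K) * emeasure lborel S \<le> hausdorff_delta n 1 A"
    unfolding hausdorff_delta_def
  proof (rule INF_greatest)
    fix C assume "C \<in> {C :: nat \<Rightarrow> 'a set. A \<subseteq> (\<Union>i. C i) \<and> (\<forall>i. bounded (C i) \<and> diameter (C i) \<le> 1)}"
    then have "emeasure lborel S \<le> ennreal K * (\<Sum>i. ennreal (?v * (diameter (C i) / 2) ^ n))"
      by (intro cover) auto
    then have "ennreal (1 / K) * emeasure lborel S \<le> ennreal (1 / K) * (ennreal K * (\<Sum>i. ennreal (?v * (diameter (C i) / 2) ^ n)))"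
      by (intro mult_left_mono) auto
    also have "\<dots> = (\<Sum>i. ennreal (?v * (diameter (C i) / 2) ^ n))"
      using K by (simp add: mult.assoc[symmetric] flip: ennreal_mult)
    finally show "ennreal (1 / K) * emeasure lborel S \<le> (\<Sum>i. ennreal (?v * (diameter (C i) / 2) ^ n))" .
  qed
  also have "\<dots> \<le> hausdorff n A" unfolding hausdorff_def by (intro SUP_upper) auto
  finally have "ennreal K * (ennreal (1 / K) * emeasure lborel S) \<le> ennreal K * hausdorff n A"
    by (intro mult_left_mono) auto
  moreover have "ennreal K * (ennreal (1 / K) * emeasure lborel S) = emeasure lborel S"
    using K by (simp add: mult.assoc[symmetric] flip: ennreal_mult)
  ultimately show ?thesis by (simp add: K_def n_def)
qed

section \<open>First exit from the domain along a direction\<close>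

context bounded_open
begin

definition exit :: "'a \<Rightarrow> 'a \<Rightarrow> real" where
  "exit b x = Inf {t. 0 \<le> t \<and> x + t *\<^sub>R b \<notin> \<Omega>}"

definition hit :: "'a \<Rightarrow> 'a \<Rightarrow> 'a" where
  "hit b x = x + exit b x *\<^sub>R b"

text \<open>The set of times outside is closed because the domain is open, so its infimum is
  attained. This puts the hit point outside the domain, and the earlier points of the ray put it in
  the closure.\<close>

lemma exit_props:
  assumes R: "\<And>y. y \<in> \<Omega> \<Longrightarrow> 2 * norm y < R" and b: "norm b = 1" and x: "x \<in> \<Omega>"
  shows "0 < exit b x" "exit b x \<le> R" "hit b x \<in> frontier \<Omega>"
    "\<And>s. 0 \<le> s \<Longrightarrow> s < exit b x \<Longrightarrow> x + s *\<^sub>R b \<in> \<Omega>"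
    "x + exit b x *\<^sub>R b \<notin> \<Omega>"
proof -
  let ?T = "{t. 0 \<le> t \<and> x + t *\<^sub>R b \<notin> \<Omega>}"
  have "closed ((\<lambda>t. x + t *\<^sub>R b) -` (- \<Omega>))"
    using open_dom by (intro continuous_closed_vimage) (auto intro!: continuous_intros)
  then have "closed ({0..} \<inter> (\<lambda>t. x + t *\<^sub>R b) -` (- \<Omega>))" by (intro closed_Int) auto
  moreover have "{0..} \<inter> (\<lambda>t. x + t *\<^sub>R b) -` (- \<Omega>) = ?T" by auto
  ultimately have cl: "closed ?T" by simp
  \<comment> \<open>After length \<open>R\<close> the norm is at least \<open>R / 2\<close>, which
    no point of the domain reaches; hence \<open>R\<close> is an exit time for every starting
    point.\<close>
  have "norm (R *\<^sub>R b) \<le> norm (x + R *\<^sub>R b) + norm x" using norm_triangle_ineq4[of "x + R *\<^sub>R b" x] by simp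
  moreover have Rp: "R > 0" using R[OF x] norm_ge_zero[of x] by linarith
  ultimately have "2 * norm (x + R *\<^sub>R b) \<ge> R" using R[OF x] b by simp
  then have RT: "R \<in> ?T" using R[of "x + R *\<^sub>R b"] Rp by force
  have bdd: "bdd_below ?T" by (rule bdd_belowI[of _ 0]) auto
  have "exit b x \<in> ?T" unfolding exit_def using closed_contains_Inf[OF _ bdd cl] RT by blast
  then show out: "x + exit b x *\<^sub>R b \<notin> \<Omega>" and pos: "0 < exit b x"
    using x by (auto simp: order_le_less)
  show "exit b x \<le> R" unfolding exit_def by (rule cInf_lower[OF RT bdd])
  show inside: "x + s *\<^sub>R b \<in> \<Omega>" if "0 \<le> s" "s < exit b x" for s
    using cInf_lower[OF _ bdd, of s] that unfolding exit_def by force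
  have "hit b x \<in> closure \<Omega>"
    unfolding closure_approachable
  proof (intro allI impI)
    fix e :: real assume e: "e > 0"
    let ?s = "max 0 (exit b x - e / 2)"
    have "x + ?s *\<^sub>R b \<in> \<Omega>" using pos e by (intro inside) auto
    moreover have "dist (x + ?s *\<^sub>R b) (hit b x) = \<bar>?s - exit b x\<bar>"
      using b by (simp add: hit_def dist_norm flip: scaleR_diff_left)
    moreover have "\<bar>?s - exit b x\<bar> < e" using pos e by auto
    ultimately show "\<exists>y\<in>\<Omega>. dist y (hit b x) < e" by (intro bexI[of _ "x + ?s *\<^sub>R b"]) auto
  qed
  then show "hit b x \<in> frontier \<Omega>" using out open_dom by (simp add: frontier_def hit_def interior_open)
qed

text \<open>Exit later than \<open>a \<ge> 0\<close> means that the closed segment of length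
  \<open>a\<close> stays inside. The points where this fails form the Minkowski sum of a compact
  segment and the closed complement, which is closed.\<close>

lemma exit_measurable:
  assumes R: "\<And>y. y \<in> \<Omega> \<Longrightarrow> 2 * norm y < R" and b: "norm b = 1"
  shows "exit b \<in> borel_measurable (restrict_space borel \<Omega>)"
proof (subst borel_measurable_iff_greater, intro allI)
  fix a :: real
  have "open {x \<in> \<Omega>. a < exit b x}"
  proof (cases "a < 0")
    case True
    then have "{x \<in> \<Omega>. a < exit b x} = \<Omega>" using exit_props(1)[OF R b] by force
    then show ?thesis using open_dom by simp
  next
    case False
    let ?X = "\<Union>x\<in>(\<lambda>r. - (r *\<^sub>R b)) ` {0..a}. \<Union>y\<in>- \<Omega>. {x + y}"
    have "closed ?X"
      using open_dom by (intro compact_closed_sums compact_continuous_image) (auto intro!: continuous_intros)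
    moreover have "{x \<in> \<Omega>. a < exit b x} = \<Omega> - ?X"
    proof (intro Set.set_eqI iffI)
      fix x assume x: "x \<in> {x \<in> \<Omega>. a < exit b x}"
      have "x \<notin> ?X"
      proof
        assume "x \<in> ?X"
        then obtain r y where r: "0 \<le> r" "r \<le> a" "y \<notin> \<Omega>" "x = - (r *\<^sub>R b) + y" by auto
        then have "x + r *\<^sub>R b \<in> \<Omega>" using exit_props(4)[OF R b, of x r] x by auto
        then show False using r by simp
      qed
      then show "x \<in> \<Omega> - ?X" using x by simp
    next
      fix x assume x: "x \<in> \<Omega> - ?X"
      have "a < exit b x"
      proof (rule ccontr)
        assume "\<not> a < exit b x"
        then have "exit b x \<in> {0..a}" "x + exit b x *\<^sub>R b \<in> - \<Omega>" using exit_props[OF R b, of x] x by auto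
        then have "- (exit b x *\<^sub>R b) + (x + exit b x *\<^sub>R b) \<in> ?X" by blast
        then show False using x by simp
      qed
      then show "x \<in> {x \<in> \<Omega>. a < exit b x}" using x by simp
    qed
    ultimately show ?thesis using open_dom by (simp add: open_Diff)
  qed
  then show "{w \<in> space (restrict_space borel \<Omega>). a < exit b w} \<in> sets (restrict_space borel \<Omega>)"
    using open_dom by (auto simp: space_restrict_space sets_restrict_space_iff)
qed

abbreviation "\<Sigma> \<equiv> surface_measure \<Omega>"

lemma space_\<Sigma>: "space \<Sigma> = frontier \<Omega>" and sets_\<Sigma>: "sets \<Sigma> = sets (restrict_space borel (frontier \<Omega>))"
proof -
  have sa: "sigma_algebra (frontier \<Omega>) (sets (restrict_space borel (frontier \<Omega>)))"
    using sets.sigma_algebra_axioms[of "restrict_space borel (frontier \<Omega>)"] by (simp add: space_restrict_space)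
  show "space \<Sigma> = frontier \<Omega>" by (simp add: surface_measure_def space_measure_of_conv)
  show "sets \<Sigma> = sets (restrict_space borel (frontier \<Omega>))"
    unfolding surface_measure_def using sa by (rule sigma_algebra.sets_measure_of_eq)
qed

lemma hit_measurable:
  assumes R: "\<And>y. y \<in> \<Omega> \<Longrightarrow> 2 * norm y < R" and b: "norm b = 1"
  shows "hit b \<in> measurable (restrict_space borel \<Omega>) \<Sigma>"
proof -
  have [measurable]: "exit b \<in> borel_measurable (restrict_space borel \<Omega>)" by (rule exit_measurable[OF R b])
  have "(\<lambda>x. x) \<in> borel_measurable (restrict_space borel \<Omega>)" by (rule measurable_restrict_space1) simp
  then have "hit b \<in> borel_measurable (restrict_space borel \<Omega>)"
    unfolding hit_def[abs_def] by (intro borel_measurable_add borel_measurable_scaleR) auto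
  then have "hit b \<in> measurable (restrict_space borel \<Omega>) (restrict_space borel (frontier \<Omega>))"
    using exit_props(3)[OF R b] by (intro measurable_restrict_space2) (auto simp: space_restrict_space)
  then show ?thesis using sets_\<Sigma> by (simp cong: measurable_cong_sets)
qed

text \<open>The image of volume under \<open>hit b\<close> is dominated by \<open>?K\<close> times
  the surface measure: on sets this is \<open>hausdorff_projection\<close>, on functions it follows
  by measurable induction.\<close>

lemma nn_integral_hit:
  fixes h :: "'a \<Rightarrow> ennreal"
  assumes dim: "DIM('a) \<ge> 2"
    and HM: "\<And>A. A \<in> sets \<Sigma> \<Longrightarrow> emeasure \<Sigma> A = hausdorff (DIM('a) - 1) A"
    and R: "\<And>y. y \<in> \<Omega> \<Longrightarrow> 2 * norm y < R" and R0: "R > 0" and b: "b \<in> Basis"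
    and h: "h \<in> borel_measurable \<Sigma>"
  shows "(\<integral>\<^sup>+x. h (hit b x) \<partial>restrict_space lborel \<Omega>) \<le>
      ennreal (4 ^ (DIM('a) - 1) * (R + 2) / unit_ball_vol (real (DIM('a) - 1))) * (\<integral>\<^sup>+y. h y \<partial>\<Sigma>)"
    (is "?I h \<le> ?K * _")
proof -
  let ?L = "restrict_space lborel \<Omega>"
  have b1: "norm b = 1" using b by simp
  have sL: "sets ?L = sets (restrict_space borel \<Omega>)" by (simp add: sets_restrict_space)
  have hm [measurable]: "hit b \<in> measurable ?L \<Sigma>"
    using hit_measurable[OF R b1] measurable_cong_sets[OF sL refl] by blast
  show ?thesis using h
  proof (induction rule: borel_measurable_induct)
    case (cong f g)
    have "?I f = ?I g"
      by (intro nn_integral_cong cong(3)) (use measurable_space[OF hm] in auto)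
    moreover have "(\<integral>\<^sup>+y. f y \<partial>\<Sigma>) = (\<integral>\<^sup>+y. g y \<partial>\<Sigma>)" by (intro nn_integral_cong cong(3))
    ultimately show ?case using cong(4) by simp
  next
    case (set A)
    have S: "hit b -` A \<inter> space ?L \<in> sets ?L" by (rule measurable_sets[OF hm set])
    then have S': "hit b -` A \<inter> \<Omega> \<in> sets borel" using open_dom
      by (auto simp: space_restrict_space sets_restrict_space_iff)
    have "?I (indicator A) = emeasure ?L (hit b -` A \<inter> space ?L)"
    proof -
      have "?I (indicator A) = (\<integral>\<^sup>+x. indicator (hit b -` A \<inter> space ?L) x \<partial>?L)"
        by (intro nn_integral_cong) (auto split: split_indicator)
      then show ?thesis using S by simp
    qed
    also have "\<dots> = emeasure lborel (hit b -` A \<inter> \<Omega>)"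
      using open_dom by (subst emeasure_restrict_space) (auto simp: space_restrict_space)
    also have "\<dots> \<le> ?K * hausdorff (DIM('a) - 1) A"
    proof (rule hausdorff_projection[OF dim b R0 S'])
      fix x assume "x \<in> hit b -` A \<inter> \<Omega>"
      then show "\<exists>t\<ge>0. t \<le> R \<and> x + t *\<^sub>R b \<in> A"
        using exit_props(1,2)[OF R b1, of x] by (intro exI[of _ "exit b x"]) (auto simp: hit_def)
    qed
    also have "\<dots> = ?K * (\<integral>\<^sup>+y. indicator A y \<partial>\<Sigma>)" using set HM by simp
    finally show ?case .
  next
    case (mult u c)
    have "?I (\<lambda>x. c * u x) = c * ?I u" by (rule nn_integral_cmult[OF measurable_compose[OF hm mult(2)]])
    also have "\<dots> \<le> c * (?K * (\<integral>\<^sup>+y. u y \<partial>\<Sigma>))" using mult(4) by (intro mult_left_mono) auto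
    also have "\<dots> = ?K * (\<integral>\<^sup>+y. c * u y \<partial>\<Sigma>)" using mult(2) by (simp add: nn_integral_cmult mult.left_commute)
    finally show ?case .
  next
    case (add u v)
    have [measurable]: "u \<in> borel_measurable \<Sigma>" "v \<in> borel_measurable \<Sigma>" using add by auto
    have "?I (\<lambda>x. v x + u x) = ?I v + ?I u"
      by (rule nn_integral_add) (auto intro: measurable_compose[OF hm])
    also have "\<dots> \<le> ?K * (\<integral>\<^sup>+y. v y \<partial>\<Sigma>) + ?K * (\<integral>\<^sup>+y. u y \<partial>\<Sigma>)" using add by (intro add_mono) auto
    also have "\<dots> = ?K * (\<integral>\<^sup>+y. v y + u y \<partial>\<Sigma>)" by (simp add: nn_integral_add distrib_left)
    finally show ?case .
  next
    case (seq U)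
    have [measurable]: "\<And>i. U i \<in> borel_measurable \<Sigma>" using seq by auto
    have "?I (SUP i. U i) = (\<integral>\<^sup>+x. (SUP i. U i (hit b x)) \<partial>?L)" by (simp add: image_comp)
    also have "\<dots> = (SUP i. ?I (U i))"
    proof (rule nn_integral_monotone_convergence_SUP)
      have "incseq U" using seq by simp
      then show "incseq (\<lambda>i x. U i (hit b x))" by (simp add: incseq_def le_fun_def)
    qed (auto intro: measurable_compose[OF hm])
    also have "\<dots> \<le> ?K * (\<integral>\<^sup>+y. (SUP i. U i) y \<partial>\<Sigma>)"
    proof (rule SUP_least)
      fix i
      have "?I (U i) \<le> ?K * (\<integral>\<^sup>+y. U i y \<partial>\<Sigma>)" by (rule seq)
      also have "\<dots> \<le> ?K * (\<integral>\<^sup>+y. (SUP i. U i) y \<partial>\<Sigma>)"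
        by (intro mult_left_mono nn_integral_mono) (auto simp: image_comp intro: SUP_upper)
      finally show "?I (U i) \<le> ?K * (\<integral>\<^sup>+y. (SUP i. U i) y \<partial>\<Sigma>)" .
    qed
    finally show ?case .
  qed
qed

text \<open>The weight \<open>1 / (2 * R)\<close> lets half of the squared norm of \<open>\<phi>\<close> be absorbed after integration
  over the domain.\<close>

lemma line_estimate:
  assumes R: "\<And>y. y \<in> \<Omega> \<Longrightarrow> 2 * norm y < R" and R0: "R > 0" and b: "b \<in> Basis"
    and \<phi>: "smooth \<phi>" and x: "x \<in> \<Omega>"
  shows "ennreal ((\<phi> x)\<^sup>2) \<le> ennreal ((\<phi> (hit b x))\<^sup>2) +
    (\<integral>\<^sup>+s. indicator {0..R} s * (indicator \<Omega> (x + s *\<^sub>R b) *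
       ennreal ((\<phi> (x + s *\<^sub>R b))\<^sup>2 / (2 * R) + 2 * R * (frechet_derivative \<phi> (at (x + s *\<^sub>R b)) b)\<^sup>2)) \<partial>lborel)"
proof -
  have b1: "norm b = 1" using b by simp
  let ?t = "exit b x" and ?p = "\<lambda>s. \<phi> (x + s *\<^sub>R b)" and ?d = "\<lambda>s. frechet_derivative \<phi> (at (x + s *\<^sub>R b)) b"
  let ?h = "\<lambda>s. (?p s)\<^sup>2 / (2 * R) + 2 * R * (?d s)\<^sup>2"
  note t = exit_props[OF R b1 x]
  have l: "continuous_on UNIV (\<lambda>s. x + s *\<^sub>R b)" by (intro continuous_intros)
  have cp: "continuous_on UNIV ?p" "continuous_on UNIV ?d"
    using continuous_on_compose2[OF smooth_continuous[OF \<phi>], of UNIV "\<lambda>s. x + s *\<^sub>R b"]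
      continuous_on_compose2[OF smooth_continuous[OF smooth_frechet[OF \<phi> b]], of UNIV "\<lambda>s. x + s *\<^sub>R b"] l
    by simp_all
  have ch: "continuous_on UNIV ?h" using cp R0 by (intro continuous_intros) auto
  have cd: "continuous_on UNIV (\<lambda>s. 2 * ?p s * ?d s)" using cp by (intro continuous_intros)
  have int: "integrable lborel (\<lambda>s. f s * indicator {0..?t} s)" if "continuous_on UNIV f" for f :: "real \<Rightarrow> real"
    using borel_integrable_atLeastAtMost[of 0 ?t f] that continuous_on_eq_continuous_at[of UNIV f]
    by (simp add: indicator_def[abs_def] if_distrib mult.commute cong: if_cong)
  have ftc: "(\<integral>s. (2 * ?p s * ?d s) * indicator {0..?t} s \<partial>lborel) = (?p ?t)\<^sup>2 - (?p 0)\<^sup>2"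
  proof (rule integral_FTC_Icc_real)
    show "((\<lambda>s. (?p s)\<^sup>2) has_real_derivative 2 * ?p s * ?d s) (at s)" for s
      using smooth_line_deriv[OF \<phi>, of x b s] by (auto intro!: derivative_eq_intros)
    show "isCont (\<lambda>s. 2 * ?p s * ?d s) s" for s
      using cd continuous_on_eq_continuous_at by blast
  qed (use t(1) in simp)
  have pw: "- (2 * ?p s * ?d s) \<le> ?h s" for s
  proof -
    have "0 \<le> (?p s + 2 * R * ?d s)\<^sup>2 / (2 * R)" using R0 by simp
    also have "\<dots> = ?h s + 2 * ?p s * ?d s"
      using R0 by (simp add: power2_eq_square field_simps)
    finally show ?thesis by simp
  qed
  have "(\<phi> x)\<^sup>2 = (?p ?t)\<^sup>2 + (\<integral>s. (- (2 * ?p s * ?d s)) * indicator {0..?t} s \<partial>lborel)"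
    using ftc by simp
  also have "\<dots> \<le> (?p ?t)\<^sup>2 + (\<integral>s. ?h s * indicator {0..?t} s \<partial>lborel)"
    using pw by (intro add_left_mono integral_mono int ch continuous_on_minus cd mult_right_mono) auto
  finally have 1: "(\<phi> x)\<^sup>2 \<le> (\<phi> (hit b x))\<^sup>2 + (\<integral>s. ?h s * indicator {0..?t} s \<partial>lborel)"
    by (simp add: hit_def)
  have hn: "0 \<le> ?h s" for s using R0 by simp
  have "ennreal ((\<phi> x)\<^sup>2) \<le> ennreal ((\<phi> (hit b x))\<^sup>2) + ennreal (\<integral>s. ?h s * indicator {0..?t} s \<partial>lborel)"
  proof -
    have "0 \<le> (\<integral>s. ?h s * indicator {0..?t} s \<partial>lborel)"
      using hn by (intro integral_nonneg_AE AE_I2 mult_nonneg_nonneg) auto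
    then show ?thesis using ennreal_leI[OF 1] by simp
  qed
  also have "ennreal (\<integral>s. ?h s * indicator {0..?t} s \<partial>lborel) = (\<integral>\<^sup>+s. ennreal (?h s * indicator {0..?t} s) \<partial>lborel)"
    using hn by (intro nn_integral_eq_integral[symmetric] int ch) auto
  also have "\<dots> \<le> (\<integral>\<^sup>+s. indicator {0..R} s * (indicator \<Omega> (x + s *\<^sub>R b) * ennreal (?h s)) \<partial>lborel)"
  proof (rule nn_integral_mono_AE)
    \<comment> \<open>At the exit time itself the point is outside the domain and the right-hand
      integrand is zero, but a single time is null.\<close>
    have "AE s in lborel. s \<noteq> ?t" by (rule AE_lborel_singleton)
    then show "AE s in lborel. ennreal (?h s * indicator {0..?t} s) \<le> indicator {0..R} s * (indicator \<Omega> (x + s *\<^sub>R b) * ennreal (?h s))"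
    proof eventually_elim
      case (elim s)
      show ?case
      proof (cases "s \<in> {0..?t}")
        case True
        then have "x + s *\<^sub>R b \<in> \<Omega>" using t(4)[of s] elim by auto
        then show ?thesis using True t(2) by simp
      qed simp
    qed
  qed
  finally show ?thesis by (simp add: add_left_mono)
qed

text \<open>Tonelli: for fixed \<open>s\<close> the integral over \<open>x\<close> is a translate of
  the integral over the domain, and \<open>s\<close> ranges over an interval of length
  \<open>R\<close>.\<close>

lemma nn_integral_lines:
  assumes R0: "R > 0" and h [measurable]: "h \<in> borel_measurable borel"
  shows "(\<integral>\<^sup>+x. indicator \<Omega> x * (\<integral>\<^sup>+s. indicator {0..R} s * (indicator \<Omega> (x + s *\<^sub>R b) * h (x + s *\<^sub>R b)) \<partial>lborel) \<partial>lborel)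
    \<le> ennreal R * (\<integral>\<^sup>+x. indicator \<Omega> x * h x \<partial>lborel)"
proof -
  have [measurable]: "\<Omega> \<in> sets borel" using open_dom by simp
  have "(\<integral>\<^sup>+x. indicator \<Omega> x * (\<integral>\<^sup>+s. indicator {0..R} s * (indicator \<Omega> (x + s *\<^sub>R b) * h (x + s *\<^sub>R b)) \<partial>lborel) \<partial>lborel)
     \<le> (\<integral>\<^sup>+x. (\<integral>\<^sup>+s. indicator {0..R} s * (indicator \<Omega> (x + s *\<^sub>R b) * h (x + s *\<^sub>R b)) \<partial>lborel) \<partial>lborel)"
    by (intro nn_integral_mono) (auto simp: indicator_def)
  also have "\<dots> = (\<integral>\<^sup>+s. (\<integral>\<^sup>+x. indicator {0..R} s * (indicator \<Omega> (x + s *\<^sub>R b) * h (x + s *\<^sub>R b)) \<partial>lborel) \<partial>lborel)"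
    by (rule lborel_pair.Fubini'[where f = "\<lambda>s x. indicator {0..R} s * (indicator \<Omega> (x + s *\<^sub>R b) * h (x + s *\<^sub>R b))"]) measurable
  also have "\<dots> = (\<integral>\<^sup>+s. indicator {0..R} s * (\<integral>\<^sup>+x. indicator \<Omega> x * h x \<partial>lborel) \<partial>lborel)"
  proof (intro nn_integral_cong)
    fix s :: real
    have "(\<integral>\<^sup>+x. indicator \<Omega> x * h x \<partial>lborel) = (\<integral>\<^sup>+x. indicator \<Omega> x * h x \<partial>distr lborel borel ((+) (s *\<^sub>R b)))"
      by (simp add: lborel_distr_plus)
    also have "\<dots> = (\<integral>\<^sup>+x. indicator \<Omega> (s *\<^sub>R b + x) * h (s *\<^sub>R b + x) \<partial>lborel)"
      by (rule nn_integral_distr) measurable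
    finally have "(\<integral>\<^sup>+x. indicator \<Omega> (x + s *\<^sub>R b) * h (x + s *\<^sub>R b) \<partial>lborel) = (\<integral>\<^sup>+x. indicator \<Omega> x * h x \<partial>lborel)"
      by (simp add: add.commute)
    moreover have "(\<integral>\<^sup>+x. indicator {0..R} s * (indicator \<Omega> (x + s *\<^sub>R b) * h (x + s *\<^sub>R b)) \<partial>lborel) = 
       indicator {0..R} s * (\<integral>\<^sup>+x. indicator \<Omega> (x + s *\<^sub>R b) * h (x + s *\<^sub>R b) \<partial>lborel)"
      by (rule nn_integral_cmult) measurable
    ultimately show "(\<integral>\<^sup>+x. indicator {0..R} s * (indicator \<Omega> (x + s *\<^sub>R b) * h (x + s *\<^sub>R b)) \<partial>lborel) = 
       indicator {0..R} s * (\<integral>\<^sup>+x. indicator \<Omega> x * h x \<partial>lborel)" by simp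
  qed
  also have "\<dots> = ennreal R * (\<integral>\<^sup>+x. indicator \<Omega> x * h x \<partial>lborel)"
    using R0 by (simp add: nn_integral_multc)
  finally show ?thesis .
qed

lemma nn_integral_M:
  assumes f [measurable]: "f \<in> borel_measurable borel" and "\<And>x. 0 \<le> f x" and "integrable M f"
  shows "(\<integral>\<^sup>+x. indicator \<Omega> x * ennreal (f x) \<partial>lborel) = ennreal (LINT x|M. f x)"
proof -
  have "ennreal (LINT x|M. f x) = (\<integral>\<^sup>+x. ennreal (f x) \<partial>M)"
    using assms by (intro nn_integral_eq_integral[symmetric]) auto
  also have "\<dots> = (\<integral>\<^sup>+x. ennreal (f x) * indicator \<Omega> x \<partial>lebesgue)"
    using open_dom by (intro nn_integral_restrict_space) auto
  finally show ?thesis by (simp add: nn_integral_completion mult.commute)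
qed

text \<open>The integrated line estimate. Its first summand becomes a boundary integral by
  \<open>nn_integral_hit\<close>; its second contributes half of the left-hand side and a gradient
  term.\<close>

lemma smooth_friedrichs:
  assumes dim: "DIM('a) \<ge> 2"
    and HM: "\<And>A. A \<in> sets \<Sigma> \<Longrightarrow> emeasure \<Sigma> A = hausdorff (DIM('a) - 1) A"
    and R: "\<And>y. y \<in> \<Omega> \<Longrightarrow> 2 * norm y < R" and R0: "R > 0" 
    and \<phi>: "smooth \<phi>"
    and K: "K = 4 ^ (DIM('a) - 1) * (R + 2) / unit_ball_vol (real (DIM('a) - 1))"
  shows "ennreal (LINT x|M. (\<phi> x)\<^sup>2) \<le> ennreal (2 * K) * (\<integral>\<^sup>+y. ennreal ((\<phi> y)\<^sup>2) \<partial>\<Sigma>) +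
    ennreal (4 * R\<^sup>2 * (LINT x|M. (norm (cgrad \<phi> x))\<^sup>2))"
proof -
  obtain b :: 'a where b: "b \<in> Basis" using nonempty_Basis by blast
  have b1: "norm b = 1" using b by simp
  let ?L = "restrict_space lborel \<Omega>" and ?D = "\<lambda>x. frechet_derivative \<phi> (at x) b"
  have K0: "K > 0" using R0 unfolding K by (auto intro!: divide_pos_pos)
  define I where "I = (LINT x|M. (\<phi> x)\<^sup>2)"
  define J where "J = (LINT x|M. (?D x)\<^sup>2)"
  define S where "S = (\<integral>\<^sup>+y. ennreal ((\<phi> y)\<^sup>2) \<partial>\<Sigma>)"
  have IJ: "0 \<le> I" "0 \<le> J" by (auto simp: I_def J_def intro!: integral_nonneg_AE)
  have \<phi>m [measurable]: "\<phi> \<in> borel_measurable borel" and Dm [measurable]: "?D \<in> borel_measurable borel"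
    using smooth_continuous[OF \<phi>] smooth_continuous[OF smooth_frechet[OF \<phi> b]] borel_measurable_continuous_onI by auto
  have i1: "integrable M (\<lambda>x. (\<phi> x)\<^sup>2)" "integrable M (\<lambda>x. (?D x)\<^sup>2)"
    using L2_integrable[OF continuous_L2[OF smooth_continuous[OF \<phi>] open_dom bounded_dom]]
      L2_integrable[OF continuous_L2[OF smooth_continuous[OF smooth_frechet[OF \<phi> b]] open_dom bounded_dom]] by auto
  let ?h = "\<lambda>x. (\<phi> x)\<^sup>2 / (2 * R) + 2 * R * (?D x)\<^sup>2"
  define l where "l x = (\<integral>\<^sup>+s. indicator {0..R} s * (indicator \<Omega> (x + s *\<^sub>R b) * ennreal (?h (x + s *\<^sub>R b))) \<partial>lborel)" for x
  have [measurable]: "\<Omega> \<in> sets borel" using open_dom by simp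
  have lm [measurable]: "l \<in> borel_measurable borel" unfolding l_def[abs_def] by measurable
  have hitm: "hit b \<in> measurable ?L \<Sigma>"
    using hit_measurable[OF R b1] measurable_cong_sets[of ?L "restrict_space borel \<Omega>" \<Sigma> \<Sigma>]
    by (auto simp: sets_restrict_space)
  have \<phi>\<Sigma>: "(\<lambda>y. ennreal ((\<phi> y)\<^sup>2)) \<in> borel_measurable \<Sigma>"
  proof -
    have "(\<lambda>y. ennreal ((\<phi> y)\<^sup>2)) \<in> borel_measurable (restrict_space borel (frontier \<Omega>))"
      by (rule measurable_restrict_space1) measurable
    then show ?thesis using sets_\<Sigma> by (simp cong: measurable_cong_sets)
  qed
  have rs: "(\<integral>\<^sup>+x. f x \<partial>?L) = (\<integral>\<^sup>+x. indicator \<Omega> x * f x \<partial>lborel)" for f :: "'a \<Rightarrow> ennreal"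
    by (subst nn_integral_restrict_space) (auto simp: mult.commute)
  have "ennreal I = (\<integral>\<^sup>+x. ennreal ((\<phi> x)\<^sup>2) \<partial>?L)"
    unfolding rs I_def by (rule nn_integral_M[symmetric]) (use i1 in auto)
  also have "\<dots> \<le> (\<integral>\<^sup>+x. ennreal ((\<phi> (hit b x))\<^sup>2) + l x \<partial>?L)"
    unfolding l_def by (intro nn_integral_mono line_estimate[OF R R0 b \<phi>]) (auto simp: space_restrict_space)
  also have "\<dots> = (\<integral>\<^sup>+x. ennreal ((\<phi> (hit b x))\<^sup>2) \<partial>?L) + (\<integral>\<^sup>+x. l x \<partial>?L)"
    by (intro nn_integral_add measurable_compose[OF hitm \<phi>\<Sigma>] measurable_restrict_space1) simp
  also have "\<dots> \<le> ennreal K * S + ennreal (I / 2 + 2 * R\<^sup>2 * J)"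
  proof (rule add_mono)
    show "(\<integral>\<^sup>+x. ennreal ((\<phi> (hit b x))\<^sup>2) \<partial>?L) \<le> ennreal K * S"
      unfolding K S_def by (rule nn_integral_hit[OF dim HM R R0 b \<phi>\<Sigma>])
    have "(\<integral>\<^sup>+x. l x \<partial>?L) \<le> ennreal R * (\<integral>\<^sup>+x. indicator \<Omega> x * ennreal (?h x) \<partial>lborel)"
      unfolding rs l_def by (rule nn_integral_lines[OF R0]) measurable
    also have "(\<integral>\<^sup>+x. indicator \<Omega> x * ennreal (?h x) \<partial>lborel) = ennreal (LINT x|M. ?h x)"
      using R0 i1 by (intro nn_integral_M) auto
    also have "(LINT x|M. ?h x) = I / (2 * R) + 2 * R * J"
      using i1 by (simp add: I_def J_def)
    also have "ennreal R * ennreal (I / (2 * R) + 2 * R * J) = ennreal (I / 2 + 2 * R\<^sup>2 * J)"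
      using R0 IJ by (subst ennreal_mult[symmetric]) (auto simp: field_simps power2_eq_square)
    finally show "(\<integral>\<^sup>+x. l x \<partial>?L) \<le> ennreal (I / 2 + 2 * R\<^sup>2 * J)" .
  qed
  finally have main: "ennreal I \<le> ennreal K * S + ennreal (I / 2 + 2 * R\<^sup>2 * J)" .
  have JG: "J \<le> (LINT x|M. (norm (cgrad \<phi> x))\<^sup>2)"
    unfolding J_def
  proof (rule integral_mono[OF i1(2)])
    show "integrable M (\<lambda>x. (norm (cgrad \<phi> x))\<^sup>2)"
      by (rule L2_integrable[OF continuous_L2[OF continuous_cgrad[OF \<phi>] open_dom bounded_dom]])
    show "(?D x)\<^sup>2 \<le> (norm (cgrad \<phi> x))\<^sup>2" for x
      using Basis_le_norm[OF b, of "cgrad \<phi> x"] by (simp add: cgrad_inner[OF b] abs_le_square_iff[symmetric])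
  qed
  have "ennreal I \<le> ennreal (2 * K) * S + ennreal (4 * R\<^sup>2 * J)"
  \<comment> \<open>Half of the finite \<open>I\<close> is subtracted in the reals; if the boundary
    integral is infinite there is nothing to show.\<close>
  proof (cases S)
    case (real s)
    then have "ennreal I \<le> ennreal (K * s + (I / 2 + 2 * R\<^sup>2 * J))"
      using main K0 IJ by (simp add: ennreal_mult)
    then have "I \<le> K * s + (I / 2 + 2 * R\<^sup>2 * J)"
      using real K0 IJ by (subst (asm) ennreal_le_iff) auto
    then have "I \<le> 2 * K * s + 4 * R\<^sup>2 * J" by linarith
    then have "ennreal I \<le> ennreal (2 * K * s + 4 * R\<^sup>2 * J)" by (rule ennreal_leI)
    then show ?thesis using real K0 IJ by (simp add: ennreal_mult)
  next
    case top
    then show ?thesis using K0 by (simp add: ennreal_mult_top)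
  qed
  also have "\<dots> \<le> ennreal (2 * K) * S + ennreal (4 * R\<^sup>2 * (LINT x|M. (norm (cgrad \<phi> x))\<^sup>2))"
    using JG by (intro add_left_mono ennreal_leI mult_left_mono) auto
  finally show ?thesis by (simp add: I_def S_def)
qed

text \<open>Along the smooth approximants that define \<open>H1_0\<close> the boundary term of the
  smooth inequality tends to zero.\<close>

lemma friedrichs:
  assumes dim: "DIM('a) \<ge> 2"
    and HM: "\<And>A. A \<in> sets \<Sigma> \<Longrightarrow> emeasure \<Sigma> A = hausdorff (DIM('a) - 1) A"
  shows "\<exists>C>0. \<forall>w\<in>H1_0 \<Omega>. (LINT x|M. (w x)\<^sup>2) \<le> C * (LINT x|M. (norm (wgrad \<Omega> w x))\<^sup>2)"
proof -
  obtain B where B: "B > 0" "\<And>y. y \<in> \<Omega> \<Longrightarrow> norm y \<le> B" using bounded_dom by (auto simp: bounded_pos)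
  define R where "R = 2 * B + 1"
  have R0: "R > 0" and R: "\<And>y. y \<in> \<Omega> \<Longrightarrow> 2 * norm y < R" using B by (force simp: R_def)+
  define K where "K = 4 ^ (DIM('a) - 1) * (R + 2) / unit_ball_vol (real (DIM('a) - 1))"
  \<comment> \<open>16 is \<open>2 * 4 * 2\<close>: the outer factors come from passing to the
    approximant in the function and in the gradient, the middle one from the smooth
    inequality.\<close>
  have "(LINT x|M. (w x)\<^sup>2) \<le> 16 * R\<^sup>2 * (LINT x|M. (norm (wgrad \<Omega> w x))\<^sup>2)" if wN: "w \<in> H1_0 \<Omega>" for w
  proof -
    obtain \<phi> where w: "w \<in> H1 \<Omega>" and \<phi>: "\<And>n. smooth (\<phi> n)"
      and l1: "(\<lambda>n. H1_norm \<Omega> (\<lambda>x. \<phi> n x - w x)) \<longlonglongrightarrow> 0"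
      and l2: "(\<lambda>n. \<integral>\<^sup>+x. ennreal ((\<phi> n x)\<^sup>2) \<partial>\<Sigma>) \<longlonglongrightarrow> 0"
      using wN unfolding H1_0_def has_trace_def by auto
    let ?W = "LINT x|M. (w x)\<^sup>2" and ?G = "LINT x|M. (norm (wgrad \<Omega> w x))\<^sup>2"
    define A where "A n = H1_form (\<lambda>x. \<phi> n x - w x) (\<lambda>x. \<phi> n x - w x)" for n
    define s where "s n = (\<integral>\<^sup>+x. ennreal ((\<phi> n x)\<^sup>2) \<partial>\<Sigma>)" for n
    have pH: "\<phi> n \<in> H1 \<Omega>" for n by (rule smooth_H1[OF \<phi>])
    have A0: "0 \<le> A n" for n
      unfolding A_def using semi_ip.nonneg[OF H1_semi_ip H1_diff[OF pH w]] by simp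
    have "(\<lambda>n. (H1_norm \<Omega> (\<lambda>x. \<phi> n x - w x))\<^sup>2) \<longlonglongrightarrow> 0\<^sup>2" by (intro tendsto_intros l1)
    moreover have "(H1_norm \<Omega> (\<lambda>x. \<phi> n x - w x))\<^sup>2 = A n" for n
      using A0[of n] by (simp add: H1_norm_form A_def)
    ultimately have A: "A \<longlonglongrightarrow> 0" by simp
    have A_eq: "A n = (LINT x|M. (norm (\<phi> n x - w x))\<^sup>2) + (LINT x|M. (norm (wgrad \<Omega> (\<phi> n) x - wgrad \<Omega> w x))\<^sup>2)" for n
      unfolding A_def by (rule H1_form_diff[OF pH w])
    have nn: "0 \<le> (LINT x|M. (norm (h x))\<^sup>2)" for h :: "'a \<Rightarrow> 'c::real_normed_vector"
      by (intro integral_nonneg_AE) auto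
    have A_ge: "(LINT x|M. (norm (wgrad \<Omega> (\<phi> n) x - wgrad \<Omega> w x))\<^sup>2) \<le> A n" for n
      unfolding A_eq by (rule order_trans[OF _ add_mono[OF nn order_refl]]) simp
    have gr: "(LINT x|M. (norm (cgrad (\<phi> n) x))\<^sup>2) \<le> 2 * A n + 2 * ?G" for n
    proof -
      have "(LINT x|M. (norm (cgrad (\<phi> n) x))\<^sup>2) = (LINT x|M. (norm (wgrad \<Omega> (\<phi> n) x))\<^sup>2)"
      proof (rule integral_cong_AE)
        show "AE x in M. (norm (cgrad (\<phi> n) x))\<^sup>2 = (norm (wgrad \<Omega> (\<phi> n) x))\<^sup>2"
          using weak_grad_unique[OF smooth_weak_grad[OF open_dom bounded_dom \<phi>[of n]] wgrad[OF pH[of n]]]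
          by eventually_elim simp
        have [measurable]: "cgrad (\<phi> n) \<in> borel_measurable M" "wgrad \<Omega> (\<phi> n) \<in> borel_measurable M"
          using L2_measurable weak_grad_L2[OF smooth_weak_grad[OF open_dom bounded_dom \<phi>]] wgrad_L2[OF pH] by auto
        show "(\<lambda>x. (norm (cgrad (\<phi> n) x))\<^sup>2) \<in> borel_measurable M" "(\<lambda>x. (norm (wgrad \<Omega> (\<phi> n) x))\<^sup>2) \<in> borel_measurable M"
          by measurable
      qed
      also have "\<dots> \<le> 2 * (LINT x|M. (norm (wgrad \<Omega> (\<phi> n) x - wgrad \<Omega> w x))\<^sup>2) + 2 * ?G"
        using L2_add_sq[OF L2_diff[OF wgrad_L2[OF pH[of n]] wgrad_L2[OF w]] wgrad_L2[OF w]] by simp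
      also have "\<dots> \<le> 2 * A n + 2 * ?G"
        by (intro add_right_mono mult_left_mono A_ge) simp
      finally show ?thesis .
    qed
    have "ennreal ?W \<le> ennreal (2 * A n) + 2 * (ennreal (2 * K) * s n + ennreal (4 * R\<^sup>2 * (2 * A n + 2 * ?G)))" for n
    proof -
      have "?W \<le> 2 * (LINT x|M. (norm (w x - \<phi> n x))\<^sup>2) + 2 * (LINT x|M. (\<phi> n x)\<^sup>2)"
        using L2_add_sq[OF L2_diff[OF H1_L2[OF w] H1_L2[OF pH[of n]]] H1_L2[OF pH[of n]]] by simp
      also have "\<dots> \<le> 2 * A n + 2 * (LINT x|M. (\<phi> n x)\<^sup>2)"
        using nn[of "\<lambda>x. wgrad \<Omega> (\<phi> n) x - wgrad \<Omega> w x"] unfolding A_eq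
        by (simp add: power2_commute)
      finally have "ennreal ?W \<le> ennreal (2 * A n + 2 * (LINT x|M. (\<phi> n x)\<^sup>2))" by (rule ennreal_leI)
      also have "\<dots> = ennreal (2 * A n) + 2 * ennreal (LINT x|M. (\<phi> n x)\<^sup>2)"
        using A0[of n] by (simp add: ennreal_plus ennreal_mult)
      also have "\<dots> \<le> ennreal (2 * A n) + 2 * (ennreal (2 * K) * s n + ennreal (4 * R\<^sup>2 * (LINT x|M. (norm (cgrad (\<phi> n) x))\<^sup>2)))"
        unfolding s_def by (intro add_left_mono mult_left_mono smooth_friedrichs[OF dim HM R R0 \<phi> K_def]) auto
      also have "\<dots> \<le> ennreal (2 * A n) + 2 * (ennreal (2 * K) * s n + ennreal (4 * R\<^sup>2 * (2 * A n + 2 * ?G)))"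
        by (intro add_left_mono mult_left_mono ennreal_leI gr) auto
      finally show ?thesis .
    qed
    moreover have "(\<lambda>n. ennreal (2 * A n) + 2 * (ennreal (2 * K) * s n + ennreal (4 * R\<^sup>2 * (2 * A n + 2 * ?G)))) \<longlonglongrightarrow>
        ennreal (2 * 0) + 2 * (ennreal (2 * K) * 0 + ennreal (4 * R\<^sup>2 * (2 * 0 + 2 * ?G)))"
      using A l2 unfolding s_def by (intro tendsto_add ennreal_tendsto_cmult tendsto_ennrealI tendsto_mult tendsto_const) auto
    ultimately have "ennreal ?W \<le> ennreal (2 * 0) + 2 * (ennreal (2 * K) * 0 + ennreal (4 * R\<^sup>2 * (2 * 0 + 2 * ?G)))"
      by (intro LIMSEQ_le_const) auto
    also have "\<dots> = ennreal (16 * R\<^sup>2 * ?G)"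
      using ennreal_mult[of 2 "4 * R\<^sup>2 * (2 * ?G)"] nn[of "wgrad \<Omega> w"] by (simp add: algebra_simps)
    finally show ?thesis using nn[of "wgrad \<Omega> w"] by (simp add: ennreal_le_iff)
  qed
  then show ?thesis using R0 by (intro exI[of _ "16 * R\<^sup>2"]) auto
qed

section \<open>Traces\<close>

lemma H1_norm_nrm: "H1_norm \<Omega> u = semi_ip.nrm H1_form u"
  by (simp add: H1_norm_form semi_ip.nrm_def[OF H1_semi_ip])

lemma H1_norm_add: "u \<in> H1 \<Omega> \<Longrightarrow> v \<in> H1 \<Omega> \<Longrightarrow> H1_norm \<Omega> (fadd u v) \<le> H1_norm \<Omega> u + H1_norm \<Omega> v"
  unfolding H1_norm_nrm by (rule semi_ip.nrm_add[OF H1_semi_ip])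

lemma H1_norm_scl: "u \<in> H1 \<Omega> \<Longrightarrow> H1_norm \<Omega> (fscl c u) = \<bar>c\<bar> * H1_norm \<Omega> u"
  unfolding H1_norm_nrm by (rule semi_ip.nrm_scl[OF H1_semi_ip])

lemma H1_norm_nonneg: "u \<in> H1 \<Omega> \<Longrightarrow> 0 \<le> H1_norm \<Omega> u"
  unfolding H1_norm_nrm by (rule semi_ip.nrm_nonneg[OF H1_semi_ip])

lemma smooth_measurable_\<Sigma>: "smooth \<phi> \<Longrightarrow> \<phi> \<in> borel_measurable \<Sigma>"
  using measurable_restrict_space1[OF borel_measurable_continuous_onI[OF smooth_continuous], of \<phi> "frontier \<Omega>"] sets_\<Sigma>
  by (simp cong: measurable_cong_sets)

lemma has_trace_add:
  assumes "has_trace \<Omega> u f" "has_trace \<Omega> v g"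
  shows "has_trace \<Omega> (fadd u v) (fadd f g)"
proof -
  obtain \<phi> where u: "u \<in> H1 \<Omega>" "f \<in> L2 \<Sigma>" and \<phi>: "\<And>n. smooth (\<phi> n)"
      "(\<lambda>n. H1_norm \<Omega> (\<lambda>x. \<phi> n x - u x)) \<longlonglongrightarrow> 0" "(\<lambda>n. \<integral>\<^sup>+x. ennreal ((\<phi> n x - f x)\<^sup>2) \<partial>\<Sigma>) \<longlonglongrightarrow> 0"
    using assms(1) unfolding has_trace_def by blast
  obtain \<psi> where v: "v \<in> H1 \<Omega>" "g \<in> L2 \<Sigma>" and \<psi>: "\<And>n. smooth (\<psi> n)"
      "(\<lambda>n. H1_norm \<Omega> (\<lambda>x. \<psi> n x - v x)) \<longlonglongrightarrow> 0" "(\<lambda>n. \<integral>\<^sup>+x. ennreal ((\<psi> n x - g x)\<^sup>2) \<partial>\<Sigma>) \<longlonglongrightarrow> 0"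
    using assms(2) unfolding has_trace_def by blast
  have [measurable]: "\<And>n. \<phi> n \<in> borel_measurable \<Sigma>" "\<And>n. \<psi> n \<in> borel_measurable \<Sigma>" "f \<in> borel_measurable \<Sigma>" "g \<in> borel_measurable \<Sigma>"
    using \<phi> \<psi> u v smooth_measurable_\<Sigma> L2_measurable by auto
  have l1: "(\<lambda>n. H1_norm \<Omega> (\<lambda>x. (\<phi> n x + \<psi> n x) - (u x + v x))) \<longlonglongrightarrow> 0"
  proof (rule tendsto_sandwich[where f = "\<lambda>_. 0"])
    have H: "(\<lambda>x. \<phi> n x - u x) \<in> H1 \<Omega>" "(\<lambda>x. \<psi> n x - v x) \<in> H1 \<Omega>" for n
      using H1_diff[OF smooth_H1[OF \<phi>(1)] u(1)] H1_diff[OF smooth_H1[OF \<psi>(1)] v(1)] by auto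
    have eq: "(\<lambda>x. (\<phi> n x + \<psi> n x) - (u x + v x)) = fadd (\<lambda>x. \<phi> n x - u x) (\<lambda>x. \<psi> n x - v x)" for n
      by auto
    show "\<forall>\<^sub>F n in sequentially. H1_norm \<Omega> (\<lambda>x. (\<phi> n x + \<psi> n x) - (u x + v x)) \<le> H1_norm \<Omega> (\<lambda>x. \<phi> n x - u x) + H1_norm \<Omega> (\<lambda>x. \<psi> n x - v x)"
      unfolding eq using H1_norm_add[OF H] by (intro always_eventually allI)
    show "\<forall>\<^sub>F n in sequentially. 0 \<le> H1_norm \<Omega> (\<lambda>x. (\<phi> n x + \<psi> n x) - (u x + v x))"
      unfolding eq using H1_norm_nonneg[OF H1_add[OF H]] by (intro always_eventually allI)
    show "(\<lambda>n. H1_norm \<Omega> (\<lambda>x. \<phi> n x - u x) + H1_norm \<Omega> (\<lambda>x. \<psi> n x - v x)) \<longlonglongrightarrow> 0"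
      using tendsto_add[OF \<phi>(2) \<psi>(2)] by simp
  qed simp
  have l2: "(\<lambda>n. \<integral>\<^sup>+x. ennreal (((\<phi> n x + \<psi> n x) - (f x + g x))\<^sup>2) \<partial>\<Sigma>) \<longlonglongrightarrow> 0"
  proof (rule tendsto_sandwich[where f = "\<lambda>_. 0"])
    have "(\<integral>\<^sup>+x. ennreal (((\<phi> n x + \<psi> n x) - (f x + g x))\<^sup>2) \<partial>\<Sigma>) \<le>
        2 * (\<integral>\<^sup>+x. ennreal ((\<phi> n x - f x)\<^sup>2) \<partial>\<Sigma>) + 2 * (\<integral>\<^sup>+x. ennreal ((\<psi> n x - g x)\<^sup>2) \<partial>\<Sigma>)" for n
    proof -
      have "(\<integral>\<^sup>+x. ennreal (((\<phi> n x + \<psi> n x) - (f x + g x))\<^sup>2) \<partial>\<Sigma>) \<le>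
         (\<integral>\<^sup>+x. ennreal 2 * ennreal ((\<phi> n x - f x)\<^sup>2) + ennreal 2 * ennreal ((\<psi> n x - g x)\<^sup>2) \<partial>\<Sigma>)"
      proof (rule nn_integral_mono)
        fix x
        have "((\<phi> n x + \<psi> n x) - (f x + g x))\<^sup>2 \<le> 2 * (\<phi> n x - f x)\<^sup>2 + 2 * (\<psi> n x - g x)\<^sup>2"
          using zero_le_power2[of "(\<phi> n x - f x) - (\<psi> n x - g x)"] by (simp add: power2_eq_square algebra_simps)
        then show "ennreal (((\<phi> n x + \<psi> n x) - (f x + g x))\<^sup>2) \<le> ennreal 2 * ennreal ((\<phi> n x - f x)\<^sup>2) + ennreal 2 * ennreal ((\<psi> n x - g x)\<^sup>2)"
          by (simp only: ennreal_mult[symmetric] ennreal_plus[symmetric] zero_le_power2 zero_le_numeral mult_nonneg_nonneg ennreal_leI)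
      qed
      also have "\<dots> = 2 * (\<integral>\<^sup>+x. ennreal ((\<phi> n x - f x)\<^sup>2) \<partial>\<Sigma>) + 2 * (\<integral>\<^sup>+x. ennreal ((\<psi> n x - g x)\<^sup>2) \<partial>\<Sigma>)"
        by (simp add: nn_integral_add nn_integral_cmult)
      finally show ?thesis .
    qed
    then show "\<forall>\<^sub>F n in sequentially. (\<integral>\<^sup>+x. ennreal (((\<phi> n x + \<psi> n x) - (f x + g x))\<^sup>2) \<partial>\<Sigma>) \<le>
        2 * (\<integral>\<^sup>+x. ennreal ((\<phi> n x - f x)\<^sup>2) \<partial>\<Sigma>) + 2 * (\<integral>\<^sup>+x. ennreal ((\<psi> n x - g x)\<^sup>2) \<partial>\<Sigma>)"
      by (intro always_eventually allI)
    show "(\<lambda>n. 2 * (\<integral>\<^sup>+x. ennreal ((\<phi> n x - f x)\<^sup>2) \<partial>\<Sigma>) + 2 * (\<integral>\<^sup>+x. ennreal ((\<psi> n x - g x)\<^sup>2) \<partial>\<Sigma>)) \<longlonglongrightarrow> 0"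
      using tendsto_add[OF ennreal_tendsto_cmult[OF _ \<phi>(3), of 2] ennreal_tendsto_cmult[OF _ \<psi>(3), of 2]] by simp
  qed auto
  show ?thesis
    unfolding has_trace_def
  proof (intro conjI exI allI)
    show "fadd u v \<in> H1 \<Omega>" by (rule H1_add[OF u(1) v(1)])
    show "fadd f g \<in> L2 \<Sigma>" by (rule L2_add[OF u(2) v(2)])
    show "smooth (fadd (\<phi> n) (\<psi> n))" for n by (rule smooth_add[OF \<phi>(1) \<psi>(1)])
  qed (use l1 l2 in simp_all)
qed

lemma has_trace_scl:
  assumes "has_trace \<Omega> u f"
  shows "has_trace \<Omega> (fscl c u) (fscl c f)"
proof -
  obtain \<phi> where u: "u \<in> H1 \<Omega>" "f \<in> L2 \<Sigma>" and \<phi>: "\<And>n. smooth (\<phi> n)"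
      "(\<lambda>n. H1_norm \<Omega> (\<lambda>x. \<phi> n x - u x)) \<longlonglongrightarrow> 0" "(\<lambda>n. \<integral>\<^sup>+x. ennreal ((\<phi> n x - f x)\<^sup>2) \<partial>\<Sigma>) \<longlonglongrightarrow> 0"
    using assms(1) unfolding has_trace_def by blast
  have [measurable]: "\<And>n. \<phi> n \<in> borel_measurable \<Sigma>" "f \<in> borel_measurable \<Sigma>"
    using \<phi> u smooth_measurable_\<Sigma> L2_measurable by auto
  have l1: "(\<lambda>n. H1_norm \<Omega> (\<lambda>x. c * \<phi> n x - c * u x)) \<longlonglongrightarrow> 0"
  proof -
    have "(\<lambda>x. \<phi> n x - u x) \<in> H1 \<Omega>" for n by (rule H1_diff[OF smooth_H1[OF \<phi>(1)] u(1)])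
    from H1_norm_scl[OF this] have "H1_norm \<Omega> (\<lambda>x. c * \<phi> n x - c * u x) = \<bar>c\<bar> * H1_norm \<Omega> (\<lambda>x. \<phi> n x - u x)" for n
      by (simp add: right_diff_distrib)
    then show ?thesis using tendsto_mult_right_zero[OF \<phi>(2), of "\<bar>c\<bar>"] by simp
  qed
  have l2: "(\<lambda>n. \<integral>\<^sup>+x. ennreal ((c * \<phi> n x - c * f x)\<^sup>2) \<partial>\<Sigma>) \<longlonglongrightarrow> 0"
  proof -
    have "ennreal ((c * \<phi> n x - c * f x)\<^sup>2) = ennreal (c\<^sup>2) * ennreal ((\<phi> n x - f x)\<^sup>2)" for n x
      by (simp add: ennreal_mult[symmetric] power_mult_distrib[symmetric] right_diff_distrib)
    then have "(\<integral>\<^sup>+x. ennreal ((c * \<phi> n x - c * f x)\<^sup>2) \<partial>\<Sigma>) = ennreal (c\<^sup>2) * (\<integral>\<^sup>+x. ennreal ((\<phi> n x - f x)\<^sup>2) \<partial>\<Sigma>)" for n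
      by (simp add: nn_integral_cmult)
    then show ?thesis using ennreal_tendsto_cmult[OF _ \<phi>(3), of "ennreal (c\<^sup>2)"] by simp
  qed
  show ?thesis
    unfolding has_trace_def
  proof (intro conjI exI allI)
    show "fscl c u \<in> H1 \<Omega>" by (rule H1_scl[OF u(1)])
    show "fscl c f \<in> L2 \<Sigma>" by (rule L2_scl_real[OF u(2)])
    show "smooth (fscl c (\<phi> n))" for n by (rule smooth_mult[OF smooth_const \<phi>(1)])
  qed (use l1 l2 in simp_all)
qed

lemma has_trace_L2: "has_trace \<Omega> u f \<Longrightarrow> f \<in> L2 \<Sigma>" and has_trace_H1: "has_trace \<Omega> u f \<Longrightarrow> u \<in> H1 \<Omega>"
  by (auto simp: has_trace_def)

lemma has_trace_AE:
  assumes "has_trace \<Omega> u f" "g \<in> L2 \<Sigma>" "AE x in \<Sigma>. g x = f x"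
  shows "has_trace \<Omega> u g"
proof -
  have "(\<integral>\<^sup>+x. ennreal ((\<phi> n x - g x)\<^sup>2) \<partial>\<Sigma>) = (\<integral>\<^sup>+x. ennreal ((\<phi> n x - f x)\<^sup>2) \<partial>\<Sigma>)" for \<phi> :: "nat \<Rightarrow> 'a \<Rightarrow> real" and n
    using assms(3) by (intro nn_integral_cong_AE) (auto elim: eventually_mono)
  then show ?thesis using assms(1,2) by (simp add: has_trace_def)
qed

lemma H1_0_iff: "w \<in> H1_0 \<Omega> \<longleftrightarrow> has_trace \<Omega> w (\<lambda>_. 0)"
  by (auto simp: H1_0_def has_trace_def)

lemma H1_0_H1: "w \<in> H1_0 \<Omega> \<Longrightarrow> w \<in> H1 \<Omega>" by (simp add: H1_0_def)

lemma H1_0_add: "u \<in> H1_0 \<Omega> \<Longrightarrow> v \<in> H1_0 \<Omega> \<Longrightarrow> fadd u v \<in> H1_0 \<Omega>"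
  unfolding H1_0_iff using has_trace_add[of u "\<lambda>_. 0" v "\<lambda>_. 0"] by simp

lemma H1_0_scl: "u \<in> H1_0 \<Omega> \<Longrightarrow> fscl c u \<in> H1_0 \<Omega>"
  unfolding H1_0_iff using has_trace_scl[of u "\<lambda>_. 0" c] by simp

lemma zero_H1_0: "(\<lambda>_. 0) \<in> H1_0 \<Omega>"
proof -
  have z: "(\<lambda>_. 0) \<in> H1 \<Omega>" by (rule smooth_H1[OF smooth_const])
  have "H1_norm \<Omega> (\<lambda>_. 0) = 0" using H1_norm_scl[OF z, of 0] by simp
  then show ?thesis unfolding H1_0_iff has_trace_def
    using z by (auto simp: L2_def intro!: exI[of _ "\<lambda>_ _. 0"] smooth_const)
qed

text \<open>A diagonal sequence: each \<open>w n\<close> is replaced by a smooth function within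
  \<open>1 / Suc n\<close> of it in \<open>H1\<close>, with squared boundary integral below the same
  bound.\<close>

lemma H1_0_closed:
  assumes w: "\<And>n. w n \<in> H1_0 \<Omega>" and z: "z \<in> H1 \<Omega>"
    and lim: "(\<lambda>n. H1_norm \<Omega> (\<lambda>x. w n x - z x)) \<longlonglongrightarrow> 0"
  shows "z \<in> H1_0 \<Omega>"
proof -
  have "\<exists>\<phi>. smooth \<phi> \<and> H1_norm \<Omega> (\<lambda>x. \<phi> x - w n x) < 1 / Suc n \<and> (\<integral>\<^sup>+x. ennreal ((\<phi> x)\<^sup>2) \<partial>\<Sigma>) < ennreal (1 / Suc n)" for n
  proof -
    obtain \<phi> where \<phi>: "\<And>k. smooth (\<phi> k)" "(\<lambda>k. H1_norm \<Omega> (\<lambda>x. \<phi> k x - w n x)) \<longlonglongrightarrow> 0"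
        "(\<lambda>k. \<integral>\<^sup>+x. ennreal ((\<phi> k x - 0)\<^sup>2) \<partial>\<Sigma>) \<longlonglongrightarrow> 0"
      using w[of n] unfolding H1_0_iff has_trace_def by blast
    have "\<forall>\<^sub>F k in sequentially. H1_norm \<Omega> (\<lambda>x. \<phi> k x - w n x) < 1 / Suc n"
      by (rule order_tendstoD(2)[OF \<phi>(2)]) simp
    moreover have "\<forall>\<^sub>F k in sequentially. (\<integral>\<^sup>+x. ennreal ((\<phi> k x - 0)\<^sup>2) \<partial>\<Sigma>) < ennreal (1 / Suc n)"
      by (rule order_tendstoD(2)[OF \<phi>(3)]) simp
    ultimately have "\<forall>\<^sub>F k in sequentially. H1_norm \<Omega> (\<lambda>x. \<phi> k x - w n x) < 1 / Suc n \<and>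
        (\<integral>\<^sup>+x. ennreal ((\<phi> k x)\<^sup>2) \<partial>\<Sigma>) < ennreal (1 / Suc n)" by eventually_elim simp
    then obtain k where "H1_norm \<Omega> (\<lambda>x. \<phi> k x - w n x) < 1 / Suc n \<and> (\<integral>\<^sup>+x. ennreal ((\<phi> k x)\<^sup>2) \<partial>\<Sigma>) < ennreal (1 / Suc n)"
      using eventually_happens' trivial_limit_sequentially by blast
    then show ?thesis using \<phi>(1) by blast
  qed
  then obtain \<phi> where \<phi>: "\<And>n. smooth (\<phi> n)" "\<And>n. H1_norm \<Omega> (\<lambda>x. \<phi> n x - w n x) < 1 / Suc n"
      "\<And>n. (\<integral>\<^sup>+x. ennreal ((\<phi> n x)\<^sup>2) \<partial>\<Sigma>) < ennreal (1 / Suc n)" by metis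
  have inv: "(\<lambda>n. 1 / real (Suc n)) \<longlonglongrightarrow> 0" by (rule LIMSEQ_inverse_real_of_nat[unfolded inverse_eq_divide])
  have "(\<lambda>n. H1_norm \<Omega> (\<lambda>x. \<phi> n x - z x)) \<longlonglongrightarrow> 0"
  proof (rule tendsto_sandwich[where f = "\<lambda>_. 0"])
    have H: "(\<lambda>x. \<phi> n x - w n x) \<in> H1 \<Omega>" "(\<lambda>x. w n x - z x) \<in> H1 \<Omega>" for n
      using H1_diff[OF smooth_H1[OF \<phi>(1)] H1_0_H1[OF w]] H1_diff[OF H1_0_H1[OF w] z] by auto
    show "\<forall>\<^sub>F n in sequentially. H1_norm \<Omega> (\<lambda>x. \<phi> n x - z x) \<le> 1 / Suc n + H1_norm \<Omega> (\<lambda>x. w n x - z x)"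
    proof (intro always_eventually allI)
      fix n
      show "H1_norm \<Omega> (\<lambda>x. \<phi> n x - z x) \<le> 1 / Suc n + H1_norm \<Omega> (\<lambda>x. w n x - z x)"
        using H1_norm_add[OF H(1)[of n] H(2)[of n]] \<phi>(2)[of n] by simp
    qed
    show "\<forall>\<^sub>F n in sequentially. 0 \<le> H1_norm \<Omega> (\<lambda>x. \<phi> n x - z x)"
      by (intro always_eventually allI H1_norm_nonneg H1_diff[OF smooth_H1[OF \<phi>(1)] z])
    show "(\<lambda>n. 1 / Suc n + H1_norm \<Omega> (\<lambda>x. w n x - z x)) \<longlonglongrightarrow> 0"
      using tendsto_add[OF inv lim] by simp
  qed simp
  moreover have "(\<lambda>n. \<integral>\<^sup>+x. ennreal ((\<phi> n x - 0)\<^sup>2) \<partial>\<Sigma>) \<longlonglongrightarrow> 0"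
  proof (rule tendsto_sandwich[where f = "\<lambda>_. 0"])
    show "(\<lambda>n. ennreal (1 / Suc n)) \<longlonglongrightarrow> 0" using tendsto_ennrealI[OF inv] by simp
    show "\<forall>\<^sub>F n in sequentially. (\<integral>\<^sup>+x. ennreal ((\<phi> n x - 0)\<^sup>2) \<partial>\<Sigma>) \<le> ennreal (1 / Suc n)"
      using \<phi>(3) by (intro always_eventually allI) (simp add: less_imp_le)
  qed auto
  ultimately show ?thesis unfolding H1_0_iff has_trace_def using z \<phi>(1) by (auto simp: L2_def)
qed

section \<open>The trace space and the Dirichlet-to-Neumann operator\<close>

lemma form_le:
  assumes a: "weight \<Omega> a" and A: "0 \<le> A" "AE x in M. \<bar>a x\<bar> \<le> A" and c: "0 \<le> c" and v: "v \<in> H1 \<Omega>"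
  shows "form \<Omega> c a v v \<le> (c + A) * H1_form v v"
proof -
  have "energy \<Omega> a v v \<le> (LINT x|M. A * inner (wgrad \<Omega> v x) (wgrad \<Omega> v x))"
    unfolding energy_def
  proof (rule integral_mono_AE)
    show "integrable M (\<lambda>x. a x * inner (wgrad \<Omega> v x) (wgrad \<Omega> v x))"
      by (rule energy_integrable[OF a wgrad_L2[OF v] wgrad_L2[OF v]])
    show "integrable M (\<lambda>x. A * inner (wgrad \<Omega> v x) (wgrad \<Omega> v x))"
      using L2_inner_integrable[OF wgrad_L2[OF v] wgrad_L2[OF v]] by simp
    show "AE x in M. a x * inner (wgrad \<Omega> v x) (wgrad \<Omega> v x) \<le> A * inner (wgrad \<Omega> v x) (wgrad \<Omega> v x)"
      using A(2) by eventually_elim (auto intro: mult_right_mono)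
  qed
  also have "\<dots> = A * energy \<Omega> (\<lambda>_. 1) v v" by (simp add: energy_def)
  finally have e: "energy \<Omega> a v v \<le> A * energy \<Omega> (\<lambda>_. 1) v v" .
  have "0 \<le> (LINT x|M. v x * v x)" "0 \<le> energy \<Omega> (\<lambda>_. 1) v v"
    unfolding energy_def by (auto intro!: integral_nonneg_AE)
  then have "0 \<le> A * (LINT x|M. v x * v x)" "0 \<le> c * energy \<Omega> (\<lambda>_. 1) v v"
    using A c by auto
  with e show ?thesis by (simp add: form_def algebra_simps)
qed

lemma energy_ge:
  assumes a: "weight \<Omega> a" and a0: "AE x in M. a0 \<le> a x" and v: "v \<in> H1 \<Omega>"
  shows "a0 * energy \<Omega> (\<lambda>_. 1) v v \<le> energy \<Omega> a v v"
proof -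
  have "(LINT x|M. a0 * inner (wgrad \<Omega> v x) (wgrad \<Omega> v x)) \<le> energy \<Omega> a v v"
    unfolding energy_def
  proof (rule integral_mono_AE)
    show "integrable M (\<lambda>x. a x * inner (wgrad \<Omega> v x) (wgrad \<Omega> v x))"
      by (rule energy_integrable[OF a wgrad_L2[OF v] wgrad_L2[OF v]])
    show "integrable M (\<lambda>x. a0 * inner (wgrad \<Omega> v x) (wgrad \<Omega> v x))"
      using L2_inner_integrable[OF wgrad_L2[OF v] wgrad_L2[OF v]] by simp
    show "AE x in M. a0 * inner (wgrad \<Omega> v x) (wgrad \<Omega> v x) \<le> a x * inner (wgrad \<Omega> v x) (wgrad \<Omega> v x)"
      using a0 by eventually_elim (auto intro: mult_right_mono)
  qed
  then show ?thesis by (simp add: energy_def)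
qed

section \<open>Boundary classes and their extensions\<close>

abbreviation "T \<equiv> trace_space \<Omega>"
abbreviation "bc \<equiv> bdry_class \<Omega>"

lemma bc_self: "f \<in> L2 \<Sigma> \<Longrightarrow> f \<in> bc f"
  by (simp add: bdry_class_def)

lemma bc_cong: "AE x in \<Sigma>. g x = f x \<Longrightarrow> bc g = bc f"
  unfolding bdry_class_def by (auto elim: eventually_elim2)

text \<open>All pairs of representatives yield the same class, and the classes are nonempty by
  \<open>bc_self\<close>, so the union in the definition of the sum is just that class.\<close>

lemma vadd_bc:
  assumes "f \<in> L2 \<Sigma>" "g \<in> L2 \<Sigma>"
  shows "vadd T (bc f) (bc g) = bc (fadd f g)"
proof -
  have "bc (fadd f' g') = bc (fadd f g)" if "f' \<in> bc f" "g' \<in> bc g" for f' g'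
    using that by (intro bc_cong) (auto simp: bdry_class_def elim: eventually_elim2)
  then have "(\<Union>f'\<in>bc f. \<Union>g'\<in>bc g. bc (fadd f' g')) = bc (fadd f g)"
    using bc_self[OF assms(1)] bc_self[OF assms(2)] by blast
  then show ?thesis by (simp add: trace_space_def)
qed

lemma vscale_bc:
  assumes "f \<in> L2 \<Sigma>"
  shows "vscale T c (bc f) = bc (fscl c f)"
proof -
  have "bc (fscl c f') = bc (fscl c f)" if "f' \<in> bc f" for f'
    using that by (intro bc_cong) (auto simp: bdry_class_def elim: eventually_mono)
  then have "(\<Union>f'\<in>bc f. bc (fscl c f')) = bc (fscl c f)"
    using bc_self[OF assms(1)] by blast
  then show ?thesis by (simp add: trace_space_def)
qed

definition ext :: "('a \<Rightarrow> real) set \<Rightarrow> ('a \<Rightarrow> real) set" where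
  "ext F = {u \<in> H1 \<Omega>. \<exists>f\<in>F. has_trace \<Omega> u f}"

text \<open>A trace matters only almost everywhere, so one representative of the class may be fixed
  once and for all.\<close>

lemma ext_bc: "f \<in> L2 \<Sigma> \<Longrightarrow> u \<in> ext (bc f) \<longleftrightarrow> has_trace \<Omega> u f"
proof
  assume f: "f \<in> L2 \<Sigma>" and "u \<in> ext (bc f)"
  then obtain g where g: "g \<in> bc f" "has_trace \<Omega> u g" by (auto simp: ext_def)
  then have "AE x in \<Sigma>. f x = g x" by (auto simp: bdry_class_def elim: eventually_mono)
  then show "has_trace \<Omega> u f" by (rule has_trace_AE[OF g(2) f])
next
  assume "f \<in> L2 \<Sigma>" "has_trace \<Omega> u f"
  then show "u \<in> ext (bc f)" using bc_self[of f] has_trace_H1[of u f] by (auto simp: ext_def)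
qed

lemma vecs_bc:
  assumes "F \<in> vecs T"
  obtains f u where "F = bc f" "f \<in> L2 \<Sigma>" "has_trace \<Omega> u f"
  using assms has_trace_L2 by (auto simp: trace_space_def)

lemma bc_vecs: "has_trace \<Omega> u f \<Longrightarrow> bc f \<in> vecs T"
  using has_trace_H1[of u f] by (auto simp: trace_space_def)

lemma ext_H1: "u \<in> ext F \<Longrightarrow> u \<in> H1 \<Omega>"
  by (simp add: ext_def)

lemma ext_nonempty: "F \<in> vecs T \<Longrightarrow> \<exists>u. u \<in> ext F"
  using ext_bc by (metis vecs_bc)

lemma vadd_vecs:
  assumes "F \<in> vecs T" "G \<in> vecs T"
  shows "vadd T F G \<in> vecs T" and "u \<in> ext F \<Longrightarrow> v \<in> ext G \<Longrightarrow> fadd u v \<in> ext (vadd T F G)"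
proof -
  obtain f u0 where f: "F = bc f" "f \<in> L2 \<Sigma>" "has_trace \<Omega> u0 f" by (rule vecs_bc[OF assms(1)])
  obtain g v0 where g: "G = bc g" "g \<in> L2 \<Sigma>" "has_trace \<Omega> v0 g" by (rule vecs_bc[OF assms(2)])
  show "vadd T F G \<in> vecs T"
    unfolding f(1) g(1) vadd_bc[OF f(2) g(2)] by (rule bc_vecs[OF has_trace_add[OF f(3) g(3)]])
  show "fadd u v \<in> ext (vadd T F G)" if "u \<in> ext F" "v \<in> ext G"
    using that unfolding f(1) g(1) vadd_bc[OF f(2) g(2)] ext_bc[OF f(2)] ext_bc[OF g(2)] ext_bc[OF L2_add[OF f(2) g(2)]]
    by (rule has_trace_add)
qed

lemma vscale_vecs:
  assumes "F \<in> vecs T"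
  shows "vscale T c F \<in> vecs T" and "u \<in> ext F \<Longrightarrow> fscl c u \<in> ext (vscale T c F)"
proof -
  obtain f u0 where f: "F = bc f" "f \<in> L2 \<Sigma>" "has_trace \<Omega> u0 f" by (rule vecs_bc[OF assms(1)])
  show "vscale T c F \<in> vecs T"
    unfolding f(1) vscale_bc[OF f(2)] by (rule bc_vecs[OF has_trace_scl[OF f(3)]])
  show "fscl c u \<in> ext (vscale T c F)" if "u \<in> ext F"
    using that unfolding f(1) vscale_bc[OF f(2)] ext_bc[OF f(2)] ext_bc[OF L2_scl_real[OF f(2)]]
    by (rule has_trace_scl)
qed

lemma ext_diff:
  assumes "F \<in> vecs T" "u \<in> ext F" "v \<in> ext F"
  shows "(\<lambda>x. u x - v x) \<in> H1_0 \<Omega>"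
proof -
  obtain f u0 where f: "F = bc f" "f \<in> L2 \<Sigma>" "has_trace \<Omega> u0 f" by (rule vecs_bc[OF assms(1)])
  have "has_trace \<Omega> u f" "has_trace \<Omega> v f" using assms ext_bc[OF f(2)] by (auto simp: f(1))
  then show ?thesis using has_trace_add[OF _ has_trace_scl, of u f v f "-1"] by (simp add: H1_0_iff)
qed

lemma ext_diff_H1_0:
  assumes "F \<in> vecs T" "u \<in> ext F" "w \<in> H1_0 \<Omega>"
  shows "(\<lambda>x. u x - w x) \<in> ext F"
proof -
  obtain f u0 where f: "F = bc f" "f \<in> L2 \<Sigma>" "has_trace \<Omega> u0 f" by (rule vecs_bc[OF assms(1)])
  have "has_trace \<Omega> u f" using assms ext_bc[OF f(2)] by (auto simp: f(1))
  then have "has_trace \<Omega> (\<lambda>x. u x - w x) f"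
    using has_trace_add[OF _ has_trace_scl, of u f w "\<lambda>_. 0" "-1"] assms(3) by (simp add: H1_0_iff)
  then show ?thesis using ext_bc[OF f(2)] by (simp add: f(1))
qed

text \<open>For \<open>c = 0\<close> this is the weak equation with coefficient \<open>a\<close>;
  for \<open>c = 1\<close> and unit coefficient it characterises the extensions of least
  \<open>H1\<close> norm.\<close>

definition orth :: "real \<Rightarrow> ('a \<Rightarrow> real) \<Rightarrow> ('a \<Rightarrow> real) \<Rightarrow> bool" where
  "orth c a u \<longleftrightarrow> (\<forall>w\<in>H1_0 \<Omega>. form \<Omega> c a u w = 0)"

lemma sub_eq: "semi_ip.sub fadd fscl u v = (\<lambda>x. u x - v x)"
  using semi_ip.sub_def[OF H1_semi_ip, of u v] by simp

text \<open>The difference lies in \<open>H1_0\<close> and is orthogonal to it, in particular to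
  itself; by \<open>degenerate\<close> the form does not see it.\<close>

lemma orth_unique:
  assumes a: "weight \<Omega> a" and c: "0 \<le> c" and F: "F \<in> vecs T"
    and u: "u \<in> ext F" "orth c a u" and v: "v \<in> ext F" "orth c a v" and x: "x \<in> H1 \<Omega>"
  shows "form \<Omega> c a u x = form \<Omega> c a v x"
proof -
  interpret S: semi_ip "H1 \<Omega>" fadd fscl "form \<Omega> c a" by (rule form_semi_ip[OF a c])
  let ?d = "S.sub u v"
  have H: "u \<in> H1 \<Omega>" "v \<in> H1 \<Omega>" using u v ext_H1 by auto
  have d: "?d \<in> H1_0 \<Omega>" using ext_diff[OF F u(1) v(1)] by (simp add: sub_eq)
  have "form \<Omega> c a ?d ?d = form \<Omega> c a u ?d - form \<Omega> c a v ?d"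
    by (rule S.sub_left[OF H H1_0_H1[OF d]])
  also have "\<dots> = 0" using u(2) v(2) d by (simp add: orth_def)
  finally have "form \<Omega> c a ?d x = 0" by (rule S.degenerate[OF H1_0_H1[OF d] x])
  then show ?thesis using S.sub_left[OF H x] by simp
qed

text \<open>Dirichlet's principle: competitors differ from \<open>u\<close> by an element of
  \<open>H1_0\<close>, so Pythagoras applies.\<close>

lemma orth_minimal:
  assumes a: "weight \<Omega> a" and c: "0 \<le> c" and F: "F \<in> vecs T"
    and u: "u \<in> ext F" "orth c a u" and v: "v \<in> ext F"
  shows "form \<Omega> c a u u \<le> form \<Omega> c a v v"
proof -
  interpret S: semi_ip "H1 \<Omega>" fadd fscl "form \<Omega> c a" by (rule form_semi_ip[OF a c])
  let ?d = "S.sub v u"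
  have H: "u \<in> H1 \<Omega>" "v \<in> H1 \<Omega>" using u v ext_H1 by auto
  have d: "?d \<in> H1_0 \<Omega>" using ext_diff[OF F v u(1)] by (simp add: sub_eq)
  have "form \<Omega> c a u ?d = 0" using u(2) d by (simp add: orth_def)
  moreover have "0 \<le> form \<Omega> c a ?d ?d" by (rule S.nonneg[OF H1_0_H1[OF d]])
  ultimately show ?thesis using H by (simp add: S.expand S.sym[OF H(2,1)])
qed

lemma orth_add:
  assumes a: "weight \<Omega> a" and c: "0 \<le> c" and "u \<in> H1 \<Omega>" "orth c a u" "v \<in> H1 \<Omega>" "orth c a v"
  shows "orth c a (fadd u v)"
  using assms semi_ip.add_left[OF form_semi_ip[OF a c]] by (simp add: orth_def H1_0_H1)

lemma orth_scl:
  assumes a: "weight \<Omega> a" and c: "0 \<le> c" and "u \<in> H1 \<Omega>" "orth c a u"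
  shows "orth c a (fscl r u)"
  using assms semi_ip.scl_left[OF form_semi_ip[OF a c]] by (simp add: orth_def H1_0_H1)

end

section \<open>Extensions orthogonal to the functions of zero trace\<close>

locale friedrichs_domain = bounded_open +
  assumes friedrichs_ineq:
    "\<exists>C>0. \<forall>w\<in>H1_0 \<Omega>. (LINT x|M. (w x)\<^sup>2) \<le> C * (LINT x|M. (norm (wgrad \<Omega> w x))\<^sup>2)"
begin

text \<open>The energy controls the gradient through the lower bound of \<open>a\<close>, and the
  gradient controls the function by Friedrichs' inequality; hence the constant
  \<open>(C + 1) / a0\<close>.\<close>

lemma coercive:
  assumes a: "a \<in> admissible \<Omega>" and c: "0 \<le> c"
  shows "\<exists>K>0. \<forall>v\<in>H1_0 \<Omega>. H1_form v v \<le> K * form \<Omega> c a v v"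
proof -
  obtain C where C: "C > 0" "\<And>w. w \<in> H1_0 \<Omega> \<Longrightarrow> (LINT x|M. (w x)\<^sup>2) \<le> C * (LINT x|M. (norm (wgrad \<Omega> w x))\<^sup>2)"
    using friedrichs_ineq by blast
  obtain a0 where a0: "a0 > 0" "AE x in M. a0 \<le> a x" using a by (auto simp: admissible_def)
  have "H1_form v v \<le> (C + 1) / a0 * form \<Omega> c a v v" if v: "v \<in> H1_0 \<Omega>" for v
  proof -
    have "(LINT x|M. v x * v x) \<le> C * energy \<Omega> (\<lambda>_. 1) v v"
      using C(2)[OF v] by (simp add: energy_def power2_norm_eq_inner flip: power2_eq_square)
    then have "H1_form v v \<le> (C + 1) * energy \<Omega> (\<lambda>_. 1) v v" by (simp add: form_def algebra_simps)
    also have "\<dots> \<le> (C + 1) * (energy \<Omega> a v v / a0)"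
      using energy_ge[OF weight_admissible[OF a] a0(2) H1_0_H1[OF v]] a0(1) C(1)
      by (intro mult_left_mono) (auto simp: field_simps)
    also have "\<dots> \<le> (C + 1) * (form \<Omega> c a v v / a0)"
    proof -
      have "0 \<le> (LINT x|M. v x * v x)" by (auto intro!: integral_nonneg_AE)
      then have "energy \<Omega> a v v \<le> form \<Omega> c a v v" using c by (simp add: form_def)
      then show ?thesis using a0(1) C(1) by (intro mult_left_mono divide_right_mono) auto
    qed
    finally show ?thesis by simp
  qed
  then show ?thesis using a0 C by (intro exI[of _ "(C + 1) / a0"]) auto
qed

text \<open>A sequence Cauchy for the form is Cauchy in \<open>H1\<close> by coercivity; its limit
  stays in \<open>H1_0\<close> by closedness, and \<open>form_le\<close> returns the convergence to
  the form.\<close>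

lemma H1_0_projection:
  assumes a: "a \<in> admissible \<Omega>" and c: "0 \<le> c" and u: "u \<in> H1 \<Omega>"
  shows "\<exists>w\<in>H1_0 \<Omega>. \<forall>v\<in>H1_0 \<Omega>. form \<Omega> c a u v = form \<Omega> c a w v"
proof -
  note wa = weight_admissible[OF a]
  interpret S: semi_ip "H1 \<Omega>" fadd fscl "form \<Omega> c a" by (rule form_semi_ip[OF wa c])
  obtain K where K: "K > 0" "\<And>v. v \<in> H1_0 \<Omega> \<Longrightarrow> H1_form v v \<le> K * form \<Omega> c a v v" using coercive[OF a c] by blast
  obtain A where "AE x in M. \<bar>a x\<bar> \<le> A" using a by (auto simp: admissible_def)
  then have A: "AE x in M. \<bar>a x\<bar> \<le> \<bar>A\<bar>" by eventually_elim auto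
  have sub: "S.sub x y = (\<lambda>t. x t - y t)" for x y by (rule sub_eq)
  have N_diff: "(\<lambda>t. x t - y t) \<in> H1_0 \<Omega>" if "x \<in> H1_0 \<Omega>" "y \<in> H1_0 \<Omega>" for x y
    using H1_0_add[OF that(1) H1_0_scl[OF that(2)], of "-1"] by simp
  show ?thesis
  proof (rule S.projection)
    show "H1_0 \<Omega> \<subseteq> H1 \<Omega>" using H1_0_H1 by blast
    show "H1_0 \<Omega> \<noteq> {}" using zero_H1_0 by blast
    fix w :: "nat \<Rightarrow> 'a \<Rightarrow> real"
    assume w: "\<And>n. w n \<in> H1_0 \<Omega>"
      and Cau: "\<forall>\<epsilon>>0. \<exists>k. \<forall>m\<ge>k. \<forall>n\<ge>k. form \<Omega> c a (S.sub (w m) (w n)) (S.sub (w m) (w n)) < \<epsilon>"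
    have C: "\<exists>k. \<forall>m\<ge>k. \<forall>n\<ge>k. H1_form (\<lambda>x. w m x - w n x) (\<lambda>x. w m x - w n x) < \<epsilon>" if e: "\<epsilon> > 0" for \<epsilon>
    proof -
      have "\<epsilon> / K > 0" using e K by simp
      then obtain k where k: "\<forall>m\<ge>k. \<forall>n\<ge>k. form \<Omega> c a (\<lambda>x. w m x - w n x) (\<lambda>x. w m x - w n x) < \<epsilon> / K"
        using Cau unfolding sub by blast
      have "H1_form (\<lambda>x. w m x - w n x) (\<lambda>x. w m x - w n x) < \<epsilon>" if mn: "m \<ge> k" "n \<ge> k" for m n
      proof -
        have "form \<Omega> c a (\<lambda>x. w m x - w n x) (\<lambda>x. w m x - w n x) < \<epsilon> / K" using k mn by blast
        then have "K * form \<Omega> c a (\<lambda>x. w m x - w n x) (\<lambda>x. w m x - w n x) < \<epsilon>" using K(1) by (simp add: field_simps)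
        then show ?thesis using K(2)[OF N_diff[OF w[of m] w[of n]]] by linarith
      qed
      then show ?thesis by blast
    qed
    have "\<exists>z\<in>H1 \<Omega>. (\<lambda>n. H1_form (\<lambda>x. w n x - z x) (\<lambda>x. w n x - z x)) \<longlonglongrightarrow> 0"
      by (rule H1_complete[of w]) (erule C | rule H1_0_H1 w | blast)+
    then obtain z where z: "z \<in> H1 \<Omega>" and lim: "(\<lambda>n. H1_form (\<lambda>x. w n x - z x) (\<lambda>x. w n x - z x)) \<longlonglongrightarrow> 0" by blast
    have "(\<lambda>n. H1_norm \<Omega> (\<lambda>x. w n x - z x)) \<longlonglongrightarrow> 0"
      unfolding H1_norm_form using tendsto_real_sqrt[OF lim] by simp
    then have zN: "z \<in> H1_0 \<Omega>" by (rule H1_0_closed[OF w z])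
    have "(\<lambda>n. form \<Omega> c a (\<lambda>x. w n x - z x) (\<lambda>x. w n x - z x)) \<longlonglongrightarrow> 0"
    proof (rule tendsto_sandwich[where f = "\<lambda>_. 0"])
      have H: "(\<lambda>x. w n x - z x) \<in> H1 \<Omega>" for n by (rule H1_diff[OF H1_0_H1[OF w] z])
      show "\<forall>\<^sub>F n in sequentially. 0 \<le> form \<Omega> c a (\<lambda>x. w n x - z x) (\<lambda>x. w n x - z x)"
        by (intro always_eventually allI S.nonneg H)
      show "\<forall>\<^sub>F n in sequentially. form \<Omega> c a (\<lambda>x. w n x - z x) (\<lambda>x. w n x - z x) \<le>
          (c + \<bar>A\<bar>) * H1_form (\<lambda>x. w n x - z x) (\<lambda>x. w n x - z x)"
        by (intro always_eventually allI form_le[OF wa _ A c H]) simp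
      show "(\<lambda>n. (c + \<bar>A\<bar>) * H1_form (\<lambda>x. w n x - z x) (\<lambda>x. w n x - z x)) \<longlonglongrightarrow> 0"
        by (rule tendsto_mult_right_zero[OF lim])
    qed simp
    then show "\<exists>z\<in>H1_0 \<Omega>. (\<lambda>n. form \<Omega> c a (S.sub (w n) z) (S.sub (w n) z)) \<longlonglongrightarrow> 0"
      unfolding sub using zN by blast
  qed (auto intro: H1_0_add H1_0_scl u)
qed

text \<open>Any extension minus its projection onto \<open>H1_0\<close>; the subtraction leaves the
  boundary class unchanged.\<close>

lemma orth_ext:
  assumes a: "a \<in> admissible \<Omega>" and c: "0 \<le> c" and F: "F \<in> vecs T"
  shows "\<exists>u. u \<in> ext F \<and> orth c a u"
proof -
  interpret S: semi_ip "H1 \<Omega>" fadd fscl "form \<Omega> c a" by (rule form_semi_ip[OF weight_admissible[OF a] c])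
  obtain u where u: "u \<in> ext F" using ext_nonempty[OF F] by blast
  obtain w where w: "w \<in> H1_0 \<Omega>" "\<forall>v\<in>H1_0 \<Omega>. form \<Omega> c a u v = form \<Omega> c a w v"
    using H1_0_projection[OF a c ext_H1[OF u]] by blast
  have "form \<Omega> c a (S.sub u w) v = 0" if "v \<in> H1_0 \<Omega>" for v
    using S.sub_left[OF ext_H1[OF u] H1_0_H1[OF w(1)] H1_0_H1[OF that]] w(2) that by simp
  then have "orth c a (\<lambda>x. u x - w x)" by (simp add: orth_def sub_eq)
  then show ?thesis using ext_diff_H1_0[OF F u w(1)] by blast
qed

lemma one_admissible: "(\<lambda>_. 1) \<in> admissible \<Omega>"
  by (auto simp: admissible_def intro!: exI[of _ 1])

text \<open>An extension at which the quotient norm is attained. The choice is linear only up to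
  functions of norm zero, which \<open>U_unique\<close> renders harmless.\<close>

definition U :: "('a \<Rightarrow> real) set \<Rightarrow> 'a \<Rightarrow> real" where
  "U F = (SOME u. u \<in> ext F \<and> orth 1 (\<lambda>_. 1) u)"

lemma U: 
  assumes "F \<in> vecs T"
  shows "U F \<in> ext F" "orth 1 (\<lambda>_. 1) (U F)" "U F \<in> H1 \<Omega>"
proof -
  have "U F \<in> ext F \<and> orth 1 (\<lambda>_. 1) (U F)"
    unfolding U_def by (rule someI_ex[OF orth_ext[OF one_admissible _ assms]]) simp
  then show "U F \<in> ext F" "orth 1 (\<lambda>_. 1) (U F)" "U F \<in> H1 \<Omega>" using ext_H1 by auto
qed

lemma U_unique:
  assumes "F \<in> vecs T" "u \<in> ext F" "orth 1 (\<lambda>_. 1) u" "x \<in> H1 \<Omega>"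
  shows "H1_form (U F) x = H1_form u x"
  using orth_unique[OF weight_one _ assms(1) U(1,2)[OF assms(1)] assms(2-4)] by simp

definition trace_ip :: "('a \<Rightarrow> real) set \<Rightarrow> ('a \<Rightarrow> real) set \<Rightarrow> real" where
  "trace_ip F G = H1_form (U F) (U G)"

text \<open>A sum of orthogonal extensions is an orthogonal extension of the sum, so
  \<open>U_unique\<close> may exchange the chosen extension for it; multiples are treated
  alike.\<close>

lemma trace_semi_ip: "semi_ip (vecs T) (vadd T) (vscale T) trace_ip"
proof (standard, goal_cases)
  case (1 F G)
  then show ?case by (rule vadd_vecs)
next
  case (2 c F)
  then show ?case by (rule vscale_vecs)
next
  case (3 F G)
  then show ?case unfolding trace_ip_def by (intro semi_ip.sym[OF H1_semi_ip] U)
next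
  case (4 F G K)
  have "H1_form (U (vadd T F G)) (U K) = H1_form (fadd (U F) (U G)) (U K)"
    using 4 by (intro U_unique vadd_vecs orth_add weight_one U) auto
  also have "\<dots> = H1_form (U F) (U K) + H1_form (U G) (U K)"
    using 4 by (intro semi_ip.add_left[OF H1_semi_ip] U)
  finally show ?case by (simp add: trace_ip_def)
next
  case (5 c F K)
  have "H1_form (U (vscale T c F)) (U K) = H1_form (fscl c (U F)) (U K)"
    using 5 by (intro U_unique vscale_vecs orth_scl weight_one U) auto
  also have "\<dots> = c * H1_form (U F) (U K)"
    using 5 by (intro semi_ip.scl_left[OF H1_semi_ip] U)
  finally show ?case by (simp add: trace_ip_def)
next
  case (6 F)
  then show ?case unfolding trace_ip_def by (intro semi_ip.nonneg[OF H1_semi_ip] U)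
qed

lemma trace_vnorm:
  assumes F: "F \<in> vecs T"
  shows "vnorm T F = sqrt (trace_ip F F)"
proof -
  have "vnorm T F = Inf {H1_norm \<Omega> u | u. u \<in> ext F}"
    by (simp add: trace_space_def ext_def)
  also have "\<dots> = H1_norm \<Omega> (U F)"
  proof (rule cInf_eq_minimum)
    show "H1_norm \<Omega> (U F) \<in> {H1_norm \<Omega> u | u. u \<in> ext F}" using U(1)[OF F] by blast
    fix r assume "r \<in> {H1_norm \<Omega> u | u. u \<in> ext F}"
    then obtain u where u: "u \<in> ext F" "r = H1_norm \<Omega> u" by blast
    show "H1_norm \<Omega> (U F) \<le> r"
      unfolding u(2) H1_norm_form using orth_minimal[OF weight_one _ F U(1,2)[OF F] u(1)] by simp
  qed
  finally show ?thesis by (simp add: H1_norm_form trace_ip_def)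
qed

lemma trace_semi_hspace: "semi_hspace T trace_ip"
proof -
  interpret S: semi_ip "vecs T" "vadd T" "vscale T" trace_ip by (rule trace_semi_ip)
  have tr: "has_trace \<Omega> (\<lambda>_. 0) (\<lambda>_. 0)" using zero_H1_0 by (simp add: H1_0_iff)
  have z: "vzero T = bc (\<lambda>_. 0)" by (simp add: trace_space_def)
  have zv: "vzero T \<in> vecs T" unfolding z by (rule bc_vecs[OF tr])
  have ze: "(\<lambda>_. 0) \<in> ext (vzero T)" unfolding z using tr ext_bc[OF has_trace_L2[OF tr]] by simp
  have form0: "H1_form (\<lambda>_. 0) x = 0" if "x \<in> H1 \<Omega>" for x
    using semi_ip.scl_left[OF H1_semi_ip H1_0_H1[OF zero_H1_0] that, of 0] by simp
  \<comment> \<open>The zero function is itself an orthogonal extension of the zero class and can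
    stand in for the chosen one.\<close>
  have zero: "trace_ip (vzero T) F = 0" if F: "F \<in> vecs T" for F
    unfolding trace_ip_def
    using U_unique[OF zv ze _ U(3)[OF F]] form0 U(3)[OF F] by (simp add: orth_def H1_0_H1)
  show ?thesis by standard (use zv zero trace_vnorm in auto)
qed

text \<open>\<open>W\<close> and \<open>V\<close> repeat the two choices inside \<open>DtN\<close>
  literally, so that unfolding identifies them.\<close>

definition W :: "('a \<Rightarrow> real) \<Rightarrow> ('a \<Rightarrow> real) set \<Rightarrow> 'a \<Rightarrow> real" where
  "W a F = (SOME u. weak_solution \<Omega> a F u)"

definition V :: "('a \<Rightarrow> real) set \<Rightarrow> 'a \<Rightarrow> real" where
  "V G = (SOME v. v \<in> H1 \<Omega> \<and> (\<exists>g\<in>G. has_trace \<Omega> v g))"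

lemma form_0: "form \<Omega> 0 a u v = energy \<Omega> a u v"
  by (simp add: form_def)

lemma weak_solution_iff: "weak_solution \<Omega> a F u \<longleftrightarrow> u \<in> ext F \<and> orth 0 a u"
  by (auto simp: weak_solution_def ext_def orth_def form_0)

lemma W:
  assumes a: "a \<in> admissible \<Omega>" and F: "F \<in> vecs T"
  shows "W a F \<in> ext F" "orth 0 a (W a F)" "W a F \<in> H1 \<Omega>"
proof -
  have "\<exists>u. weak_solution \<Omega> a F u"
    using orth_ext[OF a _ F, of 0] by (simp add: weak_solution_iff)
  then have "weak_solution \<Omega> a F (W a F)" unfolding W_def by (rule someI_ex)
  then show "W a F \<in> ext F" "orth 0 a (W a F)" "W a F \<in> H1 \<Omega>"
    using ext_H1 by (auto simp: weak_solution_iff)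
qed

lemma V:
  assumes "G \<in> vecs T"
  shows "V G \<in> ext G" "V G \<in> H1 \<Omega>"
proof -
  have "\<exists>v. v \<in> H1 \<Omega> \<and> (\<exists>g\<in>G. has_trace \<Omega> v g)"
    using ext_nonempty[OF assms] by (simp add: ext_def)
  then have "V G \<in> H1 \<Omega> \<and> (\<exists>g\<in>G. has_trace \<Omega> (V G) g)" unfolding V_def by (rule someI_ex)
  then show "V G \<in> ext G" "V G \<in> H1 \<Omega>" by (auto simp: ext_def)
qed

text \<open>Two extensions of \<open>G\<close> differ by an element of \<open>H1_0\<close>, to which
  the weak solution is orthogonal. Hence \<open>V G\<close> can later be exchanged for whichever
  extension is convenient.\<close>

lemma energy_ext:
  assumes a: "a \<in> admissible \<Omega>" and F: "F \<in> vecs T" and G: "G \<in> vecs T" and v: "v \<in> ext G"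
  shows "energy \<Omega> a (W a F) (V G) = energy \<Omega> a (W a F) v"
proof -
  interpret S: semi_ip "H1 \<Omega>" fadd fscl "form \<Omega> 0 a" by (rule form_semi_ip[OF weight_admissible[OF a]]) simp
  have "S.sub (V G) v \<in> H1_0 \<Omega>"
    using ext_diff[OF G V(1)[OF G] v] by (simp add: sub_eq)
  then have "form \<Omega> 0 a (W a F) (S.sub (V G) v) = 0" using W(2)[OF a F] by (simp add: orth_def)
  then show ?thesis using S.sub_right[OF V(2)[OF G] ext_H1[OF v] W(3)[OF a F]] by (simp add: form_0)
qed

lemma linear_deeponet_DtN:
  assumes a: "a \<in> admissible \<Omega>"
    and e: "orthonormal_basis T e" and g: "orthonormal_basis (dual_space T) g"
    and sets: "sets \<mu> = sets (borel_of T)"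
    and mom: "(\<integral>\<^sup>+f. ennreal (1 + (vnorm T f)\<^sup>2) \<partial>\<mu>) < \<infinity>"
    and eps: "\<epsilon> > 0"
  shows "\<exists>F \<in> deeponets \<sigma> T e (dual_space T) g.
    (\<integral>\<^sup>+f. ennreal ((vnorm (dual_space T) (vdiff (dual_space T) (DtN \<Omega> a f) (F f)))\<^sup>2) \<partial>\<mu>) < ennreal \<epsilon>"
proof -
  note wa = weight_admissible[OF a]
  interpret H: semi_hspace T trace_ip by (rule trace_semi_hspace)
  interpret E: semi_ip "H1 \<Omega>" fadd fscl "form \<Omega> 0 a" by (rule form_semi_ip[OF wa]) simp
  obtain A where "AE x in M. \<bar>a x\<bar> \<le> A" using a by (auto simp: admissible_def)
  then have A: "AE x in M. \<bar>a x\<bar> \<le> \<bar>A\<bar>" by eventually_elim auto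
  define L where "L F G = energy \<Omega> a (W a F) (V G)" for F G
  have L_form: "L F G = form \<Omega> 0 a (W a F) v" if "F \<in> vecs T" "G \<in> vecs T" "v \<in> ext G" for F G v
    using energy_ext[OF a that] by (simp add: L_def form_0)
  show ?thesis
  proof (rule H.linear_deeponet[OF e g sets, where L = L and C = "\<bar>A\<bar>"])
    have sp: "space \<mu> = vecs T"
      using sets_eq_imp_space_eq[OF sets] by (simp add: borel_of_def space_measure_of_conv)
    have "(\<integral>\<^sup>+f. ennreal (trace_ip f f) \<partial>\<mu>) \<le> (\<integral>\<^sup>+f. ennreal (1 + (vnorm T f)\<^sup>2) \<partial>\<mu>)"
      by (intro nn_integral_mono ennreal_leI) (simp add: sp H.vnorm_nrm H.nrm_sq)
    then show "(\<integral>\<^sup>+f. ennreal (trace_ip f f) \<partial>\<mu>) < \<infinity>" using mom by (rule le_less_trans)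
    show "DtN \<Omega> a F = (\<lambda>x\<in>vecs T. L F x)" for F
      by (simp add: DtN_def L_def W_def V_def)
    show "L (vadd T F F') G = L F G + L F' G" if F: "F \<in> vecs T" and F': "F' \<in> vecs T" and G: "G \<in> vecs T" for F F' G
    proof -
      \<comment> \<open>The solution chosen for the sum need not be the sum of the chosen solutions;
        both are orthogonal extensions of the same class, so the form gives them equal
        values.\<close>
      have "form \<Omega> 0 a (W a (vadd T F F')) (V G) = form \<Omega> 0 a (fadd (W a F) (W a F')) (V G)"
        by (rule orth_unique[OF wa order_refl vadd_vecs(1)[OF F F'] W(1,2)[OF a vadd_vecs(1)[OF F F']]
              vadd_vecs(2)[OF F F' W(1)[OF a F] W(1)[OF a F']]
              orth_add[OF wa order_refl W(3,2)[OF a F] W(3,2)[OF a F']] V(2)[OF G]])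
      also have "\<dots> = form \<Omega> 0 a (W a F) (V G) + form \<Omega> 0 a (W a F') (V G)"
        using F F' G by (intro E.add_left W[OF a] V)
      finally show ?thesis by (simp add: L_def form_0)
    qed
    show "L (vscale T c F) G = c * L F G" if F: "F \<in> vecs T" and G: "G \<in> vecs T" for c F G
    proof -
      have "form \<Omega> 0 a (W a (vscale T c F)) (V G) = form \<Omega> 0 a (fscl c (W a F)) (V G)"
        by (rule orth_unique[OF wa order_refl vscale_vecs(1)[OF F] W(1,2)[OF a vscale_vecs(1)[OF F]]
              vscale_vecs(2)[OF F W(1)[OF a F]] orth_scl[OF wa order_refl W(3,2)[OF a F]] V(2)[OF G]])
      also have "\<dots> = c * form \<Omega> 0 a (W a F) (V G)"
        using F G by (intro E.scl_left W[OF a] V)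
      finally show ?thesis by (simp add: L_def form_0)
    qed
    show "L F (vadd T G G') = L F G + L F G'" if F: "F \<in> vecs T" and G: "G \<in> vecs T" "G' \<in> vecs T" for F G G'
      using L_form[OF F vadd_vecs(1)[OF G] vadd_vecs(2)[OF G V(1)[OF G(1)] V(1)[OF G(2)]]]
        L_form[OF F G(1) V(1)[OF G(1)]] L_form[OF F G(2) V(1)[OF G(2)]]
        E.add_right[OF V(2)[OF G(1)] V(2)[OF G(2)] W(3)[OF a F]] by simp
    show "L F (vscale T c G) = c * L F G" if F: "F \<in> vecs T" and G: "G \<in> vecs T" for c F G
      using L_form[OF F vscale_vecs(1)[OF G] vscale_vecs(2)[OF G V(1)[OF G]]]
        L_form[OF F G V(1)[OF G]] E.scl_right[OF V(2)[OF G] W(3)[OF a F]] by simp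
    \<comment> \<open>Three exchanges: \<open>V G\<close> becomes \<open>U G\<close>, the energy of
      the weak solution is at most that of \<open>U F\<close>, and the energy norm of a minimal
      extension is at most \<open>sqrt \<bar>A\<bar>\<close> times the trace norm.\<close>
    show "\<bar>L F G\<bar> \<le> \<bar>A\<bar> * H.nrm F * H.nrm G" if F: "F \<in> vecs T" and G: "G \<in> vecs T" for F G
    proof -
      have q: "E.nrm (U X) \<le> sqrt \<bar>A\<bar> * H.nrm X" if X: "X \<in> vecs T" for X
      proof -
        have "form \<Omega> 0 a (U X) (U X) \<le> (0 + \<bar>A\<bar>) * H1_form (U X) (U X)"
          by (rule form_le[OF wa _ A _ U(3)[OF X]]) auto
        then have "sqrt (form \<Omega> 0 a (U X) (U X)) \<le> sqrt (\<bar>A\<bar> * trace_ip X X)"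
          by (intro real_sqrt_le_mono) (simp add: trace_ip_def)
        then show ?thesis by (simp add: E.nrm_def H.nrm_def real_sqrt_mult)
      qed
      have "E.nrm (W a F) \<le> E.nrm (U F)"
        unfolding E.nrm_def using orth_minimal[OF wa _ F W(1,2)[OF a F] U(1)[OF F]] by simp
      then have w: "E.nrm (W a F) \<le> sqrt \<bar>A\<bar> * H.nrm F" using q[OF F] by linarith
      have "\<bar>L F G\<bar> \<le> E.nrm (W a F) * E.nrm (U G)"
        unfolding L_form[OF F G U(1)[OF G]] by (rule E.abs_le_nrm[OF W(3)[OF a F] U(3)[OF G]])
      also have "\<dots> \<le> (sqrt \<bar>A\<bar> * H.nrm F) * (sqrt \<bar>A\<bar> * H.nrm G)"
        using F G by (intro mult_mono w q mult_nonneg_nonneg E.nrm_nonneg H.nrm_nonneg U) auto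
      also have "\<dots> = (sqrt \<bar>A\<bar> * sqrt \<bar>A\<bar>) * H.nrm F * H.nrm G" by (simp only: mult_ac)
      also have "\<dots> = \<bar>A\<bar> * H.nrm F * H.nrm G" by simp
      finally show ?thesis .
    qed
  qed (use eps in auto)
qed

end

section \<open>Approximation of the Dirichlet-to-Neumann operator\<close>

text \<open>That the Hausdorff measure is countably additive on Borel sets need not be known: if it
  is not, \<open>measure_of\<close> returns the null measure, all traces are identified, and the trace space
  has no unit vector.\<close>

lemma (in bounded_open) surface_measure_hausdorff:
  assumes e: "orthonormal_basis T e" and A: "A \<in> sets \<Sigma>"
  shows "emeasure \<Sigma> A = hausdorff (DIM('a) - 1) A"
proof -
  let ?S = "sets (restrict_space borel (frontier \<Omega>))"
  show ?thesis
  proof (cases "measure_space (frontier \<Omega>) (sigma_sets (frontier \<Omega>) ?S) (hausdorff (DIM('a) - 1))")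
    case True
    have "A \<in> ?S" using A sets_\<Sigma> by simp
    then have "A \<in> sigma_sets (frontier \<Omega>) ?S" by (rule sigma_sets.Basic)
    then show ?thesis using True unfolding surface_measure_def by (subst emeasure_measure_of_conv) simp
  next
    case False
    have "emeasure \<Sigma> X = 0" for X
      using False unfolding surface_measure_def by (subst emeasure_measure_of_conv) simp
    then have AE: "AE x in \<Sigma>. P x" for P
      by (intro AE_I'[of "space \<Sigma>"]) (auto simp: null_sets_def)
    \<comment> \<open>Every property now holds almost everywhere, so all square-integrable boundary
      functions fall into one class, which contains the trace of the zero function.\<close>
    then have bc: "bc f = L2 \<Sigma>" for f by (auto simp: bdry_class_def)
    have tr: "has_trace \<Omega> (\<lambda>_. 0) (\<lambda>_. 0)" using zero_H1_0 by (simp add: H1_0_iff)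
    have n0: "vnorm T (L2 \<Sigma>) = 0"
    proof -
      have "vnorm T (L2 \<Sigma>) = Inf {H1_norm \<Omega> u | u. u \<in> ext (L2 \<Sigma>)}"
        by (simp add: trace_space_def ext_def)
      also have "\<dots> = 0"
      proof (rule cInf_eq_minimum)
        have "(\<lambda>_. 0) \<in> ext (L2 \<Sigma>)"
          using tr has_trace_L2[OF tr] has_trace_H1[OF tr] by (auto simp: ext_def)
        moreover have "H1_norm \<Omega> (\<lambda>_. 0) = 0" using H1_norm_scl[OF has_trace_H1[OF tr], of 0] by simp
        ultimately show "0 \<in> {H1_norm \<Omega> u | u. u \<in> ext (L2 \<Sigma>)}" by force
      qed (auto intro: H1_norm_nonneg ext_H1)
      finally show ?thesis .
    qed
    have "e 0 \<in> vecs T" using e by (auto simp: orthonormal_basis_def)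
    then have "e 0 = L2 \<Sigma>" by (rule vecs_bc) (simp add: bc)
    moreover have "vadd T (L2 \<Sigma>) (L2 \<Sigma>) = L2 \<Sigma>" "vscale T (-1) (L2 \<Sigma>) = L2 \<Sigma>"
      using vadd_bc[OF has_trace_L2[OF tr] has_trace_L2[OF tr]] vscale_bc[OF has_trace_L2[OF tr], of "-1"]
      by (simp_all add: bc)
    ultimately have "vinner T (e 0) (e 0) = 0" by (simp add: vinner_def vdiff_def n0)
    then show ?thesis using e by (auto simp: orthonormal_basis_def)
  qed
qed

theorem theorem4p2:
  fixes \<Omega> :: "'a::euclidean_space set"
    and a :: "'a \<Rightarrow> real"
    and \<sigma> :: "real \<Rightarrow> real"
    and e :: "nat \<Rightarrow> ('a \<Rightarrow> real) set"
    and g :: "nat \<Rightarrow> ('a \<Rightarrow> real) set \<Rightarrow> real"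
    and \<mu> :: "('a \<Rightarrow> real) set measure"
    and \<epsilon> :: real
  assumes "DIM('a) \<ge> 2"
    and "smooth_bounded_domain \<Omega>"
    and "a \<in> admissible \<Omega>"
    and "continuous_on UNIV \<sigma>"
    and "\<not> (\<exists>p. \<sigma> = poly p)"
    and "orthonormal_basis (trace_space \<Omega>) e"
    and "orthonormal_basis (dual_space (trace_space \<Omega>)) g"
    and "sets \<mu> = sets (borel_of (trace_space \<Omega>))"
    and "finite_measure \<mu>"
    and "(\<integral>\<^sup>+f. ennreal (1 + (vnorm (trace_space \<Omega>) f)\<^sup>2) \<partial>\<mu>) < \<infinity>"
    and "\<epsilon> > 0"
  shows "\<exists>F \<in> deeponets \<sigma> (trace_space \<Omega>) e (dual_space (trace_space \<Omega>)) g.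
    (\<integral>\<^sup>+f. ennreal ((vnorm (dual_space (trace_space \<Omega>))
       (vdiff (dual_space (trace_space \<Omega>)) (DtN \<Omega> a f) (F f)))\<^sup>2) \<partial>\<mu>) < ennreal \<epsilon>"
proof -
  interpret bounded_open \<Omega>
    using assms(2) by unfold_locales (auto simp: smooth_bounded_domain_def)
  \<comment> \<open>The basis \<open>e\<close> certifies through its unit vectors that the surface
    measure takes the Hausdorff values, which the boundary term in Friedrichs' inequality relies
    on.\<close>
  interpret friedrichs_domain \<Omega>
    using friedrichs[OF assms(1) surface_measure_hausdorff[OF assms(6)]] by unfold_locales
  show ?thesis
    by (rule linear_deeponet_DtN[OF assms(3,6,7,8,10,11)])
qed

end
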